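(* Let $G$ and $H$ be groups. If $G$ and $H$ each admit $\mathcal{EZ}$-structures, then the direct product $G\times H$ admits an $\mathcal{EZ}$-structure.
   Context: All spaces are locally compact, separable metric spaces. Groups are discrete and act by homeomorphisms. A separable metric space $X$ is an absolute neighborhood retract (ANR) if, whenever $X$ is embedded as a closed subset of a separable metric space $Y$, some neighborhood of $X$ in $Y$ retracts onto $X$. A space is a Euclidean retract (ER) if it can be embedded in some Euclidean space as a retract of it. A closed subset $Z$ of an ANR $\widehat{X}$ is a $\mathcal{Z}$-set in $\widehat{X}$ if there is a homotopy $F:\widehat{X}\times[0,1]\to\widehat{X}$ with $F_0=\mathrm{id}_{\widehat{X}}$ and $F_t(\widehat{X})\cap Z=\emptyset$ for all $t>0$. An ANR $\widehat{X}$ is a $\mathcal{Z}$-compactification of $X$ if $X\subseteq\widehat{X}$, $\widehat{X}$ is compact, and $\widehat{X}\setminus X$ is a $\mathcal{Z}$-set in $\widehat{X}$. An action of $G$ on $X$ is proper if every $x\in X$ has a neighborhood $U$ with $g(U)\cap U=\emptyset$ for all but finitely many $g\in G$; it is cocompact if there is a compact $K\subseteq X$ with $\bigcup_{g\in G}gK=X$. A $\mathcal{Z}$-compactification $\widehat{X}$ of $X$ satisfies the null condition with respect to a proper cocompact action of $G$ on $X$ if for every compact $C\subseteq X$ and every open cover $\mathcal{U}$ of $\widehat{X}$ there is a finite $\Gamma\subseteq G$ such that for each $g\in G\setminus\Gamma$, $gC$ is contained in a single element of $\mathcal{U}$. A $\mathcal{Z}$-structure on a group $G$ is a pair $(\widehat{X},Z)$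 of spaces such that: (1) $\widehat{X}$ is a compact ER; (2) $\widehat{X}$ is a $\mathcal{Z}$-compactification of $X:=\widehat{X}\setminus Z$; (3) $G$ acts properly and cocompactly on $X$; (4) $\widehat{X}$ satisfies the null condition with respect to the action of $G$ on $X$. (Groups may have torsion.) An $\mathcal{EZ}$-structure on $G$ is a $\mathcal{Z}$-structure $(\widehat{X},Z)$ on $G$ such that the action of $G$ on $X=\widehat{X}\setminus Z$ extends to an action of $G$ on $\widehat{X}$. *)

theory Defs
  imports "HOL-Analysis.Analysis" "HOL-Algebra.Group_Action"
begin

text \<open>
  Spaces are abstract topologies; a separable metric space is a topology that is metrizable
  and separable (no metric is fixed). Every separable metric space is homeomorphic to a
  subspace of \<open>\<real>\<close> to the power \<open>\<nat>\<close>, so letting the ambient space \<open>Y\<close> range over all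
  separable metrizable topologies on subsets of the type \<open>nat \<Rightarrow> real\<close> amounts to
  quantifying over all separable metric spaces. (The library's \<^term>\<open>ANR\<close> is for subsets of a
  fixed Euclidean type and does not apply to abstract topologies.)
\<close>

definition ANR_space :: "'x topology \<Rightarrow> bool" where
  "ANR_space X \<longleftrightarrow> metrizable_space X \<and> separable_space X \<and>
     (\<forall>(Y :: (nat \<Rightarrow> real) topology) f.
        metrizable_space Y \<and> separable_space Y \<and>
        embedding_map X Y f \<and> closedin Y (f ` topspace X) \<longrightarrow>
        (\<exists>V. openin Y V \<and> f ` topspace X \<subseteq> V \<and>
             f ` topspace X retract_of_space subtopology Y V))"

definition ER_space :: "'x topology \<Rightarrow> bool" where
  "ER_space X \<longleftrightarrow>
     (\<exists>n f. embedding_map X (Euclidean_space n) f \<and>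
            f ` topspace X retract_of_space Euclidean_space n)"

definition Z_set :: "'x topology \<Rightarrow> 'x set \<Rightarrow> bool" where
  "Z_set Xh Z \<longleftrightarrow> ANR_space Xh \<and> closedin Xh Z \<and>
     (\<exists>F. continuous_map (prod_topology Xh (top_of_set {0..1::real})) Xh F \<and>
          (\<forall>x\<in>topspace Xh. F (x, 0) = x) \<and>
          (\<forall>t\<in>{0<..1}. (\<lambda>x. F (x, t)) ` topspace Xh \<inter> Z = {}))"

text \<open>The compactified space is the set \<open>X\<close> with the topology induced from \<open>Xh\<close>.\<close>

definition Z_compactification :: "'x topology \<Rightarrow> 'x set \<Rightarrow> bool" where
  "Z_compactification Xh X \<longleftrightarrow> ANR_space Xh \<and> X \<subseteq> topspace Xh \<and> compact_space Xh \<and>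
     Z_set Xh (topspace Xh - X)"

text \<open>
  In the library, \<^term>\<open>group_action G E \<phi>\<close> means that \<open>\<phi>\<close> is a homomorphism from \<open>G\<close> to the
  group of bijections of \<open>E\<close>; these are represented as functions that are
  \<^term>\<open>undefined\<close> outside \<open>E\<close>.
\<close>

definition acts_by_homeos ::
    "('g, 'm) monoid_scheme \<Rightarrow> 'x topology \<Rightarrow> ('g \<Rightarrow> 'x \<Rightarrow> 'x) \<Rightarrow> bool" where
  "acts_by_homeos G X \<phi> \<longleftrightarrow>
     group_action G (topspace X) \<phi> \<and> (\<forall>g\<in>carrier G. homeomorphic_map X X (\<phi> g))"

definition proper_action ::
    "('g, 'm) monoid_scheme \<Rightarrow> 'x topology \<Rightarrow> ('g \<Rightarrow> 'x \<Rightarrow> 'x) \<Rightarrow> bool" where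
  "proper_action G X \<phi> \<longleftrightarrow>
     (\<forall>x\<in>topspace X. \<exists>U. openin X U \<and> x \<in> U \<and>
        finite {g \<in> carrier G. \<phi> g ` U \<inter> U \<noteq> {}})"

definition cocompact_action ::
    "('g, 'm) monoid_scheme \<Rightarrow> 'x topology \<Rightarrow> ('g \<Rightarrow> 'x \<Rightarrow> 'x) \<Rightarrow> bool" where
  "cocompact_action G X \<phi> \<longleftrightarrow>
     (\<exists>K. compactin X K \<and> (\<Union>g\<in>carrier G. \<phi> g ` K) = topspace X)"

definition null_condition ::
    "('g, 'm) monoid_scheme \<Rightarrow> 'x topology \<Rightarrow> 'x set \<Rightarrow> ('g \<Rightarrow> 'x \<Rightarrow> 'x) \<Rightarrow> bool" where
  "null_condition G Xh X \<phi> \<longleftrightarrow>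
     (\<forall>C \<U>. compactin (subtopology Xh X) C \<and>
        (\<forall>U\<in>\<U>. openin Xh U) \<and> \<Union>\<U> = topspace Xh \<longrightarrow>
        (\<exists>\<Gamma>. finite \<Gamma> \<and> \<Gamma> \<subseteq> carrier G \<and>
             (\<forall>g\<in>carrier G - \<Gamma>. \<exists>U\<in>\<U>. \<phi> g ` C \<subseteq> U)))"

text \<open>The action \<open>\<phi>\<close> of \<open>G\<close> on the complement of \<open>Z\<close> is an explicit parameter.\<close>

definition Z_structure ::
    "('g, 'm) monoid_scheme \<Rightarrow> 'x topology \<Rightarrow> 'x set \<Rightarrow> ('g \<Rightarrow> 'x \<Rightarrow> 'x) \<Rightarrow> bool" where
  "Z_structure G Xh Z \<phi> \<longleftrightarrow> Z \<subseteq> topspace Xh \<and>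
     (let X = topspace Xh - Z in
        compact_space Xh \<and> ER_space Xh \<and>
        Z_compactification Xh X \<and>
        acts_by_homeos G (subtopology Xh X) \<phi> \<and>
        proper_action G (subtopology Xh X) \<phi> \<and>
        cocompact_action G (subtopology Xh X) \<phi> \<and>
        null_condition G Xh X \<phi>)"

definition EZ_structure ::
    "('g, 'm) monoid_scheme \<Rightarrow> 'x topology \<Rightarrow> 'x set \<Rightarrow> ('g \<Rightarrow> 'x \<Rightarrow> 'x) \<Rightarrow> bool" where
  "EZ_structure G Xh Z \<phi> \<longleftrightarrow> Z_structure G Xh Z \<phi> \<and>
     (\<exists>\<psi>. acts_by_homeos G Xh \<psi> \<and>
          (\<forall>g\<in>carrier G. \<forall>x\<in>topspace Xh - Z. \<psi> g x = \<phi> g x))"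

text \<open>
  HOL cannot quantify existentially over types, so the type carrying the points of the space is
  a parameter. The choice \<^typ>\<open>nat \<Rightarrow> real\<close> is universal: a Euclidean retract is
  homeomorphic to a subspace of some \<^term>\<open>Euclidean_space n\<close>, which lives on that type.
\<close>

definition admits_EZ_structure :: "'x itself \<Rightarrow> ('g, 'm) monoid_scheme \<Rightarrow> bool" where
  "admits_EZ_structure (_ :: 'x itself) G \<longleftrightarrow>
     (\<exists>(Xh :: 'x topology) Z \<phi>. EZ_structure G Xh Z \<phi>)"

lemma metrizable_separable_imp_second_countable:
  assumes "metrizable_space X" and "separable_space X"
  shows "second_countable X"
proof -
  obtain M d where M: "Metric_space M d" and X: "X = Metric_space.mtopology M d"
    using assms(1) unfolding metrizable_space_def by blast
  interpret Metric_space M d by (rule M)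
  obtain C where C: "countable C" "C \<subseteq> M" "mtopology closure_of C = M"
    using assms(2) unfolding separable_space_def X by auto
  let ?B = "(\<lambda>(c, n). mball c (1 / real (Suc n))) ` (C \<times> UNIV)"
  have "\<exists>V\<in>?B. x \<in> V \<and> V \<subseteq> U" if U: "openin mtopology U" and x: "x \<in> U" for U x
  proof -
    obtain r where r: "r > 0" "mball x r \<subseteq> U" and xM: "x \<in> M"
      using U x unfolding openin_mtopology by blast
    obtain n where n: "1 / real (Suc n) < r / 2"
      using r(1) by (metis half_gt_zero nat_approx_posE)
    have "x \<in> mtopology closure_of C"
      using C(3) xM by simp
    moreover have "openin mtopology (mball x (1 / real (Suc n)))"
      by (rule openin_mball)
    moreover have "x \<in> mball x (1 / real (Suc n))"
      using xM by (simp add: centre_in_mball_iff)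
    ultimately obtain c where c: "c \<in> C" "c \<in> mball x (1 / real (Suc n))"
      unfolding in_closure_of by blast
    have cM: "c \<in> M" and dc: "d x c < 1 / real (Suc n)"
      using c C(2) by auto
    have "x \<in> mball c (1 / real (Suc n))"
      using cM dc xM by (simp add: commute)
    moreover have "mball c (1 / real (Suc n)) \<subseteq> mball x r"
    proof
      fix y assume y: "y \<in> mball c (1 / real (Suc n))"
      then have "d x y \<le> d x c + d c y"
        using triangle xM cM by auto
      also have "\<dots> < r"
        using y dc n by (simp only: in_mball) linarith
      finally show "y \<in> mball x r"
        using y xM by simp
    qed
    ultimately show ?thesis
      using c(1) r(2) by blast
  qed
  moreover have "countable ?B"
    using C(1) by simp
  moreover have "\<forall>V\<in>?B. openin mtopology V"
    by auto
  ultimately show ?thesis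
    unfolding second_countable_def X by (intro exI[of _ ?B] conjI allI impI) simp_all
qed

text \<open>
  All spaces are meant to be locally compact, separable and metrizable. This is not assumed
  separately, because it follows for both members of the pair and for the complement:
\<close>

lemma Z_structure_spaces:
  assumes "Z_structure G Xh Z \<phi>" and "S \<in> {topspace Xh, Z, topspace Xh - Z}"
  shows "locally_compact_space (subtopology Xh S)"
    and "separable_space (subtopology Xh S)"
    and "metrizable_space (subtopology Xh S)"
proof -
  have met: "metrizable_space Xh" and sep: "separable_space Xh" and comp: "compact_space Xh"
    and sub: "Z \<subseteq> topspace Xh" and "closedin Xh (topspace Xh - (topspace Xh - Z))"
    using assms(1)
    by (auto simp: Z_structure_def Let_def Z_compactification_def Z_set_def ANR_space_def)
  then have cl: "closedin Xh Z"
    by (simp add: double_diff)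
  have haus: "Hausdorff_space Xh"
    using met by (rule metrizable_imp_Hausdorff_space)
  have lc: "locally_compact_space Xh"
    using comp by (simp add: compact_imp_locally_compact_space)
  have "closedin Xh S \<or> openin Xh S"
    using assms(2) cl by auto
  then show "locally_compact_space (subtopology Xh S)"
    using lc haus locally_compact_space_closed_subset locally_compact_space_open_subset by blast
  show "metrizable_space (subtopology Xh S)"
    using met by (rule metrizable_space_subtopology)
  show "separable_space (subtopology Xh S)"
    using metrizable_separable_imp_second_countable[OF met sep]
    by (rule second_countable_imp_separable_space[OF second_countable_subtopology])
qed

end

theory Submission
  imports Defs
begin

text \<open>
  The boundary of the product is to be the join of the two boundaries: points $(x_i, y_i)$ that
  leave every compact subset of $X \times Y$ should converge according to the limits of $x_i$ and
  $y_i$ in the two compactifications and to the limiting ratio of the speeds at which the two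
  coordinates escape. This is sensible only if speed is measured so that the limiting ratio does
  not change when the points move inside translates of a fixed compact set (null condition), are
  moved by a fixed group element (extension of the action), or are pushed off the boundary by the
  given homotopy (Z-set condition).

  So everything rests on a good gauge $a$ on each compactification: a continuous function with
  values in the unit interval, vanishing exactly on the boundary, such that $1/a$ changes only by
  a bounded amount under the first two moves, while after pushing for time $t$ it agrees, up to a
  bounded amount, with the smaller of $1/a$ and $1/t$. Each of these demands says that a certain
  compact set is carried into a compact set. Hence they all hold from one level to the next along
  a sequence of levels decreasing fast enough, and rescaling the levels to $1, 1/2, 1/3, \dots$
  turns them into bounds on $1/a$ (\<open>adapted_rescaling\<close>, \<open>euclidean_EZ.exists_controlled\<close>).

  With gauges $a$ and $b$, the compactification is the set of points $(1-s)x + sy$ of the join of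
  the two compact factors that satisfy $(1-s)\,a(x) = s\,b(y)$. Over $X \times Y$ this forces
  $s = a(x)/(a(x)+b(y))$; at infinity it leaves exactly the join of the two boundaries. A bounded
  error in $1/a$ and $1/b$ changes $s$ by a multiple of $a + b$ only (\<open>slope_estimate\<close>), and
  so it disappears at infinity. This gives continuity of the extended action and the null
  condition (\<open>pair_act_cont\<close>, \<open>pair_act_null\<close>).

  The homotopy off the boundary pushes the two coordinates for times proportional to $s$ and $1-s$,
  so that the ratio $s$ survives; near the two ends of the join, where one coordinate is
  collapsed, that coordinate is contracted to a point (\<open>push_time\<close>, \<open>push_cont\<close>).

  That the result is a Euclidean retract follows from this homotopy. The complement of the
  boundary is an absolute extensor in each factor (\<open>absolute_extensor_pushed_off\<close>), hence also
  in the product, and a compact set that is pushed instantly into an absolute extensor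
  inside itself is a retract of every Euclidean space around it
  (\<open>instant_homotopy_retraction\<close>).
\<close>

section \<open>Rescaling fast decreasing levels to the harmonic sequence\<close>

text \<open>
  A sum of clamped linear ramps, the \<open>n\<close>-th rising by $1/(n+1) - 1/(n+2)$ between the
  consecutive levels \<open>\<epsilon> (Suc n)\<close> and \<open>\<epsilon> n\<close>. The heights are summable, so the Weierstrass test gives
  continuity, and they telescope to the prescribed values.
\<close>
lemma staircase_rescaling:
  fixes \<epsilon> :: "nat \<Rightarrow> real"
  assumes e0: "\<epsilon> 0 = 1" and pos: "\<And>n. 0 < \<epsilon> n" and dec: "\<And>n. \<epsilon> (Suc n) < \<epsilon> n" and lim: "\<epsilon> \<longlonglongrightarrow> 0"
  obtains l where "continuous_on {0..1} l" "strict_mono_on {0..1} l" "l 0 = (0::real)"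
    "\<And>n. l (\<epsilon> n) = 1 / real (Suc n)"
proof -
  define c where "c n = 1 / real (Suc n) - 1 / real (Suc (Suc n))" for n
  define u where "u n r = max 0 (min 1 ((r - \<epsilon> (Suc n)) / (\<epsilon> n - \<epsilon> (Suc n))))" for n r
  define l where "l r = (\<Sum>n. c n * u n r)" for r
  have c_pos: "c n > 0" for n by (simp add: c_def divide_strict_left_mono)
  have u01: "0 \<le> u n r" "u n r \<le> 1" for n r by (auto simp: u_def)
  have c_tail: "(\<lambda>n. c (n + m)) sums (1 / real (Suc m))" for m
  proof -
    have "(\<lambda>n. 1 / real (Suc (n + m))) \<longlonglongrightarrow> 0"
      using LIMSEQ_ignore_initial_segment[OF LIMSEQ_inverse_real_of_nat, of m] by (simp add: inverse_eq_divide)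
    from telescope_sums'[OF this] show ?thesis by (simp add: c_def)
  qed
  have csum: "summable c" using c_tail[of 0] by (simp add: sums_iff)
  have sm: "summable (\<lambda>n. c n * u n r)" for r
    by (rule summable_comparison_test'[OF csum, of 0])
      (use c_pos u01 in \<open>auto simp: abs_mult less_imp_le mult_left_le\<close>)
  have ul: "uniform_limit {0..1} (\<lambda>n r. \<Sum>i<n. c i * u i r) l sequentially"
    unfolding l_def
    by (rule Weierstrass_m_test[OF _ csum]) (use c_pos u01 in \<open>auto simp: abs_mult less_imp_le mult_left_le\<close>)
  have cont: "continuous_on {0..1} l"
  proof (rule uniform_limit_theorem[OF _ ul])
    show "\<forall>\<^sub>F n in sequentially. continuous_on {0..1} (\<lambda>r. \<Sum>i<n. c i * u i r)"
      unfolding u_def using dec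
      by (intro always_eventually allI continuous_intros) (simp add: less_imp_neq[THEN not_sym])
  qed simp
  have decm: "m \<le> n \<Longrightarrow> \<epsilon> n \<le> \<epsilon> m" for m n
    using dec by (meson decseq_SucI decseqD less_imp_le)
  have u_mono: "u n r \<le> u n r'" if "r \<le> r'" for n r r'
  proof -
    have "(r - \<epsilon> (Suc n)) / (\<epsilon> n - \<epsilon> (Suc n)) \<le> (r' - \<epsilon> (Suc n)) / (\<epsilon> n - \<epsilon> (Suc n))"
      using that dec[of n] by (intro divide_right_mono) auto
    then show ?thesis unfolding u_def by linarith
  qed
  have smono: "strict_mono_on {0..1} l"
  proof (rule strict_mono_onI)
    fix r r' :: real assume r: "r \<in> {0..1}" "r' \<in> {0..1}" "r < r'"
    \<comment> \<open>The ramp between the two levels that enclose the larger argument separates the two values.\<close>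
    obtain k where "\<epsilon> k < r'"
      using order_tendstoD(2)[OF lim, of r'] r by (auto simp: eventually_sequentially)
    define k where "k = (LEAST k. \<epsilon> k < r')"
    have k: "\<epsilon> k < r'" unfolding k_def by (rule LeastI) fact
    have "k \<noteq> 0" by (rule notI) (use k e0 r in simp)
    then obtain n where n: "k = Suc n" by (cases k) auto
    have "r' \<le> \<epsilon> n" using not_less_Least[of n "\<lambda>k. \<epsilon> k < r'"] n unfolding k_def[symmetric] by auto
    moreover have "(r - \<epsilon> (Suc n)) / (\<epsilon> n - \<epsilon> (Suc n)) < (r' - \<epsilon> (Suc n)) / (\<epsilon> n - \<epsilon> (Suc n))"
      using r dec[of n] by (intro divide_strict_right_mono) auto
    moreover have "0 < (r' - \<epsilon> (Suc n)) / (\<epsilon> n - \<epsilon> (Suc n))" using k n dec[of n] by simp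
    moreover have "(r' - \<epsilon> (Suc n)) / (\<epsilon> n - \<epsilon> (Suc n)) \<le> 1"
      using \<open>r' \<le> \<epsilon> n\<close> dec[of n] by simp
    ultimately have "u n r < u n r'" unfolding u_def by linarith
    then have "0 < c n * u n r' - c n * u n r" using c_pos[of n] by simp
    then have "0 < (\<Sum>n. c n * u n r' - c n * u n r)"
      using u_mono[of r r'] r c_pos
      by (intro suminf_pos2[of _ n] summable_diff sm) (auto simp: less_imp_le mult_left_mono)
    then show "l r < l r'" unfolding l_def by (simp add: suminf_diff[OF sm sm, symmetric])
  qed
  have l0: "l 0 = 0"
  proof -
    have "u n 0 = 0" for n
    proof -
      have "(0 - \<epsilon> (Suc n)) / (\<epsilon> n - \<epsilon> (Suc n)) \<le> 0"
        using pos[of "Suc n"] dec[of n] by (intro divide_nonpos_nonneg) auto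
      then show ?thesis by (simp add: u_def)
    qed
    then show ?thesis by (simp add: l_def)
  qed
  have le: "l (\<epsilon> m) = 1 / real (Suc m)" for m
  proof -
    have 1: "u n (\<epsilon> m) = 1" if "m \<le> n" for n
    proof -
      have "1 \<le> (\<epsilon> m - \<epsilon> (Suc n)) / (\<epsilon> n - \<epsilon> (Suc n))"
        using decm[OF that] dec[of n] by simp
      then show ?thesis by (simp add: u_def)
    qed
    have 0: "u n (\<epsilon> m) = 0" if "n < m" for n
    proof -
      have "(\<epsilon> m - \<epsilon> (Suc n)) / (\<epsilon> n - \<epsilon> (Suc n)) \<le> 0"
        using decm[of "Suc n" m] that dec[of n] by (intro divide_nonpos_nonneg) auto
      then show ?thesis by (simp add: u_def)
    qed
    have "(\<lambda>n. c (n + m) * u (n + m) (\<epsilon> m)) sums (1 / real (Suc m))"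
      using c_tail[of m] 1 by simp
    then have "(\<lambda>n. c n * u n (\<epsilon> m)) sums (1 / real (Suc m) + (\<Sum>n<m. c n * u n (\<epsilon> m)))"
      by (rule sums_iff_shift[THEN iffD1])
    then show ?thesis using 0 by (simp add: l_def sums_iff)
  qed
  show ?thesis by (rule that[OF cont smono l0 le])
qed

text \<open>
  This turns growth conditions into bounds. A relation \<open>Good n \<epsilon> \<delta>\<close> that holds
  for all small \<open>\<delta>\<close> can be made to hold along a whole sequence of levels, by choosing the next
  level small enough; the homeomorphism \<open>l\<close> of the unit interval, with inverse \<open>s\<close>, then spaces
  the levels harmonically, so that one step between levels changes the reciprocal by one.
\<close>
lemma adapted_rescaling:
  fixes Good :: "nat \<Rightarrow> real \<Rightarrow> real \<Rightarrow> bool"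
  assumes good: "\<And>n \<epsilon>. 0 < \<epsilon> \<Longrightarrow> \<exists>\<delta>0>0. \<forall>\<delta>. 0 < \<delta> \<and> \<delta> \<le> \<delta>0 \<longrightarrow> Good n \<epsilon> \<delta>"
  obtains \<epsilon> l s where "\<And>n. 0 < \<epsilon> n" "\<And>n. \<epsilon> n \<le> 1" "\<And>n. Good n (\<epsilon> n) (\<epsilon> (Suc n))"
    "continuous_on {0..1} l" "\<And>r. r \<in> {0..1} \<Longrightarrow> l r \<in> {0..1}" "l 0 = (0::real)"
    "\<And>n. l (\<epsilon> n) = 1 / real (Suc n)"
    "\<And>r r'. r \<in> {0..1} \<Longrightarrow> r' \<in> {0..1} \<Longrightarrow> l r \<le> l r' \<longleftrightarrow> r \<le> r'"
    "continuous_on {0..1} s" "\<And>t. t \<in> {0..1} \<Longrightarrow> s t \<in> {0..1}" "\<And>t. t \<in> {0..1} \<Longrightarrow> l (s t) = t"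
    "s 0 = (0::real)" "s 1 = 1"
proof -
  have "\<exists>\<epsilon>. \<forall>n. (0 < \<epsilon> n \<and> (n = 0 \<longrightarrow> \<epsilon> n = (1::real))) \<and> (Good n (\<epsilon> n) (\<epsilon> (Suc n)) \<and> \<epsilon> (Suc n) \<le> \<epsilon> n / 2)"
  proof (rule dependent_nat_choice)
    show "\<exists>x. 0 < x \<and> (0 = (0::nat) \<longrightarrow> x = (1::real))" by auto
    fix x :: real and n :: nat assume "0 < x \<and> (n = 0 \<longrightarrow> x = 1)"
    moreover then obtain d where "d > 0" "\<forall>\<delta>. 0 < \<delta> \<and> \<delta> \<le> d \<longrightarrow> Good n x \<delta>" using good by blast
    ultimately show "\<exists>y. (0 < y \<and> (Suc n = 0 \<longrightarrow> y = 1)) \<and> Good n x y \<and> y \<le> x / 2"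
      by (intro exI[of _ "min d (x/2)"]) auto
  qed
  then obtain \<epsilon> where pos: "\<And>n. 0 < \<epsilon> n" and e0: "\<epsilon> 0 = 1" and g: "\<And>n. Good n (\<epsilon> n) (\<epsilon> (Suc n))"
    and half: "\<And>n. \<epsilon> (Suc n) \<le> \<epsilon> n / 2" by metis
  have dec: "\<epsilon> (Suc n) < \<epsilon> n" for n using half[of n] pos[of n] by linarith
  have bd: "\<epsilon> n \<le> (1/2)^n" for n
    by (induction n) (use e0 half in \<open>auto intro: order_trans\<close>)
  have lim: "\<epsilon> \<longlonglongrightarrow> 0"
    by (rule real_tendsto_sandwich[of "\<lambda>_. 0" _ _ "\<lambda>n. (1/2)^n"])
      (use pos bd in \<open>auto simp: less_imp_le intro!: always_eventually LIMSEQ_realpow_zero\<close>)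
 obtain l where cl: "continuous_on {0..1} l" and sm: "strict_mono_on {0..1} l" and l0: "l 0 = (0::real)"
    and le: "\<And>n. l (\<epsilon> n) = 1 / real (Suc n)"
    using staircase_rescaling[OF e0 pos dec lim] by blast
  have l1: "l 1 = 1" using le[of 0] e0 by simp
  have mono: "l r \<le> l r' \<longleftrightarrow> r \<le> r'" if "r \<in> {0..1}" "r' \<in> {0..1}" for r r'
    using strict_mono_on_leD[OF sm] strict_mono_onD[OF sm] that by (metis linorder_not_le)
  have l01: "l r \<in> {0..1}" if "r \<in> {0..1}" for r
    using mono[of 0 r] mono[of r 1] that l0 l1 by auto
  have surj: "t \<in> l ` {0..1}" if "t \<in> {0..1}" for t
    using IVT'[of l 0 t 1] that l0 l1 cl by force
  have inj: "inj_on l {0..1}" by (rule strict_mono_on_imp_inj_on[OF sm])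
  define s where "s = inv_into {0..1} l"
  have im: "l ` {0..1} = {0..1}" using surj l01 by blast
  have cs: "continuous_on {0..1} s"
    using continuous_on_inv[OF cl, of s] inj unfolding im s_def by (simp add: inv_into_f_f)
  have s01: "s t \<in> {0..1}" "l (s t) = t" if "t \<in> {0..1}" for t
    unfolding s_def using surj[OF that] by (rule inv_into_into, intro f_inv_into_f)
  have "s 0 = 0" "s 1 = 1"
    using inv_into_f_f[OF inj, of 0] inv_into_f_f[OF inj, of 1] l0 l1 by (auto simp: s_def)
  moreover have "\<epsilon> n \<le> 1" for n using bd[of n] power_le_one[of "1/2::real" n] by linarith
  ultimately show ?thesis
    by (intro that[OF pos _ g cl l01 l0 le mono cs s01]) (auto simp: l1)
qed

section \<open>Retractions from instantaneous deformations\<close>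

lemma reciprocal_bracket:
  fixes m :: real assumes "0 < m" "m \<le> 1"
  obtains n where "1 / real (Suc (Suc n)) < m" "m \<le> 1 / real (Suc n)"
proof -
  define k where "k = nat \<lfloor>1 / m\<rfloor>"
  have 1: "1 \<le> 1 / m" using assms by simp
  have k: "real k \<le> 1 / m" "1 / m < real (Suc k)" "k \<ge> 1"
    using 1 unfolding k_def by linarith+
  then obtain n where "k = Suc n" by (cases k) auto
  with k assms show ?thesis by (intro that[of n]) (auto simp: field_simps)
qed

text \<open>
  A point \<open>m\<close> outside \<open>P\<close> is sent to \<open>\<Phi> (m, \<tau> m)\<close>, where \<open>\<tau> m\<close> tends to \<open>0\<close> as \<open>m\<close> approaches
  \<open>P\<close>. Since \<open>\<Phi>\<close> extends \<open>H\<close> and \<open>H\<close> starts at the identity, this is continuous at \<open>P\<close> as soon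
  as \<open>(m, \<tau> m)\<close> stays so near to \<open>P \<times> {0<..1}\<close> that \<open>\<Phi>\<close> there is close to \<open>H\<close>. On each
  compact range of times a tube around \<open>P\<close> is near enough, so \<open>\<tau>\<close> only has to decrease slowly
  compared with the widths of these tubes, which a rescaled distance to \<open>P\<close> does.
\<close>
lemma instant_homotopy_retraction:
  fixes P N :: "'a::metric_space set" and H \<Phi> :: "'a \<times> real \<Rightarrow> 'a"
  assumes P: "compact P" "P \<noteq> {}" "P \<subseteq> N"
    and H: "continuous_on (P \<times> {0..1}) H" and H0: "\<And>p. p \<in> P \<Longrightarrow> H (p, 0) = p"
    and Phi: "continuous_on (N \<times> {0<..1}) \<Phi>" "\<Phi> ` (N \<times> {0<..1}) \<subseteq> P"
    and ext: "\<And>p t. p \<in> P \<Longrightarrow> t \<in> {0<..1} \<Longrightarrow> \<Phi> (p, t) = H (p, t)"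
  obtains r where "continuous_on N r" "r ` N \<subseteq> P" "\<And>p. p \<in> P \<Longrightarrow> r p = p"
proof -
  let ?S = "N \<times> {0<..1::real}"
  \<comment> \<open>The neighbourhood of \<open>P \<times> {0<..1}\<close> on which \<open>\<Phi>\<close> is close to \<open>H\<close>.\<close>
  define W where "W p = {z \<in> ?S. 0 < snd z - dist (fst z) p} \<inter> {z \<in> ?S. 0 < snd z - dist (\<Phi> z) (\<Phi> (p, snd z))}" for p
  have opW: "openin (top_of_set ?S) (W p)" if "p \<in> P" for p
  proof -
    have "continuous_on ?S (\<lambda>z. \<Phi> (p, snd z))"
      using that P(3) by (intro continuous_on_compose2[OF Phi(1)] continuous_intros) auto
    then have "continuous_on ?S (\<lambda>z. snd z - dist (\<Phi> z) (\<Phi> (p, snd z)))"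
      by (intro continuous_intros Phi(1))
    from continuous_openin_preimage_gen[OF this open_greaterThan[of 0]]
    have 1: "openin (top_of_set ?S) {z \<in> ?S. 0 < snd z - dist (\<Phi> z) (\<Phi> (p, snd z))}"
      by (simp add: vimage_def Int_def conj_commute)
    have "continuous_on ?S (\<lambda>z. snd z - dist (fst z) p)" by (intro continuous_intros)
    from continuous_openin_preimage_gen[OF this open_greaterThan[of 0]]
    have 2: "openin (top_of_set ?S) {z \<in> ?S. 0 < snd z - dist (fst z) p}"
      by (simp add: vimage_def Int_def conj_commute)
    show ?thesis unfolding W_def using 2 1 by (rule openin_Int)
  qed
  obtain V where V: "open V" "(\<Union>p\<in>P. W p) = ?S \<inter> V"
    using openin_Union[of "W ` P" "top_of_set ?S"] opW unfolding openin_open by blast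
  have PV: "(p, t) \<in> V" if "p \<in> P" "0 < t" "t \<le> 1" for p t
  proof -
    have "(p, t) \<in> W p" using that P(3) by (auto simp: W_def)
    then show ?thesis using V(2) that by blast
  qed
  define Good where "Good n \<epsilon> \<delta> \<longleftrightarrow> (\<forall>m\<in>N. infdist m P \<le> \<delta> \<longrightarrow>
      (\<forall>t. 1 / real (Suc (Suc (Suc n))) \<le> t \<and> t \<le> 1 / real (Suc (Suc n)) \<longrightarrow> (m, t) \<in> (\<Union>p\<in>P. W p)))"
    for n :: nat and \<epsilon> \<delta> :: real
  have "\<exists>\<delta>0>0. \<forall>\<delta>. 0 < \<delta> \<and> \<delta> \<le> \<delta>0 \<longrightarrow> Good n \<epsilon> \<delta>" for n \<epsilon>
  proof -
    let ?I = "{1 / real (Suc (Suc (Suc n)))..1 / real (Suc (Suc n))}"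
    have I: "0 < t \<and> t \<le> 1" if "t \<in> ?I" for t
    proof -
      have "0 < 1 / real (Suc (Suc (Suc n)))" "1 / real (Suc (Suc n)) \<le> 1" by auto
      then show ?thesis using that unfolding atLeastAtMost_iff by linarith
    qed
    have "compact (P \<times> ?I)" by (intro compact_Times P compact_Icc)
    moreover have "P \<times> ?I \<subseteq> \<Union>{V}" using PV I by force
    moreover have "\<And>G. G \<in> {V} \<Longrightarrow> open G" using V(1) by simp
    ultimately obtain e where e: "e > 0" "\<forall>x\<in>P \<times> ?I. \<exists>G\<in>{V}. ball x e \<subseteq> G"
      by (rule Heine_Borel_lemma) auto
    have "Good n \<epsilon> \<delta>" if "0 < \<delta>" "\<delta> \<le> e / 2" for \<delta>
      unfolding Good_def
    proof (intro ballI impI allI)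
      fix m t assume m: "m \<in> N" "infdist m P \<le> \<delta>" and t: "1 / real (Suc (Suc (Suc n))) \<le> t \<and> t \<le> 1 / real (Suc (Suc n))"
      have "infdist m P < e" using m that e by linarith
      then obtain p where p: "p \<in> P" "dist m p < e"
        using P(2) by (auto simp: infdist_notempty cINF_less_iff)
      have "ball (p, t) e \<subseteq> V" using e p t by auto
      moreover have "(m, t) \<in> ball (p, t) e" using p by (simp add: dist_Pair_Pair dist_commute)
      ultimately show "(m, t) \<in> (\<Union>p\<in>P. W p)"
        unfolding V(2) using m I[of t] t by auto
    qed
    then show ?thesis using e by (intro exI[of _ "e/2"]) auto
  qed
  then obtain \<epsilon> l s where epos: "\<And>n. 0 < \<epsilon> n" and e1: "\<And>n. \<epsilon> n \<le> 1" and good: "\<And>n. Good n (\<epsilon> n) (\<epsilon> (Suc n))"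
    and cl: "continuous_on {0..1} l" and l01: "\<And>r. r \<in> {0..1} \<Longrightarrow> l r \<in> {0..1}" and l0: "l 0 = (0::real)"
    and le: "\<And>n. l (\<epsilon> n) = 1 / real (Suc n)"
    and lmono: "\<And>r r'. r \<in> {0..1} \<Longrightarrow> r' \<in> {0..1} \<Longrightarrow> l r \<le> l r' \<longleftrightarrow> r \<le> r'"
    by (rule adapted_rescaling[of Good]) blast+
  define \<tau> where "\<tau> m = l (min 1 (infdist m P))" for m
  have clP: "closed P" using P(1) by (rule compact_imp_closed)
  have ip: "0 < infdist m P" if "m \<notin> P" for m
    using infdist_pos_not_in_closed[OF clP P(2) that] .
  have tau_pos: "0 < \<tau> m \<and> \<tau> m \<le> 1" if "m \<notin> P" for m
    using ip[OF that] l01[of "min 1 (infdist m P)"] lmono[of "min 1 (infdist m P)" 0] l0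
    unfolding \<tau>_def by (auto simp: less_le)
  have tau_cont: "continuous_on N \<tau>"
    unfolding \<tau>_def by (intro continuous_on_compose2[OF cl] continuous_intros) (auto simp: infdist_nonneg)
  have near: "(m, \<tau> m) \<in> (\<Union>p\<in>P. W p)" if m: "m \<in> N" "m \<notin> P" "infdist m P \<le> \<epsilon> 1" for m
  proof -
    have d1: "infdist m P \<le> 1" using m(3) e1[of 1] by linarith
    have "\<tau> m \<le> l (\<epsilon> 1)"
      using lmono[of "min 1 (infdist m P)" "\<epsilon> 1"] m e1[of 1] epos[of 1] d1 by (auto simp: \<tau>_def infdist_nonneg)
    then have t2: "\<tau> m \<le> 1/2" using le[of 1] by simp
    obtain k where k: "1 / real (Suc (Suc k)) < \<tau> m" "\<tau> m \<le> 1 / real (Suc k)"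
      using reciprocal_bracket tau_pos[OF m(2)] by blast
    have "k \<noteq> 0" using k(1) t2 by (rule_tac notI) simp
    then obtain n where n: "k = Suc n" by (cases k) auto
    have "l (min 1 (infdist m P)) \<le> l (\<epsilon> (Suc n))" using k(2) n le[of "Suc n"] by (simp add: \<tau>_def)
    then have "infdist m P \<le> \<epsilon> (Suc n)"
      using lmono[of "min 1 (infdist m P)" "\<epsilon> (Suc n)"] epos[of "Suc n"] e1[of "Suc n"] d1
      by (auto simp: infdist_nonneg)
    then show ?thesis using good[of n] m(1) k n unfolding Good_def by auto
  qed
  define r where "r m = (if m \<in> P then m else \<Phi> (m, \<tau> m))" for m
  have "continuous (at x within N) r" if x: "x \<in> N" for x
  proof (cases "x \<in> P")
    case False
    have "continuous_on (N - P) (\<lambda>m. \<Phi> (m, \<tau> m))"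
      using tau_pos by (intro continuous_on_compose2[OF Phi(1)] continuous_intros continuous_on_subset[OF tau_cont]) auto
    then have "continuous_on (N - P) r" by (rule continuous_on_eq) (auto simp: r_def)
    then have "continuous (at x within (N - P)) r" using x False by (simp add: continuous_on_eq_continuous_within)
    moreover have "at x within N = at x within (N - P)"
      by (rule at_within_nhd[of _ "- P"]) (use False clP in auto)
    ultimately show ?thesis by simp
  next
    case True
    show ?thesis unfolding continuous_within_eps_delta
    proof (intro allI impI)
      fix e :: real assume e: "e > 0"
      have "uniformly_continuous_on (P \<times> {0..1}) H"
        by (intro compact_uniformly_continuous H compact_Times P compact_Icc)
      then obtain d1 where d1: "d1 > 0" "\<And>z z'. z \<in> P \<times> {0..1} \<Longrightarrow> z' \<in> P \<times> {0..1} \<Longrightarrow> dist z' z < d1 \<Longrightarrow> dist (H z') (H z) < e / 2"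
        unfolding uniformly_continuous_on_def using half_gt_zero[OF e] by blast
      define \<eta> where "\<eta> = min (e/2) (d1/4)"
      have eta: "\<eta> > 0" using e d1 by (simp add: \<eta>_def)
      have "continuous (at x within N) \<tau>" using tau_cont x by (simp add: continuous_on_eq_continuous_within)
      moreover have "\<tau> x = 0" using True by (simp add: \<tau>_def l0)
      ultimately obtain d2 where d2: "d2 > 0" "\<And>m. m \<in> N \<Longrightarrow> dist m x < d2 \<Longrightarrow> \<bar>\<tau> m\<bar> < \<eta>"
        unfolding continuous_within_eps_delta using eta by (auto simp: dist_real_def)
      define d where "d = min d2 (min (\<epsilon> 1) (min e (d1/4)))"
      have "dist (r m) (r x) < e" if m: "m \<in> N" "dist m x < d" for m
      proof (cases "m \<in> P")
        case mP: True
        then show ?thesis using True m by (simp add: r_def d_def)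
      next
        case mP: False
        have "infdist m P \<le> \<epsilon> 1"
          using infdist_le[OF True, of m] m by (simp add: d_def)
        then obtain p where p: "p \<in> P" "(m, \<tau> m) \<in> W p" using near[OF m(1) mP] by blast
        have t: "0 < \<tau> m" "\<tau> m \<le> 1" "\<tau> m < \<eta>" using tau_pos[OF mP] d2(2)[of m] m by (auto simp: d_def)
        have a: "dist m p < \<tau> m" "dist (\<Phi> (m, \<tau> m)) (H (p, \<tau> m)) < \<tau> m"
          using p t ext[of p "\<tau> m"] by (auto simp: W_def)
        have "dist (p, \<tau> m) (x, 0) \<le> dist p x + \<bar>\<tau> m\<bar>"
          using sqrt_sum_squares_le_sum_abs[of "dist p x" "\<tau> m"] by (simp add: dist_Pair_Pair dist_real_def)
        also have "dist p x \<le> dist m p + dist m x" by (rule dist_triangle3)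
        finally have "dist (p, \<tau> m) (x, 0) < d1"
          using a t m by (simp add: d_def \<eta>_def)
        then have "dist (H (p, \<tau> m)) (H (x, 0)) < e / 2"
          using p True t by (intro d1(2)) auto
        then have "dist (\<Phi> (m, \<tau> m)) x < e"
          using a(2) t H0[OF True] dist_triangle[of "\<Phi> (m, \<tau> m)" x "H (p, \<tau> m)"] by (simp add: \<eta>_def)
        then show ?thesis using mP True by (simp add: r_def)
      qed
      moreover have "d > 0" using d2 e d1 epos[of 1] by (simp add: d_def)
      ultimately show "\<exists>d>0. \<forall>x'\<in>N. dist x' x < d \<longrightarrow> dist (r x') (r x) < e" by blast
    qed
  qed
  then have "continuous_on N r" by (simp add: continuous_on_eq_continuous_within)
  moreover have "r ` N \<subseteq> P" using Phi(2) tau_pos by (auto simp: r_def image_subset_iff)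
  ultimately show ?thesis by (rule that) (simp add: r_def)
qed

type_synonym rseq = "nat \<Rightarrow> real"

abbreviation euclid :: "nat \<Rightarrow> rseq set" where
  "euclid n \<equiv> {x. \<forall>i\<ge>n. x i = 0}"

text \<open>
  The test spaces are the subsets of one fixed type that contains all cylinders over Euclidean
  spaces; extension over those cylinders is what the retraction above requires.
\<close>
definition absolute_extensor :: "'a::topological_space set \<Rightarrow> bool" where
  "absolute_extensor D \<longleftrightarrow> (\<forall>(N :: (rseq \<times> real) set) A f.
     closedin (top_of_set N) A \<and> continuous_on A f \<and> f ` A \<subseteq> D \<longrightarrow>
     (\<exists>g. continuous_on N g \<and> g ` N \<subseteq> D \<and> (\<forall>a\<in>A. g a = f a)))"

text \<open>
  Extend into the Euclidean retract \<open>S\<close> by Tietze and the retraction, then apply the homotopy for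
  a time that is \<open>0\<close> exactly on the closed set \<open>A\<close>: off \<open>A\<close> this lands in \<open>X\<close>, and on \<open>A\<close> nothing
  has moved.
\<close>
lemma absolute_extensor_pushed_off:
  fixes S :: "rseq set" and F :: "rseq \<times> real \<Rightarrow> rseq"
  assumes S: "S \<subseteq> euclid n"
    and r: "continuous_on (euclid n) r" "r ` euclid n \<subseteq> S" "\<And>x. x \<in> S \<Longrightarrow> r x = x"
    and F: "continuous_on (S \<times> {0..1}) F" "\<And>x. x \<in> S \<Longrightarrow> F (x, 0) = x"
      "\<And>x t. x \<in> S \<Longrightarrow> t \<in> {0<..1} \<Longrightarrow> F (x, t) \<in> X"
    and X: "X \<subseteq> S"
  shows "absolute_extensor X"
  unfolding absolute_extensor_def
proof (intro allI impI, elim conjE)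
  fix N :: "(rseq \<times> real) set" and A f
  assume A: "closedin (top_of_set N) A" and f: "continuous_on A f" "f ` A \<subseteq> X"
  let ?E = "euclid n"
  show "\<exists>g. continuous_on N g \<and> g ` N \<subseteq> X \<and> (\<forall>a\<in>A. g a = f a)"
  proof (cases "A = {}")
    case True
    have "r (\<lambda>_. 0) \<in> S" using r(2) by auto
    then have "F (r (\<lambda>_. 0), 1) \<in> X" by (intro F(3)) auto
    then show ?thesis using True by (intro exI[of _ "\<lambda>_. F (r (\<lambda>_. 0), 1)"]) auto
  next
    case False
    have "\<exists>h. continuous_on N h \<and> (\<forall>a\<in>A. h a = f a i)" for i
      by (rule Tietze_unbounded[of A "\<lambda>a. f a i" N])
        (use A continuous_on_product_then_coordinatewise[OF f(1)] in auto)
    then obtain h where h: "\<And>i. continuous_on N (h i)" "\<And>i a. a \<in> A \<Longrightarrow> h i a = f a i" by metis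
    define k where "k z = (\<lambda>i. if i < n then h i z else 0)" for z
    have kc: "continuous_on N k"
      unfolding k_def
    proof (rule continuous_on_coordinatewise_then_product)
      show "continuous_on N (\<lambda>z. if i < n then h i z else 0)" for i by (cases "i < n") (simp_all add: h)
    qed
    have kE: "k z \<in> ?E" for z by (simp add: k_def)
    have kf: "k a = f a" if "a \<in> A" for a
    proof -
      have "f a i = 0" if "i \<ge> n" for i using that \<open>a \<in> A\<close> f(2) X S by blast
      then show ?thesis using that h(2) by (intro ext) (auto simp: k_def)
    qed
    \<comment> \<open>The distance to the empty set is \<open>0\<close> by convention, hence the separate case above.\<close>
    define \<tau> where "\<tau> z = min 1 (infdist z A)" for z
    have t01: "\<tau> z \<in> {0..1}" for z by (auto simp: \<tau>_def infdist_nonneg)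
    have tp: "\<tau> z > 0" if "z \<in> N - A" for z
    proof -
      obtain T where "closed T" "A = N \<inter> T" using A by (auto simp: closedin_closed)
      then have "z \<notin> closure A" using that closure_minimal[of A T] by blast
      then show ?thesis using in_closure_iff_infdist_zero[OF False] infdist_nonneg[of z A] by (auto simp: \<tau>_def less_le)
    qed
    have t0: "\<tau> a = 0" if "a \<in> A" for a using that by (simp add: \<tau>_def)
    define g where "g z = F (r (k z), \<tau> z)" for z
    have rk: "r (k z) \<in> S" for z using r(2) kE by blast
    have ga: "g a = f a" if "a \<in> A" for a
    proof -
      have "f a \<in> S" using that f X by blast
      then show ?thesis using that by (simp add: g_def t0 kf r(3) F(2))
    qed
    have "continuous_on N g" unfolding g_def
    proof (rule continuous_on_compose2[OF F(1)])
      show "continuous_on N (\<lambda>z. (r (k z), \<tau> z))"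
        unfolding \<tau>_def using kE
        by (intro continuous_intros continuous_on_compose2[OF r(1) kc]) auto
    qed (use rk t01 in auto)
    moreover have "g z \<in> X" if "z \<in> N" for z
    proof (cases "z \<in> A")
      case True then show ?thesis using ga f by auto
    next
      case False
      then show ?thesis unfolding g_def using F(3)[OF rk] tp[of z] that t01[of z] by auto
    qed
    ultimately show ?thesis using ga by blast
  qed
qed

section \<open>Gauges controlled by the group and by the homotopy\<close>

text \<open>
  An EZ-structure whose compact space \<open>S\<close> is a retract, by \<open>r\<close>, of a Euclidean space. Here \<open>Z\<close> is
  the boundary, \<open>F\<close> the homotopy off it and \<open>act\<close> the extended action. A fixed metric makes the
  null condition a statement about diameters.
\<close>
locale euclidean_EZ =
  fixes G :: "('g, 'm) monoid_scheme" and n :: nat and S Z :: "rseq set"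
    and r :: "rseq \<Rightarrow> rseq" and F :: "rseq \<times> real \<Rightarrow> rseq"
    and act :: "'g \<Rightarrow> rseq \<Rightarrow> rseq"
  assumes grp: "group G"
    and S_compact: "compact S" and S_sub: "S \<subseteq> euclid n"
    and r_cont: "continuous_on (euclid n) r" and r_in: "r ` euclid n \<subseteq> S"
    and r_id: "\<And>x. x \<in> S \<Longrightarrow> r x = x"
    and Z_closed: "closed Z"
    and F_cont: "continuous_on (S \<times> {0..1}) F" and F_in: "F ` (S \<times> {0..1}) \<subseteq> S"
    and F_0: "\<And>x. x \<in> S \<Longrightarrow> F (x, 0) = x"
    and F_off: "\<And>x t. x \<in> S \<Longrightarrow> t \<in> {0<..1} \<Longrightarrow> F (x, t) \<notin> Z"
    and act_cont: "\<And>g. g \<in> carrier G \<Longrightarrow> continuous_on S (act g)"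
    and act_in: "\<And>g x. g \<in> carrier G \<Longrightarrow> x \<in> S \<Longrightarrow> act g x \<in> S"
    and act_one: "\<And>x. x \<in> S \<Longrightarrow> act \<one>\<^bsub>G\<^esub> x = x"
    and act_mult: "\<And>g h x. g \<in> carrier G \<Longrightarrow> h \<in> carrier G \<Longrightarrow> x \<in> S \<Longrightarrow> act (g \<otimes>\<^bsub>G\<^esub> h) x = act g (act h x)"
    and act_Z: "\<And>g x. g \<in> carrier G \<Longrightarrow> x \<in> S \<Longrightarrow> act g x \<in> Z \<longleftrightarrow> x \<in> Z"
    and proper: "\<And>x. x \<in> S - Z \<Longrightarrow> \<exists>U. openin (top_of_set (S - Z)) U \<and> x \<in> U \<and>
        finite {g \<in> carrier G. act g ` U \<inter> U \<noteq> {}}"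
    and cocompact: "\<exists>K. compact K \<and> K \<subseteq> S - Z \<and> (\<forall>x\<in>S - Z. \<exists>g\<in>carrier G. \<exists>k\<in>K. x = act g k)"
    and null: "\<And>C e. compact C \<Longrightarrow> C \<subseteq> S - Z \<Longrightarrow> 0 < (e::real) \<Longrightarrow>
        \<exists>\<Gamma>. finite \<Gamma> \<and> (\<forall>g\<in>carrier G - \<Gamma>. \<forall>x\<in>C. \<forall>y\<in>C. dist (act g x) (act g y) < e)"

text \<open>
  An EZ-structure seen through a gauge \<open>a\<close> that vanishes exactly on the boundary. The axiom
  \<open>F_ctrl\<close> says that the reciprocals of the gauge after pushing and of \<open>max (a x) t\<close> differ by at
  most \<open>2\<close>, multiplied out. The axiom \<open>act_ctrl\<close> bounds the gauge
  of every translate of \<open>y\<close> from below, uniformly in the group element, once a single point \<open>x\<close> and its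
  translate are known to be deep inside. Besides, \<open>F\<close> ends in a constant map, so that it is also a
  contraction.
\<close>
locale controlled_EZ =
  fixes G :: "('g, 'm) monoid_scheme" and n :: nat and S :: "rseq set"
    and a :: "rseq \<Rightarrow> real" and F :: "rseq \<times> real \<Rightarrow> rseq"
    and act :: "'g \<Rightarrow> rseq \<Rightarrow> rseq"
  assumes grp: "group G"
    and S_compact: "compact S" and S_sub: "S \<subseteq> euclid n" and S_ne: "S \<noteq> {}"
    and a_cont: "continuous_on S a" and a_01: "\<And>x. x \<in> S \<Longrightarrow> a x \<in> {0..1}"
    and F_cont: "continuous_on (S \<times> {0..1}) F" and F_in: "F ` (S \<times> {0..1}) \<subseteq> S"
    and F_0: "\<And>x. x \<in> S \<Longrightarrow> F (x, 0) = x"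
    and F_1: "\<And>x y. x \<in> S \<Longrightarrow> y \<in> S \<Longrightarrow> F (x, 1) = F (y, 1)"
    and F_off: "\<And>x t. x \<in> S \<Longrightarrow> t \<in> {0<..1} \<Longrightarrow> 0 < a (F (x, t))"
    and F_ctrl: "\<And>x t. x \<in> S \<Longrightarrow> t \<in> {0<..1} \<Longrightarrow>
        \<bar>a (F (x, t)) - max (a x) t\<bar> \<le> 2 * a (F (x, t)) * max (a x) t"
    and extensor: "absolute_extensor {x \<in> S. 0 < a x}"
    and act_cont: "\<And>g. g \<in> carrier G \<Longrightarrow> continuous_on S (act g)"
    and act_in: "\<And>g x. g \<in> carrier G \<Longrightarrow> x \<in> S \<Longrightarrow> act g x \<in> S"
    and act_one: "\<And>x. x \<in> S \<Longrightarrow> act \<one>\<^bsub>G\<^esub> x = x"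
    and act_mult: "\<And>g h x. g \<in> carrier G \<Longrightarrow> h \<in> carrier G \<Longrightarrow> x \<in> S \<Longrightarrow> act (g \<otimes>\<^bsub>G\<^esub> h) x = act g (act h x)"
    and act_zero: "\<And>g x. g \<in> carrier G \<Longrightarrow> x \<in> S \<Longrightarrow> a (act g x) = 0 \<longleftrightarrow> a x = 0"
    and act_ctrl: "\<And>g x y w. g \<in> carrier G \<Longrightarrow> x \<in> S \<Longrightarrow> y \<in> S \<Longrightarrow> 0 < w \<Longrightarrow>
        w \<le> a x \<Longrightarrow> w \<le> a (act g x) \<Longrightarrow> w \<le> a y \<Longrightarrow> 1 / a (act g y) \<le> 1 / w + 2"
    and cocompact: "\<exists>K. compact K \<and> K \<subseteq> {x \<in> S. 0 < a x} \<and> (\<forall>x\<in>S. 0 < a x \<longrightarrow> (\<exists>g\<in>carrier G. \<exists>k\<in>K. x = act g k))"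
    and null: "\<And>C e. compact C \<Longrightarrow> C \<subseteq> {x \<in> S. 0 < a x} \<Longrightarrow> 0 < (e::real) \<Longrightarrow>
        \<exists>\<Gamma>. finite \<Gamma> \<and> (\<forall>g\<in>carrier G - \<Gamma>. \<forall>x\<in>C. a (act g x) < e \<and> (\<forall>y\<in>C. dist (act g x) (act g y) < e))"

text \<open>
  Properness is a condition on neighbourhoods of points and does not by itself exclude infinitely
  many returns of a compact set; together with the null condition it does. Otherwise infinitely many translates of \<open>K\<close> would be small and
  meet \<open>K\<close>, hence infinitely many of them would lie in one and the same neighbourhood with
  finitely many returns, and the quotients of their group elements would all be returns.
\<close>
lemma (in euclidean_EZ) finite_returns:
  assumes K: "compact K" "K \<subseteq> S - Z"
  shows "finite {g \<in> carrier G. act g ` K \<inter> K \<noteq> {}}" (is "finite ?A")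
proof (rule ccontr)
  assume inf: "infinite ?A"
  interpret group G by (rule grp)
  have "\<forall>x\<in>K. \<exists>T. open T \<and> x \<in> T \<and> finite {g \<in> carrier G. act g ` (T \<inter> (S - Z)) \<inter> (T \<inter> (S - Z)) \<noteq> {}}"
  proof
    fix x assume "x \<in> K"
    then have "x \<in> S - Z" using K by blast
    from proper[OF this] show "\<exists>T. open T \<and> x \<in> T \<and> finite {g \<in> carrier G. act g ` (T \<inter> (S - Z)) \<inter> (T \<inter> (S - Z)) \<noteq> {}}"
      by (auto simp: openin_open Int_commute)
  qed
  from bchoice[OF this] obtain T where "\<forall>x\<in>K. open (T x) \<and> x \<in> T x \<and>
      finite {g \<in> carrier G. act g ` (T x \<inter> (S - Z)) \<inter> (T x \<inter> (S - Z)) \<noteq> {}}" ..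
  then have T: "\<And>x. x \<in> K \<Longrightarrow> open (T x)" "\<And>x. x \<in> K \<Longrightarrow> x \<in> T x"
    "\<And>x. x \<in> K \<Longrightarrow> finite {g \<in> carrier G. act g ` (T x \<inter> (S - Z)) \<inter> (T x \<inter> (S - Z)) \<noteq> {}}"
    by simp_all
  have "K \<subseteq> (\<Union>x\<in>K. T x)" using T(2) by blast
  then obtain K0 where K0: "K0 \<subseteq> K" "finite K0" "K \<subseteq> (\<Union>x\<in>K0. T x)"
    using compactE_image[OF K(1), of K T] T(1) by blast
  have "\<And>U. U \<in> T ` K0 \<Longrightarrow> open U" using T(1) K0(1) by blast
  then obtain e where e: "e > 0" "\<And>k. k \<in> K \<Longrightarrow> \<exists>U\<in>T ` K0. ball k e \<subseteq> U"
    by (rule Heine_Borel_lemma[OF K(1) K0(3)]) blast+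
  obtain \<Gamma> where \<Gamma>: "finite \<Gamma>" "\<forall>g\<in>carrier G - \<Gamma>. \<forall>x\<in>K. \<forall>y\<in>K. dist (act g x) (act g y) < e"
    using null[OF K e(1)] by blast
  let ?B = "?A - \<Gamma>"
  have infB: "infinite ?B" using inf \<Gamma>(1) by (rule Diff_infinite_finite[rotated])
  have "\<forall>g\<in>?B. \<exists>x\<in>K0. act g ` K \<subseteq> T x \<inter> (S - Z)"
  proof
    fix g assume g: "g \<in> ?B"
    then obtain k where k: "k \<in> K" "act g k \<in> K" by blast
    then obtain x where x: "x \<in> K0" "ball (act g k) e \<subseteq> T x" using e(2) by blast
    have "act g ` K \<subseteq> ball (act g k) e" using \<Gamma>(2) g k by auto
    moreover have "act g ` K \<subseteq> S - Z" using g K(2) act_in act_Z by blast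
    ultimately show "\<exists>x\<in>K0. act g ` K \<subseteq> T x \<inter> (S - Z)" using x by blast
  qed
  from bchoice[OF this[unfolded Bex_def]] obtain pick where "\<forall>g\<in>?B. pick g \<in> K0 \<and> act g ` K \<subseteq> T (pick g) \<inter> (S - Z)" ..
  then have chi: "\<And>g. g \<in> ?B \<Longrightarrow> pick g \<in> K0" "\<And>g. g \<in> ?B \<Longrightarrow> act g ` K \<subseteq> T (pick g) \<inter> (S - Z)"
    by blast+
  have "finite (pick ` ?B)" by (rule finite_subset[OF _ K0(2)]) (use chi(1) in blast)
  from pigeonhole_infinite[OF infB this]
  obtain g0 where g0: "g0 \<in> ?B" "infinite {g \<in> ?B. pick g = pick g0}" by (rule bexE)
  obtain k where k: "k \<in> K" using g0 by blast
  let ?R = "{g \<in> carrier G. act g ` (T (pick g0) \<inter> (S - Z)) \<inter> (T (pick g0) \<inter> (S - Z)) \<noteq> {}}"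
  have "inj_on (\<lambda>g. g \<otimes>\<^bsub>G\<^esub> inv\<^bsub>G\<^esub> g0) {g \<in> ?B. pick g = pick g0}"
    using g0(1) by (intro inj_onI) auto
  moreover have "(\<lambda>g. g \<otimes>\<^bsub>G\<^esub> inv\<^bsub>G\<^esub> g0) ` {g \<in> ?B. pick g = pick g0} \<subseteq> ?R"
  proof (rule image_subsetI)
    fix g assume g: "g \<in> {g \<in> ?B. pick g = pick g0}"
    have c: "g \<in> carrier G" "g0 \<in> carrier G" "k \<in> S" using g g0 k K by auto
    have "act (g \<otimes>\<^bsub>G\<^esub> inv\<^bsub>G\<^esub> g0) (act g0 k) = act (g \<otimes>\<^bsub>G\<^esub> inv\<^bsub>G\<^esub> g0 \<otimes>\<^bsub>G\<^esub> g0) k"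
      using act_mult[of "g \<otimes>\<^bsub>G\<^esub> inv\<^bsub>G\<^esub> g0" g0 k] c by simp
    also have "\<dots> = act g k" using c by (simp add: m_assoc)
    finally have "act (g \<otimes>\<^bsub>G\<^esub> inv\<^bsub>G\<^esub> g0) (act g0 k) = act g k" .
    moreover have "act g k \<in> T (pick g0) \<inter> (S - Z)" "act g0 k \<in> T (pick g0) \<inter> (S - Z)"
      using chi(2)[of g] chi(2)[of g0] g g0(1) k by auto
    ultimately have "act g k \<in> act (g \<otimes>\<^bsub>G\<^esub> inv\<^bsub>G\<^esub> g0) ` (T (pick g0) \<inter> (S - Z)) \<inter> (T (pick g0) \<inter> (S - Z))"
      by (metis IntI imageI)
    then show "g \<otimes>\<^bsub>G\<^esub> inv\<^bsub>G\<^esub> g0 \<in> ?R" using c by blast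
  qed
  moreover have "finite ?R" by (rule T(3)) (use chi(1)[OF g0(1)] K0(1) in blast)
  ultimately have "finite {g \<in> ?B. pick g = pick g0}" by (rule inj_on_finite)
  with g0(2) show False ..
qed

lemma compact_positive_lower_bound:
  fixes f :: "'a::topological_space \<Rightarrow> real"
  assumes "compact C" "continuous_on C f" "\<And>x. x \<in> C \<Longrightarrow> 0 < f x"
  obtains d where "0 < d" "\<And>x. x \<in> C \<Longrightarrow> d \<le> f x"
proof (cases "C = {}")
  case True then show ?thesis using that[of 1] by simp
next
  case False
  then obtain z where "z \<in> C" "\<forall>x\<in>C. f z \<le> f x" using continuous_attains_inf[OF assms(1) _ assms(2)] by blast
  then show ?thesis using that[of "f z"] assms(3) by blast
qed

lemma abs_diff_le_of_reciprocal:
  fixes A M C :: real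
  assumes "0 < A" "0 < M" "1 / A \<le> 1 / M + C" "1 / M \<le> 1 / A + C"
  shows "\<bar>A - M\<bar> \<le> C * A * M"
proof -
  have "A - M = A * M * (1 / M - 1 / A)" using assms by (simp add: field_simps)
  then have "\<bar>A - M\<bar> = A * M * \<bar>1 / M - 1 / A\<bar>" using assms by (simp add: abs_mult)
  also have "\<dots> \<le> A * M * C" using assms by (intro mult_left_mono) auto
  finally show ?thesis by (simp add: mult_ac)
qed

context euclidean_EZ
begin

text \<open>
  The gauge is a rescaled distance to the boundary, and the same rescaling is applied to the
  time of the homotopy, so that distance and time are measured on the same levels.
\<close>
lemma exists_controlled: "\<exists>a F'. controlled_EZ G n S a F' act"
proof -
  define a0 where "a0 x = (if Z = {} then 1 else min 1 (infdist x Z))" for x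
  \<comment> \<open>Shrinking the argument radially before retracting turns the push into a contraction.\<close>
  define F1 where "F1 z = F (r (\<lambda>i. (1 - snd z) * fst z i), snd z)" for z :: "rseq \<times> real"
  have a0_cont: "continuous_on A a0" for A
    unfolding a0_def by (cases "Z = {}") (auto intro!: continuous_intros)
  have a0_01: "a0 x \<in> {0..1}" for x by (auto simp: a0_def infdist_nonneg)
  have a0_Z: "a0 x = 0 \<longleftrightarrow> x \<in> Z" for x
    using in_closed_iff_infdist_zero[OF Z_closed, of x] by (auto simp: a0_def min_def)
  have a0_pos: "0 < a0 x \<longleftrightarrow> x \<notin> Z" for x
    using a0_Z[of x] a0_01[of x] by (auto simp: less_le)
  have cone_E: "(\<lambda>i. c * x i) \<in> (euclid n)" if "x \<in> S" for c :: real and x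
    using that S_sub by auto
  have cone_cont: "continuous_on (S \<times> {0..1}) (\<lambda>z :: rseq \<times> real. (\<lambda>i. (1 - snd z) * fst z i))"
  proof (rule continuous_on_coordinatewise_then_product)
    fix i
    have "continuous_on (S \<times> {0..1::real}) (\<lambda>z. fst z i)"
      by (rule continuous_on_product_then_coordinatewise) (intro continuous_intros)
    then show "continuous_on (S \<times> {0..1}) (\<lambda>z. (1 - snd z) * fst z i)"
      by (intro continuous_intros)
  qed
  have rS: "r (\<lambda>i. c * x i) \<in> S" if "x \<in> S" for c :: real and x
    by (rule subsetD[OF r_in imageI[OF cone_E[OF that]]])
  have F1_cont: "continuous_on (S \<times> {0..1}) F1"
    unfolding F1_def
  proof (rule continuous_on_compose2[OF F_cont])
    show "continuous_on (S \<times> {0..1}) (\<lambda>z. (r (\<lambda>i. (1 - snd z) * fst z i), snd z))"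
    proof (intro continuous_on_Pair continuous_on_snd continuous_on_id)
      show "continuous_on (S \<times> {0..1}) (\<lambda>z. r (\<lambda>i. (1 - snd z) * fst z i))"
        by (rule continuous_on_compose2[OF r_cont cone_cont]) (use S_sub in auto)
    qed
  qed (use rS in auto)
  have F1_in: "F1 (x, t) \<in> S" if "x \<in> S" "t \<in> {0..1}" for x t
    using rS[OF that(1)] that(2) F_in by (auto simp: F1_def)
  have F1_0: "F1 (x, 0) = x" if "x \<in> S" for x using that by (simp add: F1_def r_id F_0)
  have F1_off: "F1 (x, t) \<notin> Z" if "x \<in> S" "t \<in> {0<..1}" for x t
    using F_off[OF rS[OF that(1)] that(2)] by (simp add: F1_def)
  define K where "K \<epsilon> = {x \<in> S. \<epsilon> \<le> a0 x}" for \<epsilon>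
  have K_compact: "compact (K \<epsilon>)" for \<epsilon>
  proof -
    have "closed {x. \<epsilon> \<le> a0 x}" by (intro closed_Collect_le a0_cont continuous_on_const)
    then have "compact (S \<inter> {x. \<epsilon> \<le> a0 x})" using S_compact by (rule compact_Int_closed[rotated])
    then show ?thesis by (simp add: K_def Int_def)
  qed
  \<comment> \<open>The two halves of control of the homotopy, and control of the action, from level \<open>\<epsilon>\<close> to level \<open>\<delta>\<close>.\<close>
  define Good where "Good k \<epsilon> \<delta> \<longleftrightarrow>
      (\<forall>x\<in>S. \<forall>t\<in>{0..1}. \<epsilon> \<le> max (a0 x) t \<longrightarrow> \<delta> \<le> a0 (F1 (x, t))) \<and>
      (\<forall>x\<in>S. \<forall>t\<in>{0..1}. max (a0 x) t \<le> \<delta> \<longrightarrow> a0 (F1 (x, t)) \<le> \<epsilon>) \<and>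
      (\<forall>g\<in>carrier G. \<forall>x\<in>K \<epsilon>. act g x \<in> K \<epsilon> \<longrightarrow> (\<forall>y\<in>K \<epsilon>. \<delta> \<le> a0 (act g y)))"
    for k :: nat and \<epsilon> \<delta>
  have ex_Good: "\<exists>\<delta>0>0. \<forall>\<delta>. 0 < \<delta> \<and> \<delta> \<le> \<delta>0 \<longrightarrow> Good k \<epsilon> \<delta>" if e: "0 < \<epsilon>" for k \<epsilon>
  proof -
    let ?SI = "S \<times> {0..1::real}"
    have SI: "compact ?SI" by (intro compact_Times S_compact compact_Icc)
    have m_cont: "continuous_on ?SI (\<lambda>z. max (a0 (fst z)) (snd z))"
      by (intro continuous_intros continuous_on_compose2[OF a0_cont[of UNIV]]) auto
    have aF_cont: "continuous_on ?SI (\<lambda>z. a0 (F1 z))"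
      by (intro continuous_on_compose2[OF a0_cont[of UNIV]] F1_cont) auto
    have cpt: "compact {z \<in> ?SI. \<epsilon> \<le> f z}" if "continuous_on ?SI f" for f
      using continuous_closedin_preimage[OF that closed_atLeast[of \<epsilon>]] SI
      by (auto simp: vimage_def Int_def intro: closedin_compact)
    obtain d1 where d1: "d1 > 0" "\<And>z. z \<in> {z \<in> ?SI. \<epsilon> \<le> max (a0 (fst z)) (snd z)} \<Longrightarrow> d1 \<le> a0 (F1 z)"
    proof (rule compact_positive_lower_bound[OF cpt[OF m_cont], of "\<lambda>z. a0 (F1 z)"])
      show "continuous_on {z \<in> ?SI. \<epsilon> \<le> max (a0 (fst z)) (snd z)} (\<lambda>z. a0 (F1 z))"
        by (rule continuous_on_subset[OF aF_cont]) auto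
      fix z assume z: "z \<in> {z \<in> ?SI. \<epsilon> \<le> max (a0 (fst z)) (snd z)}"
      obtain x t where xt: "z = (x, t)" by (cases z)
      show "0 < a0 (F1 z)"
      proof (cases "t = 0")
        case True
        then show ?thesis using z e xt F1_0[of x] by auto
      next
        case False
        then show ?thesis using z xt F1_off[of x t] by (auto simp: a0_pos)
      qed
    qed blast
    obtain d2 where d2: "d2 > 0" "\<And>z. z \<in> {z \<in> ?SI. \<epsilon> \<le> a0 (F1 z)} \<Longrightarrow> d2 \<le> max (a0 (fst z)) (snd z)"
    proof (rule compact_positive_lower_bound[OF cpt[OF aF_cont], of "\<lambda>z. max (a0 (fst z)) (snd z)"])
      show "continuous_on {z \<in> ?SI. \<epsilon> \<le> a0 (F1 z)} (\<lambda>z. max (a0 (fst z)) (snd z))"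
        by (rule continuous_on_subset[OF m_cont]) auto
      fix z assume z: "z \<in> {z \<in> ?SI. \<epsilon> \<le> a0 (F1 z)}"
      obtain x t where xt: "z = (x, t)" by (cases z)
      show "0 < max (a0 (fst z)) (snd z)"
      proof (cases "t = 0")
        case True
        then show ?thesis using z e xt F1_0[of x] by auto
      next
        case False
        then show ?thesis using z xt by auto
      qed
    qed blast
    let ?\<Gamma> = "{g \<in> carrier G. act g ` K \<epsilon> \<inter> K \<epsilon> \<noteq> {}}"
    have K_sub: "K \<epsilon> \<subseteq> S - Z" using e a0_pos by (fastforce simp: K_def)
    have fin: "finite ?\<Gamma>" by (rule finite_returns[OF K_compact K_sub])
    have "compact (\<Union>g\<in>?\<Gamma>. act g ` K \<epsilon>)"
      by (intro compact_UN fin compact_continuous_image K_compact continuous_on_subset[OF act_cont]) (auto simp: K_def)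
    moreover have "0 < a0 x" if "x \<in> (\<Union>g\<in>?\<Gamma>. act g ` K \<epsilon>)" for x
      using that K_sub act_Z by (auto simp: a0_pos)
    ultimately obtain d3 where d3: "d3 > 0" "\<And>x. x \<in> (\<Union>g\<in>?\<Gamma>. act g ` K \<epsilon>) \<Longrightarrow> d3 \<le> a0 x"
      by (rule compact_positive_lower_bound[OF _ a0_cont]) blast+
    have "Good k \<epsilon> \<delta>" if "0 < \<delta>" "\<delta> \<le> min d1 (min (d2/2) d3)" for \<delta>
      unfolding Good_def
    proof (intro conjI ballI impI)
      fix x t assume "x \<in> S" "t \<in> {0..1}" "\<epsilon> \<le> max (a0 x) t"
      then show "\<delta> \<le> a0 (F1 (x, t))" using d1(2)[of "(x, t)"] that by auto
    next
      fix x t assume xt: "x \<in> S" "t \<in> {0..1}" "max (a0 x) t \<le> \<delta>"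
      show "a0 (F1 (x, t)) \<le> \<epsilon>"
      proof (rule ccontr)
        assume "\<not> a0 (F1 (x, t)) \<le> \<epsilon>"
        then have "d2 \<le> max (a0 x) t" using d2(2)[of "(x, t)"] xt by auto
        then show False using xt(3) that d2(1) by linarith
      qed
    next
      fix g x y assume "g \<in> carrier G" "x \<in> K \<epsilon>" "act g x \<in> K \<epsilon>" "y \<in> K \<epsilon>"
      then have "act g y \<in> (\<Union>g\<in>?\<Gamma>. act g ` K \<epsilon>)" by blast
      from d3(2)[OF this] show "\<delta> \<le> a0 (act g y)" using that by linarith
    qed
    then show ?thesis using d1 d2 d3 by (intro exI[of _ "min d1 (min (d2/2) d3)"]) auto
  qed
  obtain \<epsilon> l s where epos: "\<And>k. 0 < \<epsilon> k" and e1: "\<And>k. \<epsilon> k \<le> 1" and good: "\<And>k. Good k (\<epsilon> k) (\<epsilon> (Suc k))"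
    and l_cont: "continuous_on {0..1} l" and l01: "\<And>r. r \<in> {0..1} \<Longrightarrow> l r \<in> {0..1}" and l0: "l 0 = (0::real)"
    and le: "\<And>k. l (\<epsilon> k) = 1 / real (Suc k)"
    and lmono: "\<And>r r'. r \<in> {0..1} \<Longrightarrow> r' \<in> {0..1} \<Longrightarrow> l r \<le> l r' \<longleftrightarrow> r \<le> r'"
    and s_cont: "continuous_on {0..1} s" and s01: "\<And>t. t \<in> {0..1} \<Longrightarrow> s t \<in> {0..1}"
    and ls: "\<And>t. t \<in> {0..1} \<Longrightarrow> l (s t) = t" and s0: "s 0 = (0::real)" and s1: "s 1 = 1"
    by (rule adapted_rescaling[of Good, OF ex_Good]) (assumption, rule that)
  define a where "a x = l (a0 x)" for x
  define F' where "F' z = F1 (fst z, s (snd z))" for z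
  have a_cont: "continuous_on A a" for A
    unfolding a_def by (rule continuous_on_compose2[OF l_cont a0_cont]) (use a0_01 in auto)
  have a_01: "a x \<in> {0..1}" for x using l01[OF a0_01] by (simp add: a_def)
  have a_pos: "0 < a x \<longleftrightarrow> x \<notin> Z" for x
  proof -
    have "a x \<le> 0 \<longleftrightarrow> a0 x \<le> 0" using lmono[OF a0_01[of x], of 0] l0 by (simp add: a_def)
    then show ?thesis unfolding a0_pos[symmetric] by linarith
  qed
  have a_zero: "a x = 0 \<longleftrightarrow> x \<in> Z" for x using a_pos[of x] a_01[of x] by auto
  have a_ge: "1 / real (Suc k) \<le> a x \<longleftrightarrow> \<epsilon> k \<le> a0 x" for k x
    using lmono[of "\<epsilon> k" "a0 x"] le[of k] epos[of k] e1[of k] a0_01[of x] by (simp add: a_def)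
  have a_le: "a x \<le> 1 / real (Suc k) \<longleftrightarrow> a0 x \<le> \<epsilon> k" for k x
    using lmono[of "a0 x" "\<epsilon> k"] le[of k] epos[of k] e1[of k] a0_01[of x] by (simp add: a_def)
  have F'_cont: "continuous_on (S \<times> {0..1}) F'"
    unfolding F'_def
  proof (rule continuous_on_compose2[OF F1_cont])
    have "continuous_on (S \<times> {0..1::real}) (\<lambda>z. s (snd z))"
      by (rule continuous_on_compose2[OF s_cont]) (auto intro: continuous_intros)
    then show "continuous_on (S \<times> {0..1}) (\<lambda>z. (fst z, s (snd z)))"
      by (intro continuous_intros)
  qed (use s01 in auto)
  have bracket: "1 / m < real k + 2" "real k + 1 \<le> 1 / m"
    if "0 < m" "1 / real (Suc (Suc k)) < m" "m \<le> 1 / real (Suc k)" for m k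
    using that by (simp_all add: field_simps)
  have s_pos: "s t \<in> {0<..1}" if "t \<in> {0<..1}" for t
  proof -
    have "s t \<noteq> 0" using ls[of t] l0 that by force
    then show ?thesis using s01[of t] that by auto
  qed
  have X: "{x \<in> S. 0 < a x} = S - Z" using a_pos by blast
  have "controlled_EZ G n S a F' act"
  proof (rule controlled_EZ.intro)
    show "group G" "compact S" "S \<subseteq> euclid n" "continuous_on S a"
      by (fact grp S_compact S_sub a_cont)+
    show "S \<noteq> {}" using r_in by auto
    show "a x \<in> {0..1}" for x by (rule a_01)
    show "continuous_on (S \<times> {0..1}) F'" by (rule F'_cont)
    show "F' ` (S \<times> {0..1}) \<subseteq> S" using F1_in s01 by (auto simp: F'_def)
    show "F' (x, 0) = x" if "x \<in> S" for x using that by (simp add: F'_def s0 F1_0)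
    show "F' (x, 1) = F' (y, 1)" for x y by (simp add: F'_def s1 F1_def)
    show F'_pos: "0 < a (F' (x, t))" if "x \<in> S" "t \<in> {0<..1}" for x t
      using F1_off[OF that(1) s_pos[OF that(2)]] by (simp add: F'_def a_pos)
    show "absolute_extensor {x \<in> S. 0 < a x}"
      unfolding X
    proof (rule absolute_extensor_pushed_off[OF S_sub r_cont r_in r_id F_cont F_0])
      show "F (x, t) \<in> S - Z" if "x \<in> S" "t \<in> {0<..1}" for x t
        using F_off[OF that] F_in that by auto
    qed auto
    show "\<bar>a (F' (x, t)) - max (a x) t\<bar> \<le> 2 * a (F' (x, t)) * max (a x) t"
      if x: "x \<in> S" and t: "t \<in> {0<..1}" for x t
    proof -
      let ?A = "a (F' (x, t))" and ?M = "max (a x) t"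
      have st: "s t \<in> {0..1}" "l (s t) = t" using s01[of t] ls[of t] t by auto
      have A: "0 < ?A" "?A \<le> 1" using F'_pos[OF x t] a_01 by auto
      have M: "0 < ?M" "?M \<le> 1" using t a_01[of x] by auto
      obtain k where k: "1 / real (Suc (Suc k)) < ?M" "?M \<le> 1 / real (Suc k)"
        using reciprocal_bracket[OF M] by blast
      have e01: "\<epsilon> j \<in> {0..1}" for j using epos[of j] e1[of j] by simp
      have t_le: "t \<le> 1 / real (Suc j) \<longleftrightarrow> s t \<le> \<epsilon> j" for j
        using lmono[OF st(1) e01[of j]] by (simp only: le st(2))
      have t_ge: "1 / real (Suc j) \<le> t \<longleftrightarrow> \<epsilon> j \<le> s t" for j
        using lmono[OF e01[of j] st(1)] by (simp only: le st(2))
      have max_le: "max (a0 x) (s t) \<le> \<epsilon> k"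
        using k(2) a_le[of x k] t_le[of k] by simp
      have "1 / real (Suc (Suc k)) \<le> a x \<or> 1 / real (Suc (Suc k)) \<le> t"
        using k(1) by linarith
      then have max_ge: "\<epsilon> (Suc k) \<le> max (a0 x) (s t)"
        unfolding a_ge t_ge le_max_iff_disj .
      have "\<epsilon> (Suc (Suc k)) \<le> a0 (F1 (x, s t))"
        using good[of "Suc k"] x st(1) max_ge unfolding Good_def by blast
      then have low: "1 / real (Suc (Suc (Suc k))) \<le> ?A" unfolding a_ge F'_def by simp
      have up: "real k \<le> 1 / ?A"
      proof (cases k)
        case 0 then show ?thesis using A by simp
      next
        case (Suc j)
        have "a0 (F1 (x, s t)) \<le> \<epsilon> j"
          using good[of j] x st(1) max_le Suc unfolding Good_def by blast
        then have "?A \<le> 1 / real k" unfolding Suc a_le F'_def by simp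
        then show ?thesis using A Suc by (simp add: field_simps)
      qed
      have 1: "1 / ?A \<le> real k + 3" using low A by (simp add: field_simps)
      have 2: "1 / ?M < real k + 2" "real k + 1 \<le> 1 / ?M" using bracket[OF M(1) k] by blast+
      show ?thesis
        by (rule abs_diff_le_of_reciprocal[OF A(1) M(1)]) (use 1 2 up in linarith)+
    qed
    show "continuous_on S (act g)" if "g \<in> carrier G" for g using that by (rule act_cont)
    show "act g x \<in> S" if "g \<in> carrier G" "x \<in> S" for g x using that by (rule act_in)
    show "act \<one>\<^bsub>G\<^esub> x = x" if "x \<in> S" for x using that by (rule act_one)
    show "act (g \<otimes>\<^bsub>G\<^esub> h) x = act g (act h x)" if "g \<in> carrier G" "h \<in> carrier G" "x \<in> S" for g h x
      using that by (rule act_mult)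
    show "a (act g x) = 0 \<longleftrightarrow> a x = 0" if "g \<in> carrier G" "x \<in> S" for g x
      using act_Z[OF that] by (simp add: a_zero)
    show "1 / a (act g y) \<le> 1 / w + 2"
      if g: "g \<in> carrier G" and x: "x \<in> S" and y: "y \<in> S" and w: "0 < w" "w \<le> a x" "w \<le> a (act g x)" "w \<le> a y"
      for g x y w
    proof -
      have "w \<le> 1" using w a_01[of x] by auto
      then obtain k where k: "1 / real (Suc (Suc k)) < w" "w \<le> 1 / real (Suc k)"
        using reciprocal_bracket w(1) by blast
      have "\<epsilon> (Suc k) \<le> a0 x" "\<epsilon> (Suc k) \<le> a0 (act g x)" "\<epsilon> (Suc k) \<le> a0 y"
        unfolding a_ge[symmetric] using k(1) w by linarith+
      then have "x \<in> K (\<epsilon> (Suc k))" "act g x \<in> K (\<epsilon> (Suc k))" "y \<in> K (\<epsilon> (Suc k))"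
        using x y act_in[OF g x] by (auto simp: K_def)
      then have "\<epsilon> (Suc (Suc k)) \<le> a0 (act g y)" using good[of "Suc k"] g unfolding Good_def by blast
      then have low: "1 / real (Suc (Suc (Suc k))) \<le> a (act g y)" unfolding a_ge .
      moreover have "0 < a (act g y)" by (rule less_le_trans[OF _ low]) simp
      ultimately have "1 / a (act g y) \<le> real k + 3" by (simp add: field_simps)
      moreover have "real k + 1 \<le> 1 / w" using bracket[OF w(1) k] by blast
      ultimately show ?thesis by linarith
    qed
    show "\<exists>K. compact K \<and> K \<subseteq> {x \<in> S. 0 < a x} \<and> (\<forall>x\<in>S. 0 < a x \<longrightarrow> (\<exists>g\<in>carrier G. \<exists>k\<in>K. x = act g k))"
      using cocompact unfolding X by (auto simp: a_pos)
    show "\<exists>\<Gamma>. finite \<Gamma> \<and> (\<forall>g\<in>carrier G - \<Gamma>. \<forall>x\<in>C. a (act g x) < e \<and> (\<forall>y\<in>C. dist (act g x) (act g y) < e))"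
      if C: "compact C" "C \<subseteq> {x \<in> S. 0 < a x}" and e: "0 < e" for C and e :: real
    proof -
      have C': "C \<subseteq> S - Z" using C(2) unfolding X .
      obtain \<Gamma> where \<Gamma>: "finite \<Gamma>" "\<forall>g\<in>carrier G - \<Gamma>. \<forall>x\<in>C. \<forall>y\<in>C. dist (act g x) (act g y) < e"
        using null[OF C(1) C' e] by blast
      let ?K = "C \<union> (S \<inter> {x. e \<le> a x})"
      have "closed {x. e \<le> a x}" by (intro closed_Collect_le a_cont continuous_on_const)
      then have "compact ?K" using C(1) S_compact by (intro compact_Un compact_Int_closed)
      moreover have "x \<notin> Z" if "e \<le> a x" for x using a_pos[of x] e that by linarith
      then have "?K \<subseteq> S - Z" using C' by blast
      ultimately have fin: "finite {g \<in> carrier G. act g ` ?K \<inter> ?K \<noteq> {}}" by (rule finite_returns)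
      have "a (act g x) < e" if "g \<in> carrier G - (\<Gamma> \<union> {g \<in> carrier G. act g ` ?K \<inter> ?K \<noteq> {}})" "x \<in> C" for g x
      proof (rule ccontr)
        assume "\<not> a (act g x) < e"
        then have "act g x \<in> ?K" using act_in[of g x] that C' by auto
        then show False using that by blast
      qed
      then show ?thesis using \<Gamma> fin
        by (intro exI[of _ "\<Gamma> \<union> {g \<in> carrier G. act g ` ?K \<inter> ?K \<noteq> {}}"]) blast
    qed
  qed
  then show ?thesis by blast
qed

end

section \<open>Points of the join and the slope between two gauges\<close>

text \<open>
  The point $(1-s)x + sy$ of the join, in its standard embedding: the parameter, followed by the
  interleaved coordinates of $(1-s)x$ and $sy$, so that each factor is collapsed at one end.
\<close>
definition join_point :: "rseq \<times> rseq \<times> real \<Rightarrow> rseq" where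
  "join_point q k = (case q of (x, y, s) \<Rightarrow>
     if k = 0 then s else if odd k then (1 - s) * x (k div 2) else s * y (k div 2 - 1))"

lemma join_point_coords:
  "join_point (x, y, s) 0 = s"
  "join_point (x, y, s) (2 * i + 1) = (1 - s) * x i"
  "join_point (x, y, s) (2 * i + 2) = s * y i"
  by (simp_all add: join_point_def)

lemma join_point_eq_iff:
  "join_point (x, y, s) = join_point (x', y', s') \<longleftrightarrow> s = s' \<and> (s = 1 \<or> x = x') \<and> (s = 0 \<or> y = y')"
proof
  assume eq: "join_point (x, y, s) = join_point (x', y', s')"
  have s: "s = s'" using fun_cong[OF eq, of 0] by (simp add: join_point_coords)
  have "s = 1 \<or> x i = x' i" "s = 0 \<or> y i = y' i" for i
    using fun_cong[OF eq, of "2 * i + 1"] fun_cong[OF eq, of "2 * i + 2"] s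
    unfolding join_point_coords by auto
  then show "s = s' \<and> (s = 1 \<or> x = x') \<and> (s = 0 \<or> y = y')" using s by blast
next
  assume "s = s' \<and> (s = 1 \<or> x = x') \<and> (s = 0 \<or> y = y')"
  then show "join_point (x, y, s) = join_point (x', y', s')"
    by (intro ext) (auto simp: join_point_def)
qed

text \<open>
  Only the products with \<open>1 - h\<close> and \<open>h\<close> have to be continuous: a coordinate that is collapsed at
  an end of the join may behave badly there.
\<close>
lemma continuous_on_join_point:
  assumes "\<And>i. continuous_on A (\<lambda>z. (1 - h z) * f z i)" "\<And>i. continuous_on A (\<lambda>z. h z * g z i)" "continuous_on A h"
  shows "continuous_on A (\<lambda>z. join_point (f z, g z, h z))"
proof (rule continuous_on_coordinatewise_then_product)
  fix k
  have "(\<lambda>z. join_point (f z, g z, h z) k) = (if k = 0 then h else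
      if odd k then (\<lambda>z. (1 - h z) * f z (k div 2)) else (\<lambda>z. h z * g z (k div 2 - 1)))"
    by (auto simp: join_point_def)
  then show "continuous_on A (\<lambda>z. join_point (f z, g z, h z) k)"
    by (simp only: assms split: if_split) (simp add: assms)
qed

lemma continuous_on_descend:
  fixes e :: "'a::topological_space \<Rightarrow> 'b::t2_space" and f :: "'a \<Rightarrow> 'c::topological_space"
  assumes Q: "compact Q" "continuous_on Q e" "continuous_on Q f"
    and g: "\<And>q. q \<in> Q \<Longrightarrow> g (e q) = f q"
  shows "continuous_on (e ` Q) g"
  unfolding continuous_on_closed_invariant
proof (intro allI impI)
  fix B :: "'c set" assume "closed B"
  then obtain A where A: "closed A" "A \<inter> Q = f -` B \<inter> Q"
    using Q(3) unfolding continuous_on_closed_invariant by blast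
  have "compact (Q \<inter> A)" using Q(1) A(1) by (rule compact_Int_closed)
  then have "compact (e ` (Q \<inter> A))"
    by (intro compact_continuous_image continuous_on_subset[OF Q(2)]) auto
  then have "closed (e ` (Q \<inter> A))" by (rule compact_imp_closed)
  moreover have "q \<in> A \<longleftrightarrow> g (e q) \<in> B" if "q \<in> Q" for q
    using A(2) that unfolding g[OF that] by blast
  then have "e ` (Q \<inter> A) \<inter> e ` Q = g -` B \<inter> e ` Q" by auto
  ultimately show "\<exists>A. closed A \<and> A \<inter> e ` Q = g -` B \<inter> e ` Q" by blast
qed

text \<open>
  Bounded errors in the reciprocals of two gauges whose ratio is \<open>s : 1 - s\<close> change the
  ratio by an amount that vanishes with the total size \<open>m\<close>: the leading terms of
  \<open>(1 - s) * A - s * B\<close> cancel, and the errors are of second order.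
\<close>
lemma slope_estimate:
  fixes A B C m s :: real
  assumes "0 \<le> A" "0 \<le> B" "0 < A + B" "s \<in> {0..1}" "0 \<le> C" "0 \<le> m"
    and A: "\<bar>A - s * m\<bar> \<le> C * A * (s * m)" and B: "\<bar>B - (1 - s) * m\<bar> \<le> C * B * ((1 - s) * m)"
  shows "\<bar>A / (A + B) - s\<bar> \<le> C * m"
proof -
  have "A / (A + B) - s = ((1 - s) * (A - s * m) - s * (B - (1 - s) * m)) / (A + B)"
    using assms(3) by (simp add: field_simps)
  then have "\<bar>A / (A + B) - s\<bar> = \<bar>(1 - s) * (A - s * m) - s * (B - (1 - s) * m)\<bar> / (A + B)"
    using assms(3) by simp
  also have "\<dots> \<le> ((1 - s) * (C * A * (s * m)) + s * (C * B * ((1 - s) * m))) / (A + B)"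
  proof (rule divide_right_mono)
    have "\<bar>(1 - s) * (A - s * m) - s * (B - (1 - s) * m)\<bar> \<le> (1 - s) * \<bar>A - s * m\<bar> + s * \<bar>B - (1 - s) * m\<bar>"
      using assms(4) by (intro order_trans[OF abs_triangle_ineq4]) (simp add: abs_mult)
    also have "\<dots> \<le> (1 - s) * (C * A * (s * m)) + s * (C * B * ((1 - s) * m))"
      using assms(4) A B by (intro add_mono mult_left_mono) auto
    finally show "\<bar>(1 - s) * (A - s * m) - s * (B - (1 - s) * m)\<bar> \<le> (1 - s) * (C * A * (s * m)) + s * (C * B * ((1 - s) * m))" .
  qed (use assms(3) in simp)
  also have "\<dots> = C * (s * (1 - s)) * m"
    using assms(3) by (simp add: field_simps)
  also have "\<dots> \<le> C * 1 * m"
    using assms by (intro mult_right_mono mult_left_mono mult_le_one) auto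
  finally show ?thesis by simp
qed

text \<open>
  At a common zero of numerator and denominator the quotient is filled in by \<open>w\<close>; the bound \<open>c\<close>
  forces it to converge to \<open>w\<close> there.
\<close>
lemma continuous_on_quotient_or:
  fixes u v w c :: "'a::metric_space \<Rightarrow> real"
  assumes cont: "continuous_on A u" "continuous_on A v" "continuous_on A w" "continuous_on A c"
    and bd: "\<And>z. z \<in> A \<Longrightarrow> u z \<noteq> 0 \<Longrightarrow> \<bar>v z / u z - w z\<bar> \<le> c z"
    and c0: "\<And>z. z \<in> A \<Longrightarrow> 0 \<le> c z" "\<And>z. z \<in> A \<Longrightarrow> u z = 0 \<Longrightarrow> c z = 0"
  shows "continuous_on A (\<lambda>z. if u z = 0 then w z else v z / u z)"
  unfolding continuous_on_def
proof
  fix z assume z: "z \<in> A"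
  note tend = cont[unfolded continuous_on_def, rule_format, OF z]
  have inA: "eventually (\<lambda>x. x \<in> A) (at z within A)" by (simp add: eventually_at_filter)
  show "((\<lambda>z. if u z = 0 then w z else v z / u z) \<longlongrightarrow> (if u z = 0 then w z else v z / u z)) (at z within A)"
  proof (cases "u z = 0")
    case False
    have "((\<lambda>z. v z / u z) \<longlongrightarrow> v z / u z) (at z within A)"
      using tend False by (intro tendsto_intros)
    moreover have "eventually (\<lambda>x. u x \<noteq> 0) (at z within A)"
      using tend(1) False by (rule tendsto_imp_eventually_ne)
    ultimately show ?thesis using False
      by (auto elim!: Lim_transform_eventually eventually_mono)
  next
    case True
    have "((\<lambda>x. (if u x = 0 then w x else v x / u x) - w x) \<longlongrightarrow> 0) (at z within A)"
    proof (rule Lim_null_comparison)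
      show "(c \<longlongrightarrow> 0) (at z within A)" using tend(4) c0(2)[OF z True] by simp
      show "\<forall>\<^sub>F x in at z within A. norm ((if u x = 0 then w x else v x / u x) - w x) \<le> c x"
        using inA by (rule eventually_mono) (use bd c0 in auto)
    qed
    from tendsto_add[OF this tend(3)] show ?thesis using True by simp
  qed
qed

text \<open>
  The time for which the first coordinate of a join point with parameter \<open>s\<close> is pushed at stage
  \<open>t\<close>; the second coordinate uses \<open>1 - s\<close>. In the middle of the join it is \<open>t * s\<close>, which keeps
  the ratio of the two times equal to that of the gauges. The term \<open>t * t\<close> keeps it positive at
  \<open>s = 0\<close>, and the last term raises it to the full time \<open>1\<close> at \<open>s = 1\<close>, where the first
  coordinate is collapsed and must be contracted to a point. The jump at \<open>s = 1\<close>, \<open>t = 0\<close> is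
  harmless for the same reason.
\<close>
definition push_time :: "real \<Rightarrow> real \<Rightarrow> real" where
  "push_time s t = (if t = 0 then 0 else max (max (t * s) (t * t)) (1 - (1 - s) / t))"

lemma push_time_bounds:
  assumes "s \<in> {0..1}" "t \<in> {0..1}"
  shows "push_time s t \<in> {0..1}" "0 < t \<Longrightarrow> 0 < push_time s t" "t * s \<le> push_time s t"
proof -
  have "t * s \<le> 1" "t * t \<le> 1" using assms by (auto intro: mult_le_one)
  moreover have "0 < t \<Longrightarrow> (1 - s) / t \<ge> 0" using assms by simp
  ultimately show "push_time s t \<in> {0..1}" using assms by (auto simp: push_time_def le_max_iff_disj)
  show "0 < push_time s t" if "0 < t" using that by (auto simp: push_time_def less_max_iff_disj)
  show "t * s \<le> push_time s t" by (auto simp: push_time_def)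
qed

lemma push_time_eq:
  assumes "s \<in> {0..1}" "0 < t" "s \<le> 1 - t"
  shows "push_time s t = t * max s t"
proof -
  have "1 - (1 - s) / t \<le> 0" using assms by (simp add: field_simps)
  moreover have "0 \<le> t * t" using assms by simp
  ultimately have "1 - (1 - s) / t \<le> t * t" by linarith
  then have "push_time s t = max (t * s) (t * t)"
    using assms(2) by (simp add: push_time_def max_absorb1 le_max_iff_disj)
  also have "\<dots> = t * max s t" using assms by (auto simp: max_def mult_left_mono not_le)
  finally show ?thesis .
qed

lemma push_time_one: "0 < t \<Longrightarrow> t \<le> 1 \<Longrightarrow> push_time 1 t = 1"
  by (simp add: push_time_def max_def mult_le_one)

lemma (in controlled_EZ) interior_ne: "\<exists>x\<in>S. 0 < a x"
proof -
  obtain x where "x \<in> S" using S_ne by blast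
  then have "F (x, 1) \<in> S" "0 < a (F (x, 1))" using F_in F_off[of x 1] by (auto simp: image_subset_iff)
  then show ?thesis by blast
qed

lemma (in controlled_EZ) act_inv_act: "g \<in> carrier G \<Longrightarrow> x \<in> S \<Longrightarrow> act (inv\<^bsub>G\<^esub> g) (act g x) = x"
  using act_mult[of "inv\<^bsub>G\<^esub> g" g x] act_one group.l_inv[OF grp] group.inv_closed[OF grp] by simp

lemma (in controlled_EZ) a_nonneg: "x \<in> S \<Longrightarrow> 0 \<le> a x" and a_le_1: "x \<in> S \<Longrightarrow> a x \<le> 1"
  using a_01 by auto

lemma (in controlled_EZ) act_pos: "g \<in> carrier G \<Longrightarrow> x \<in> S \<Longrightarrow> 0 < a (act g x) \<longleftrightarrow> 0 < a x"
  using act_zero a_nonneg act_in by (metis less_le)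

text \<open>
  Apply \<open>act_ctrl\<close> with a fixed interior point, for the group element and for its inverse.
\<close>
lemma (in controlled_EZ) act_distortion:
  assumes g: "g \<in> carrier G"
  obtains C where "0 \<le> C" "\<And>x. x \<in> S \<Longrightarrow> \<bar>a (act g x) - a x\<bar> \<le> C * a (act g x) * a x"
proof -
  obtain x0 where x0: "x0 \<in> S" "0 < a x0" using interior_ne by blast
  let ?x1 = "act g x0" and ?h = "inv\<^bsub>G\<^esub> g"
  have h: "?h \<in> carrier G" using group.inv_closed[OF grp g] .
  have x1: "?x1 \<in> S" "0 < a ?x1" using g x0 act_in act_pos by auto
  have hx1: "act ?h ?x1 = x0" using act_inv_act[OF g x0(1)] .
  define w0 where "w0 = min (a x0) (a ?x1)"
  have w0: "0 < w0" "w0 \<le> a x0" "w0 \<le> a ?x1" using x0 x1 by (auto simp: w0_def)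
  define C where "C = 1 / w0 + 2"
  have C: "0 \<le> C" using w0 by (simp add: C_def)
  have split: "1 / min w0 v + 2 \<le> 1 / v + C" if "0 < v" for v
    using that w0(1) by (auto simp: C_def min_def)
  have "\<bar>a (act g x) - a x\<bar> \<le> C * a (act g x) * a x" if x: "x \<in> S" for x
  proof (cases "a x = 0")
    case True
    then show ?thesis using act_zero[OF g x] by simp
  next
    case False
    then have p: "0 < a x" "0 < a (act g x)" using act_pos[OF g x] a_nonneg[OF x] by auto
    show ?thesis
    proof (rule abs_diff_le_of_reciprocal[OF p(2) p(1)])
      have "1 / a (act g x) \<le> 1 / min w0 (a x) + 2"
        by (rule act_ctrl[OF g x0(1) x]) (use w0 p in auto)
      then show "1 / a (act g x) \<le> 1 / a x + C" using split[OF p(1)] by linarith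
      have "1 / a (act ?h (act g x)) \<le> 1 / min w0 (a (act g x)) + 2"
        by (rule act_ctrl[OF h x1(1) act_in[OF g x]]) (use w0 p hx1 in auto)
      then show "1 / a x \<le> 1 / a (act g x) + C"
        using split[OF p(2)] act_inv_act[OF g x] by simp
    qed
  qed
  then show ?thesis using that C by blast
qed

text \<open>
  Here the constant is independent of the group element: the reference point is itself
  a point of \<open>K\<close>, whose translate is one of the two translates compared.
\<close>
lemma (in controlled_EZ) translate_distortion:
  assumes K: "compact K" "K \<subseteq> {x \<in> S. 0 < a x}"
  obtains C where "0 \<le> C"
    "\<And>g x y. g \<in> carrier G \<Longrightarrow> x \<in> K \<Longrightarrow> y \<in> K \<Longrightarrow> \<bar>a (act g y) - a (act g x)\<bar> \<le> C * a (act g y) * a (act g x)"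
proof -
  have "continuous_on K a" using a_cont by (rule continuous_on_subset) (use K in blast)
  then obtain w0 where w0: "0 < w0" "\<And>x. x \<in> K \<Longrightarrow> w0 \<le> a x"
    by (rule compact_positive_lower_bound[OF K(1)]) (use K in auto)
  define C where "C = 1 / w0 + 2"
  have C: "0 \<le> C" using w0 by (simp add: C_def)
  have split: "1 / min w0 v + 2 \<le> 1 / v + C" if "0 < v" for v
    using that w0(1) by (auto simp: C_def min_def)
  have 1: "1 / a (act g y) \<le> 1 / a (act g x) + C" if "g \<in> carrier G" "x \<in> K" "y \<in> K" for g x y
  proof -
    have p: "0 < a (act g x)" using act_pos[of g x] that K by auto
    have "1 / a (act g y) \<le> 1 / min w0 (a (act g x)) + 2"
      by (rule act_ctrl[of g x y]) (use that w0 p K in \<open>auto simp: min_le_iff_disj\<close>)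
    then show ?thesis using split[OF p] by linarith
  qed
  have "\<bar>a (act g y) - a (act g x)\<bar> \<le> C * a (act g y) * a (act g x)" if "g \<in> carrier G" "x \<in> K" "y \<in> K" for g x y
    using that act_pos[of g x] act_pos[of g y] K
    by (intro abs_diff_le_of_reciprocal 1) auto
  then show ?thesis using that C by blast
qed

lemma (in controlled_EZ) F_closed: "x \<in> S \<Longrightarrow> t \<in> {0..1} \<Longrightarrow> F (x, t) \<in> S"
  using F_in by (simp add: image_subset_iff)

lemma (in controlled_EZ) push_comparable:
  assumes "x \<in> S" "t \<in> {0<..1}"
  shows "max (a x) t \<le> 3 * a (F (x, t))" "a (F (x, t)) \<le> 3 * max (a x) t"
proof -
  let ?A = "a (F (x, t))" and ?M = "max (a x) t"
  have A: "0 < ?A" "?A \<le> 1" using F_off[OF assms] a_le_1[OF F_closed[of x t]] assms by auto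
  have M: "0 < ?M" "?M \<le> 1" using assms a_le_1 by auto
  have c: "\<bar>?A - ?M\<bar> \<le> 2 * ?A * ?M" by (rule F_ctrl[OF assms])
  have "?A * ?M \<le> ?A" "?A * ?M \<le> ?M" using A M by (simp_all add: mult_left_le mult_left_le_one_le)
  then show "?M \<le> 3 * ?A" "?A \<le> 3 * ?M" using c by linarith+
qed

lemma (in controlled_EZ) push_uniformly_close:
  assumes "0 < (e::real)"
  obtains d where "0 < d" "\<And>x t. x \<in> S \<Longrightarrow> 0 \<le> t \<Longrightarrow> t < d \<Longrightarrow> t \<le> 1 \<Longrightarrow> \<bar>a (F (x, t)) - a x\<bar> < e"
proof -
  have "continuous_on (S \<times> {0..1}) (\<lambda>z. a (F z))"
    by (rule continuous_on_compose2[OF a_cont F_cont F_in])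
  then have uc: "uniformly_continuous_on (S \<times> {0..1}) (\<lambda>z. a (F z))"
    by (intro compact_uniformly_continuous compact_Times S_compact compact_Icc)
  from uc[unfolded uniformly_continuous_on_def, THEN spec, THEN mp, OF assms]
  obtain d where d: "0 < d" "\<forall>z\<in>S \<times> {0..1}. \<forall>z'\<in>S \<times> {0..1}. dist z' z < d \<longrightarrow> dist (a (F z')) (a (F z)) < e"
    by (elim exE conjE) (rule that)
  have "\<bar>a (F (x, t)) - a x\<bar> < e" if "x \<in> S" "0 \<le> t" "t < d" "t \<le> 1" for x t
    using d(2)[rule_format, of "(x, 0)" "(x, t)"] that F_0 by (simp add: dist_Pair_Pair dist_real_def)
  then show ?thesis using that d(1) by blast
qed

text \<open>
  The ambient situation for the product: \<open>X\<close> and \<open>Y\<close> are only qualifiers for the two factors.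
\<close>
locale product_EZ =
  X: controlled_EZ G m S a F act + Y: controlled_EZ H n T b E act'
  for G :: "('g, 'v) monoid_scheme" and m S a F act
    and H :: "('h, 'w) monoid_scheme" and n T b E act'
begin

text \<open>
  The compactification before collapsing. Away from the boundary \<open>s\<close> is determined by \<open>x\<close> and
  \<open>y\<close>; over a pair of boundary points it is free.
\<close>
definition Q :: "(rseq \<times> rseq \<times> real) set" where
  "Q = {(x, y, s). x \<in> S \<and> y \<in> T \<and> s \<in> {0..1} \<and> (1 - s) * a x = s * b y}"

text \<open>
  The value \<open>s\<close> stands in when both points are on the boundary, where the gauges do not determine
  the parameter.
\<close>
definition slope :: "rseq \<Rightarrow> rseq \<Rightarrow> real \<Rightarrow> real" where
  "slope x y s = (if a x + b y = 0 then s else a x / (a x + b y))"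

definition joined :: "rseq \<Rightarrow> rseq \<Rightarrow> real \<Rightarrow> rseq" where
  "joined x y s = join_point (x, y, slope x y s)"

lemma slope_in_Q:
  assumes "x \<in> S" "y \<in> T" "s \<in> {0..1}"
  shows "(x, y, slope x y s) \<in> Q"
proof -
  have ab: "0 \<le> a x" "0 \<le> b y" using assms X.a_nonneg Y.a_nonneg by auto
  show ?thesis
  proof (cases "a x + b y = 0")
    case True
    then have "a x = 0" "b y = 0" using ab by linarith+
    then show ?thesis using assms by (simp add: Q_def slope_def)
  next
    case False
    then have c: "0 < a x + b y" using ab by linarith
    then have "1 - slope x y s = b y / (a x + b y)" "slope x y s = a x / (a x + b y)"
      by (simp_all add: slope_def field_simps)
    then show ?thesis using assms ab c by (simp add: Q_def)
  qed
qed

lemma Q_weights: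
  assumes "(x, y, s) \<in> Q"
  shows "a x = s * (a x + b y)" "b y = (1 - s) * (a x + b y)"
  using assms by (simp_all add: Q_def algebra_simps)

lemma slope_on_Q: assumes "(x, y, s) \<in> Q" shows "slope x y s = s"
  by (simp add: slope_def nonzero_divide_eq_eq Q_weights(1)[OF assms, symmetric])

lemma slope_ends: "a x = 0 \<Longrightarrow> slope x y 0 = 0" "b y = 0 \<Longrightarrow> slope x y 1 = 1"
  by (auto simp: slope_def)

lemma Q_ends: "(x, y, 0) \<in> Q \<Longrightarrow> a x = 0" "(x, y, 1) \<in> Q \<Longrightarrow> b y = 0"
  by (auto simp: Q_def)

text \<open>
  The construction is symmetric under exchanging the factors and \<open>s\<close> with \<open>1 - s\<close>, so statements
  about one end of the join are transferred to the other.
\<close>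
lemma product_swap: "product_EZ H n T b E act' G m S a F act"
  by (rule product_EZ.intro[OF Y.controlled_EZ_axioms X.controlled_EZ_axioms])

lemma slope_swap:
  assumes "0 \<le> a x" "0 \<le> b y"
  shows "product_EZ.slope b a y x (1 - s) = 1 - slope x y s"
proof -
  have "1 - a x / (a x + b y) = b y / (a x + b y)" if "a x + b y \<noteq> 0"
    using that by (simp add: field_simps)
  then show ?thesis
    by (simp add: slope_def product_EZ.slope_def[OF product_swap] add.commute)
qed

lemma Q_swap: "(y, x, 1 - s) \<in> product_EZ.Q T b S a \<longleftrightarrow> (x, y, s) \<in> Q"
  by (auto simp: Q_def product_EZ.Q_def[OF product_swap])

end

section \<open>Pushing the compactification off its boundary\<close>

lemma continuous_on_cylinder:
  fixes f :: "'a::topological_space \<times> real \<Rightarrow> 'b::topological_space"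
  assumes pos: "continuous_on (K \<times> {0<..1}) f"
    and zero: "\<And>q. q \<in> K \<Longrightarrow> (f \<longlongrightarrow> f (q, 0)) (at (q, 0) within K \<times> {0..1})"
  shows "continuous_on (K \<times> {0..1}) f"
  unfolding continuous_on_def
proof
  fix z :: "'a \<times> real" assume z: "z \<in> K \<times> {0..1}"
  obtain q t where qt: "z = (q, t)" by (cases z)
  show "(f \<longlongrightarrow> f z) (at z within K \<times> {0..1})"
  proof (cases "t = 0")
    case True
    then show ?thesis using zero z qt by auto
  next
    case False
    have "open (UNIV \<times> {0<..} :: ('a \<times> real) set)" by (intro open_Times) auto
    then have "at z within K \<times> {0..1} = at z within K \<times> {0<..1}"
      by (rule at_within_nhd[rotated]) (use z qt False in auto)
    moreover have "z \<in> K \<times> {0<..1}" using z qt False by auto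
    then have "(f \<longlongrightarrow> f z) (at z within K \<times> {0<..1})" using pos unfolding continuous_on_def by blast
    ultimately show ?thesis by (simp only:)
  qed
qed

lemma continuous_on_push_time:
  assumes "continuous_on A f" "continuous_on A g" "\<And>z. z \<in> A \<Longrightarrow> g z \<noteq> 0"
  shows "continuous_on A (\<lambda>z. push_time (f z) (g z))"
proof (rule continuous_on_eq)
  show "continuous_on A (\<lambda>z. max (max (g z * f z) (g z * g z)) (1 - (1 - f z) / g z))"
    using assms by (intro continuous_intros) auto
qed (use assms in \<open>simp add: push_time_def\<close>)

context product_EZ
begin

definition push_slope :: "rseq \<Rightarrow> rseq \<Rightarrow> real \<Rightarrow> real \<Rightarrow> real" where
  "push_slope x y s t = slope (F (x, push_time s t)) (E (y, push_time (1 - s) t)) s"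

lemma Q_D: assumes "(x, y, s) \<in> Q" shows "x \<in> S" "y \<in> T" "s \<in> {0..1}" "1 - s \<in> {0..1}"
  using assms by (auto simp: Q_def)

lemma push_slope_0: "(x, y, s) \<in> Q \<Longrightarrow> push_slope x y s 0 = s"
  by (simp add: push_slope_def push_time_def X.F_0 Y.F_0 Q_D slope_on_Q)

lemma pushed_in:
  assumes "(x, y, s) \<in> Q" "t \<in> {0..1}"
  shows "F (x, push_time s t) \<in> S" "E (y, push_time (1 - s) t) \<in> T"
  using assms X.F_closed Y.F_closed push_time_bounds(1) Q_D by metis+

lemma pushed_pos:
  assumes "(x, y, s) \<in> Q" "t \<in> {0<..1}"
  shows "0 < a (F (x, push_time s t))" "0 < b (E (y, push_time (1 - s) t))"
proof -
  have t: "t \<in> {0..1}" "0 < t" using assms by auto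
  show "0 < a (F (x, push_time s t))"
    using push_time_bounds(1,2)[OF Q_D(3)[OF assms(1)] t(1)] t Q_D[OF assms(1)] by (intro X.F_off) auto
  show "0 < b (E (y, push_time (1 - s) t))"
    using push_time_bounds(1,2)[OF Q_D(4)[OF assms(1)] t(1)] t Q_D[OF assms(1)] by (intro Y.F_off) auto
qed

lemma push_slope_eq:
  assumes "(x, y, s) \<in> Q" "t \<in> {0<..1}"
  shows "push_slope x y s t = a (F (x, push_time s t)) / (a (F (x, push_time s t)) + b (E (y, push_time (1 - s) t)))"
  using pushed_pos[OF assms] by (simp add: push_slope_def slope_def)

lemma push_slope_swap:
  assumes "(x, y, s) \<in> Q" "t \<in> {0..1}"
  shows "product_EZ.push_slope b E a F y x (1 - s) t = 1 - push_slope x y s t"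
  using slope_swap[of "F (x, push_time s t)" "E (y, push_time (1 - s) t)" s] pushed_in[OF assms]
  by (simp add: push_slope_def product_EZ.push_slope_def[OF product_swap] X.a_nonneg Y.a_nonneg)

text \<open>
  Near the end \<open>s = 0\<close> the second coordinate is contracted and the two times are not in
  proportion any more. Still, the gauge of the first coordinate is at most of the order \<open>t\<close> compared
  with that of the second, so the slope stays of order \<open>t\<close>.
\<close>
lemma push_slope_near_end:
  assumes q: "(x, y, s) \<in> Q" and t: "0 < t" "t \<le> 1 / 2" and s: "s < t"
  shows "\<bar>push_slope x y s t - s\<bar> \<le> 18 * t"
proof -
  define c where "c = a x + b y"
  define M where "M = max c t"
  define A where "A = a (F (x, push_time s t))"
  define B where "B = b (E (y, push_time (1 - s) t))"
  note xy = Q_D[OF q]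
  have ab: "a x = s * c" "b y = (1 - s) * c" using Q_weights[OF q] by (simp_all add: c_def)
  have c0: "0 \<le> c" using X.a_nonneg[OF xy(1)] Y.a_nonneg[OF xy(2)] by (simp add: c_def)
  have M0: "0 < M" using t by (simp add: M_def)
  have t01: "t \<in> {0..1}" "t \<in> {0<..1}" using t by auto
  have p: "push_time s t \<in> {0<..1}" "push_time (1 - s) t \<in> {0<..1}"
    using push_time_bounds(1,2)[OF xy(3) t01(1)] push_time_bounds(1,2)[OF xy(4) t01(1)] t by auto
  have AB: "0 < A" "0 < B" using pushed_pos[OF q t01(2)] by (simp_all add: A_def B_def)
  have "push_time s t = t * t" using push_time_eq[of s t] xy s t by (simp add: max_def)
  then have "max (a x) (push_time s t) \<le> t * M"
    using ab s t c0 by (auto simp: M_def le_max_iff_disj intro: mult_mono)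
  moreover have "A \<le> 3 * max (a x) (push_time s t)"
    unfolding A_def by (rule X.push_comparable(2)[OF xy(1) p(1)])
  ultimately have A1: "A \<le> 3 * (t * M)" by linarith
  have "(1 - s) * M \<le> max (b y) (push_time (1 - s) t)"
    using push_time_bounds(3)[OF xy(4) t01(1)] ab by (auto simp: M_def le_max_iff_disj max_def mult.commute)
  moreover have "M / 2 \<le> (1 - s) * M" using s t M0 by (simp add: field_simps)
  moreover have "max (b y) (push_time (1 - s) t) \<le> 3 * B"
    unfolding B_def by (rule Y.push_comparable(1)[OF xy(2) p(2)])
  ultimately have B1: "M \<le> 6 * B" by linarith
  have "A \<le> 3 * t * M" using A1 by simp
  also have "\<dots> \<le> 3 * t * (6 * B)" using B1 t by (intro mult_left_mono) auto
  finally have "A \<le> 18 * t * B" by simp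
  also have "\<dots> \<le> 18 * t * (A + B)" using AB t by (intro mult_left_mono) auto
  finally have "A / (A + B) \<le> 18 * t" using AB by (simp add: divide_le_eq)
  moreover have "0 \<le> A / (A + B)" using AB by simp
  moreover have "push_slope x y s t = A / (A + B)" using push_slope_eq[OF q t01(2)] by (simp add: A_def B_def)
  ultimately show ?thesis using s xy(3) t by auto
qed

text \<open>
  Between the ends there are two regimes: if the gauges are small, the times are proportional to
  them and \<open>slope_estimate\<close> applies; if they are not small, the gauges hardly change in a short
  time.
\<close>
lemma push_slope_uniform:
  assumes e: "0 < e"
  obtains d where "0 < d" "\<And>x y s t. (x, y, s) \<in> Q \<Longrightarrow> 0 < t \<Longrightarrow> t < d \<Longrightarrow> \<bar>push_slope x y s t - s\<bar> < e"
proof -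
  have e2: "0 < e * e / 10" using e by simp
  obtain d1 where d1: "0 < d1" "\<And>x t. x \<in> S \<Longrightarrow> 0 \<le> t \<Longrightarrow> t < d1 \<Longrightarrow> t \<le> 1 \<Longrightarrow> \<bar>a (F (x, t)) - a x\<bar> < e * e / 10"
    by (rule X.push_uniformly_close[OF e2]) (rule that)
  obtain d2 where d2: "0 < d2" "\<And>y t. y \<in> T \<Longrightarrow> 0 \<le> t \<Longrightarrow> t < d2 \<Longrightarrow> t \<le> 1 \<Longrightarrow> \<bar>b (E (y, t)) - b y\<bar> < e * e / 10"
    by (rule Y.push_uniformly_close[OF e2]) (rule that)
  define d where "d = min (1/2) (min (e / 18) (min d1 d2))"
  have d: "0 < d" using e d1 d2 by (simp add: d_def)
  interpret swap: product_EZ H n T b E act' G m S a F act by (rule product_swap)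
  have "\<bar>push_slope x y s t - s\<bar> < e" if q: "(x, y, s) \<in> Q" and t: "0 < t" "t < d" for x y s t
  proof -
    note xy = Q_D[OF q]
    have t01: "t \<in> {0..1}" "t \<in> {0<..1}" using t by (auto simp: d_def)
    have td: "t < 1/2" "18 * t < e" "t < d1" "t < d2" using t by (auto simp: d_def)
    consider "s < t" | "1 - s < t" | "t \<le> s" "s \<le> 1 - t" by linarith
    then show ?thesis
    proof cases
      case 1
      then show ?thesis using push_slope_near_end[OF q t(1) _ 1] td by linarith
    next
      case 2
      have "\<bar>swap.push_slope y x (1 - s) t - (1 - s)\<bar> \<le> 18 * t"
        by (rule swap.push_slope_near_end) (use q Q_swap t td 2 in auto)
      then show ?thesis using push_slope_swap[OF q t01(1)] td by linarith
    next
      case 3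
      define c where "c = a x + b y"
      define M where "M = max c t"
      define A where "A = a (F (x, t * s))"
      define B where "B = b (E (y, t * (1 - s)))"
      have pt: "push_time s t = t * s" "push_time (1 - s) t = t * (1 - s)"
        using push_time_eq[OF xy(3) t(1)] push_time_eq[OF xy(4) t(1)] 3 by (simp_all add: max_def)
      have ab: "a x = s * c" "b y = (1 - s) * c" using Q_weights[OF q] by (simp_all add: c_def)
      have c0: "0 \<le> c" using X.a_nonneg[OF xy(1)] Y.a_nonneg[OF xy(2)] by (simp add: c_def)
      have s1: "0 < s" "0 < 1 - s" using 3 t by auto
      have p: "t * s \<in> {0<..1}" "t * (1 - s) \<in> {0<..1}"
        using t01 xy s1 by (auto intro: mult_le_one)
      have AB: "0 < A" "0 < B" using pushed_pos[OF q t01(2)] by (simp_all add: A_def B_def pt)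
      have sl: "push_slope x y s t = A / (A + B)" using push_slope_eq[OF q t01(2)] by (simp add: A_def B_def pt)
      have mx: "max (a x) (t * s) = s * M" "max (b y) (t * (1 - s)) = (1 - s) * M"
        using s1 by (auto simp: ab M_def max_def mult.commute)
      \<comment> \<open>The threshold is chosen so that \<open>2 * M < e\<close> below it; above it \<open>A + B\<close> is at least \<open>e / 9\<close>.\<close>
      show ?thesis
      proof (cases "c < e / 3")
        case True
        have "\<bar>A / (A + B) - s\<bar> \<le> 2 * M"
          using X.F_ctrl[OF xy(1) p(1)] Y.F_ctrl[OF xy(2) p(2)] AB xy(3) t
          by (intro slope_estimate) (auto simp: mx A_def B_def M_def)
        moreover have "2 * M < e" using True td(2) t by (auto simp: M_def)
        ultimately show ?thesis using sl by simp
      next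
        case False
        have tm: "t * s \<le> t" "t * (1 - s) \<le> t" using t xy(3) by (auto intro: mult_left_le)
        have cl: "\<bar>A - s * c\<bar> < e * e / 10" "\<bar>B - (1 - s) * c\<bar> < e * e / 10"
          unfolding A_def B_def ab[symmetric] using p tm td
          by (intro d1(2) d2(2) xy; simp only: greaterThanAtMost_iff; linarith)+
        have "s * M \<le> 3 * A" "(1 - s) * M \<le> 3 * B"
          using X.push_comparable(1)[OF xy(1) p(1)] Y.push_comparable(1)[OF xy(2) p(2)]
          by (simp_all add: A_def B_def mx)
        moreover have "s * M + (1 - s) * M = M" by (simp add: algebra_simps)
        moreover have "c \<le> M" by (simp add: M_def)
        ultimately have big: "e / 9 \<le> A + B" using False by linarith
        have "A / (A + B) - s = ((1 - s) * (A - s * c) - s * (B - (1 - s) * c)) / (A + B)"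
          using AB by (simp add: field_simps)
        then have "\<bar>A / (A + B) - s\<bar> = \<bar>(1 - s) * (A - s * c) - s * (B - (1 - s) * c)\<bar> / (A + B)"
          using AB by simp
        also have "\<dots> \<le> (e * e / 10) / (A + B)"
        proof (rule divide_right_mono)
          have "\<bar>(1 - s) * (A - s * c) - s * (B - (1 - s) * c)\<bar> \<le> (1 - s) * \<bar>A - s * c\<bar> + s * \<bar>B - (1 - s) * c\<bar>"
            using xy(3) by (intro order_trans[OF abs_triangle_ineq4]) (simp add: abs_mult)
          also have "\<dots> \<le> (1 - s) * (e * e / 10) + s * (e * e / 10)"
            using xy(3) cl by (intro add_mono mult_left_mono) auto
          also have "(1 - s) * k + s * k = k" for k by (simp add: algebra_simps)
          finally show "\<bar>(1 - s) * (A - s * c) - s * (B - (1 - s) * c)\<bar> \<le> e * e / 10" .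
        qed (use AB in simp)
        also have "\<dots> \<le> (e * e / 10) / (e / 9)"
          using big e AB by (intro divide_left_mono) auto
        also have "\<dots> < e" using e by simp
        finally show ?thesis using sl by simp
      qed
    qed
  qed
  then show ?thesis using that d by blast
qed

lemma pushed_cont:
  "continuous_on (Q \<times> {0<..1}) (\<lambda>z. F (fst (fst z), push_time (snd (snd (fst z))) (snd z)))"
  "continuous_on (Q \<times> {0<..1}) (\<lambda>z. E (fst (snd (fst z)), push_time (1 - snd (snd (fst z))) (snd z)))"
proof -
  have "continuous_on (Q \<times> {0<..1}) (\<lambda>z. push_time (snd (snd (fst z))) (snd z))"
    "continuous_on (Q \<times> {0<..1}) (\<lambda>z. push_time (1 - snd (snd (fst z))) (snd z))"
    by (intro continuous_on_push_time continuous_intros; force)+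
  then show "continuous_on (Q \<times> {0<..1}) (\<lambda>z. F (fst (fst z), push_time (snd (snd (fst z))) (snd z)))"
    "continuous_on (Q \<times> {0<..1}) (\<lambda>z. E (fst (snd (fst z)), push_time (1 - snd (snd (fst z))) (snd z)))"
    using push_time_bounds(1)
    by (intro continuous_on_compose2[OF X.F_cont] continuous_on_compose2[OF Y.F_cont] continuous_on_Pair continuous_intros;
        force simp: Q_def image_subset_iff)+
qed

lemma push_slope_cont:
  "continuous_on (Q \<times> {0..1}) (\<lambda>((x, y, s), t). push_slope x y s t)" (is "continuous_on _ ?f")
proof (rule continuous_on_cylinder)
  let ?A = "\<lambda>z. a (F (fst (fst z), push_time (snd (snd (fst z))) (snd z)))"
  let ?B = "\<lambda>z. b (E (fst (snd (fst z)), push_time (1 - snd (snd (fst z))) (snd z)))"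
  have Ac: "continuous_on (Q \<times> {0<..1}) ?A"
    by (rule continuous_on_compose2[OF X.a_cont pushed_cont(1)]) (use pushed_in(1) in \<open>auto simp: image_subset_iff\<close>)
  have Bc: "continuous_on (Q \<times> {0<..1}) ?B"
    by (rule continuous_on_compose2[OF Y.a_cont pushed_cont(2)]) (use pushed_in(2) in \<open>auto simp: image_subset_iff\<close>)
  have AB: "?A z + ?B z \<noteq> 0" if "z \<in> Q \<times> {0<..1}" for z
  proof -
    obtain x y s t where z: "z = ((x, y, s), t)" by (metis surj_pair)
    show ?thesis using pushed_pos[of x y s t] that by (simp add: z)
  qed
  have "continuous_on (Q \<times> {0<..1}) (\<lambda>z. ?A z / (?A z + ?B z))"
    using AB by (intro continuous_on_divide continuous_on_add Ac Bc) blast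
  then show "continuous_on (Q \<times> {0<..1}) ?f"
    by (rule continuous_on_eq) (auto simp: push_slope_eq)
next
  fix q assume q: "q \<in> Q"
  obtain x0 y0 s0 where q0: "q = (x0, y0, s0)" by (cases q)
  have f0: "?f (q, 0) = s0" using q by (simp add: q0 push_slope_0)
  let ?L = "at (q, 0) within Q \<times> {0..1::real}"
  have "((\<lambda>z. ?f z - snd (snd (fst z))) \<longlongrightarrow> 0) ?L"
  proof (rule tendstoI)
    fix e :: real assume e: "0 < e"
    obtain d where d: "0 < d" "\<And>x y s t. (x, y, s) \<in> Q \<Longrightarrow> 0 < t \<Longrightarrow> t < d \<Longrightarrow> \<bar>push_slope x y s t - s\<bar> < e"
      by (rule push_slope_uniform[OF e]) (rule that)
    have "(snd \<longlongrightarrow> 0) ?L" using tendsto_snd[OF tendsto_ident_at, of "(q, 0)" "Q \<times> {0..1}"] by simp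
    then have "\<forall>\<^sub>F z in ?L. snd z < d" using d(1) by (rule order_tendstoD(2))
    moreover have "\<forall>\<^sub>F z in ?L. z \<in> Q \<times> {0..1}" by (simp add: eventually_at_filter)
    ultimately show "\<forall>\<^sub>F z in ?L. dist (?f z - snd (snd (fst z))) 0 < e"
    proof eventually_elim
      case (elim z)
      obtain x y s t where z: "z = ((x, y, s), t)" by (metis surj_pair)
      show ?case
      proof (cases "t = 0")
        case True then show ?thesis using elim e by (simp add: z push_slope_0)
      next
        case False then show ?thesis using elim d(2)[of x y s t] by (simp add: z)
      qed
    qed
  qed
  moreover have "((\<lambda>z. snd (snd (fst z))) \<longlongrightarrow> s0) ?L"
    using tendsto_snd[OF tendsto_snd[OF tendsto_fst[OF tendsto_ident_at]], of "(q, 0)" "Q \<times> {0..1}"] by (simp add: q0)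
  ultimately have "((\<lambda>z. ?f z - snd (snd (fst z)) + snd (snd (fst z))) \<longlongrightarrow> 0 + s0) ?L"
    by (rule tendsto_add)
  then show "(?f \<longlongrightarrow> ?f (q, 0)) ?L" unfolding f0 by simp
qed

text \<open>
  At time \<open>0\<close> there are two cases. For \<open>s\<close> away from \<open>1\<close> the push time tends to \<open>0\<close>, so the pushed
  coordinate tends to the original one; for \<open>s\<close> near \<open>1\<close> the coordinate may jump, but it is
  multiplied by a factor that tends to \<open>0\<close>.
\<close>
lemma push_left_cont:
  "continuous_on (Q \<times> {0..1}) (\<lambda>((x, y, s), t). (1 - push_slope x y s t) * F (x, push_time s t) i)" (is "continuous_on _ ?f")
proof (rule continuous_on_cylinder)
  have Fc: "continuous_on (Q \<times> {0<..1}) (\<lambda>z. F (fst (fst z), push_time (snd (snd (fst z))) (snd z)) i)"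
    by (rule continuous_on_product_then_coordinatewise[OF pushed_cont(1)])
  have "continuous_on (Q \<times> {0<..1}) (\<lambda>((x, y, s), t). push_slope x y s t)"
    by (rule continuous_on_subset[OF push_slope_cont]) auto
  then have "continuous_on (Q \<times> {0<..1}) (\<lambda>z. (1 - (\<lambda>((x, y, s), t). push_slope x y s t) z) * F (fst (fst z), push_time (snd (snd (fst z))) (snd z)) i)"
    using Fc by (intro continuous_intros)
  then show "continuous_on (Q \<times> {0<..1}) ?f" by (rule continuous_on_eq) auto
next
  fix q assume q: "q \<in> Q"
  obtain x0 y0 s0 where q0: "q = (x0, y0, s0)" by (cases q)
  let ?L = "at (q, 0) within Q \<times> {0..1::real}"
  let ?\<sigma> = "\<lambda>((x, y, s), t). push_slope x y s t"
  let ?F = "\<lambda>z. F (fst (fst z), push_time (snd (snd (fst z))) (snd z))"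
  have feq: "?f = (\<lambda>z. (1 - ?\<sigma> z) * ?F z i)" by auto
  have x0: "x0 \<in> S" "s0 \<in> {0..1}" using q by (auto simp: q0 Q_def)
  have f0: "?f (q, 0) = (1 - s0) * x0 i" using q by (simp add: q0 push_slope_0 push_time_def X.F_0 x0)
  have inA: "\<forall>\<^sub>F z in ?L. z \<in> Q \<times> {0..1}" by (simp add: eventually_at_filter)
  have "(?\<sigma> \<longlongrightarrow> ?\<sigma> (q, 0)) ?L"
    using push_slope_cont q unfolding continuous_on_def by (elim ballE[of _ _ "(q, 0)"]) auto
  then have sig: "(?\<sigma> \<longlongrightarrow> s0) ?L" using q by (simp add: q0 push_slope_0)
  have sl: "((\<lambda>z. snd (snd (fst z))) \<longlongrightarrow> s0) ?L"
    using tendsto_snd[OF tendsto_snd[OF tendsto_fst[OF tendsto_ident_at]], of "(q, 0)" "Q \<times> {0..1}"] by (simp add: q0)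
  have xl: "((\<lambda>z. fst (fst z)) \<longlongrightarrow> x0) ?L"
    using tendsto_fst[OF tendsto_fst[OF tendsto_ident_at], of "(q, 0)" "Q \<times> {0..1}"] by (simp add: q0)
  have tl: "(snd \<longlongrightarrow> 0) ?L" using tendsto_snd[OF tendsto_ident_at, of "(q, 0)" "Q \<times> {0..1}"] by simp
  have Fin: "\<forall>\<^sub>F z in ?L. ?F z \<in> S"
    using inA by (rule eventually_mono) (use pushed_in(1) in auto)
  show "(?f \<longlongrightarrow> ?f (q, 0)) ?L"
  proof (cases "s0 = 1")
    case True
    have "compact ((\<lambda>x. x i) ` S)"
      by (intro compact_continuous_image X.S_compact continuous_on_product_then_coordinatewise[OF continuous_on_id])
    then have "bounded ((\<lambda>x. x i) ` S)" by (rule compact_imp_bounded)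
    then obtain C where Cb: "\<forall>v\<in>(\<lambda>x. x i) ` S. norm v \<le> C"
      unfolding bounded_iff by (rule exE)
    have C: "\<bar>x i\<bar> \<le> C" if "x \<in> S" for x
      using bspec[OF Cb imageI[OF that]] by simp
    have "((\<lambda>z. (1 - ?\<sigma> z) * ?F z i) \<longlongrightarrow> 0) ?L"
    proof (rule Lim_null_comparison)
      show "\<forall>\<^sub>F z in ?L. norm ((1 - ?\<sigma> z) * ?F z i) \<le> \<bar>1 - ?\<sigma> z\<bar> * C"
        using Fin by (rule eventually_mono) (auto simp: abs_mult intro!: mult_left_mono C)
      have "((\<lambda>z. \<bar>1 - ?\<sigma> z\<bar> * C) \<longlongrightarrow> \<bar>1 - s0\<bar> * C) ?L" using sig by (intro tendsto_intros)
      then show "((\<lambda>z. \<bar>1 - ?\<sigma> z\<bar> * C) \<longlongrightarrow> 0) ?L" using True by simp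
    qed
    then show ?thesis unfolding f0 unfolding feq using True by simp
  next
    case False
    define h where "h = (1 - s0) / 2"
    have h: "0 < h" "s0 < 1 - h" using False x0(2) by (auto simp: h_def field_simps)
    have "((\<lambda>z. push_time (snd (snd (fst z))) (snd z)) \<longlongrightarrow> 0) ?L"
    proof (rule Lim_null_comparison)
      show "(snd \<longlongrightarrow> 0) ?L" by (rule tl)
      show "\<forall>\<^sub>F z in ?L. norm (push_time (snd (snd (fst z))) (snd z)) \<le> snd z"
        using inA order_tendstoD(2)[OF tl h(1)] order_tendstoD(2)[OF sl h(2)]
      proof eventually_elim
        case (elim z)
        obtain x y s t where z: "z = ((x, y, s), t)" by (metis surj_pair)
        have st: "s \<in> {0..1}" "t \<in> {0..1}" "s \<le> 1 - t" using elim by (auto simp: z Q_def)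
        show ?case
        proof (cases "t = 0")
          case True then show ?thesis by (simp add: z push_time_def)
        next
          case False
          then have "push_time s t = t * max s t" using push_time_eq[OF st(1) _ st(3)] st by simp
          moreover have "t * max s t \<le> t" "0 \<le> t * max s t" using st by (auto intro!: mult_left_le mult_nonneg_nonneg)
          ultimately show ?thesis by (simp add: z)
        qed
      qed
    qed
    from tendsto_Pair[OF xl this]
    have pr: "((\<lambda>z. (fst (fst z), push_time (snd (snd (fst z))) (snd z))) \<longlongrightarrow> (x0, 0)) ?L" .
    have ev: "\<forall>\<^sub>F z in ?L. (fst (fst z), push_time (snd (snd (fst z))) (snd z)) \<in> S \<times> {0..1}"
      using inA
    proof (rule eventually_mono)
      fix z assume "z \<in> Q \<times> {0..1::real}"
      then show "(fst (fst z), push_time (snd (snd (fst z))) (snd z)) \<in> S \<times> {0..1}"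
        using push_time_bounds(1)[of "snd (snd (fst z))" "snd z"] by (auto simp: Q_def)
    qed
    have "(?F \<longlongrightarrow> F (x0, 0)) ?L"
      by (rule continuous_on_tendsto_compose[OF X.F_cont pr _ ev]) (use x0 in auto)
    then have "(?F \<longlongrightarrow> x0) ?L" by (simp add: X.F_0 x0)
    then have "((\<lambda>z. ?F z i) \<longlongrightarrow> x0 i) ?L"
      using continuous_on_tendsto_compose[OF continuous_on_product_then_coordinatewise[OF continuous_on_id], of ?F x0 ?L UNIV i] by simp
    then have "((\<lambda>z. (1 - ?\<sigma> z) * ?F z i) \<longlongrightarrow> (1 - s0) * x0 i) ?L"
      using sig by (intro tendsto_intros)
    then show ?thesis unfolding f0 unfolding feq .
  qed
qed

lemma push_right_cont:
  "continuous_on (Q \<times> {0..1}) (\<lambda>((x, y, s), t). push_slope x y s t * E (y, push_time (1 - s) t) i)"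
proof -
  interpret swap: product_EZ H n T b E act' G m S a F act by (rule product_swap)
  let ?w = "\<lambda>z :: (rseq \<times> rseq \<times> real) \<times> real.
    ((fst (snd (fst z)), fst (fst z), 1 - snd (snd (fst z))), snd z)"
  have "continuous_on (Q \<times> {0..1}) ?w" by (intro continuous_intros)
  moreover have "?w ` (Q \<times> {0..1}) \<subseteq> swap.Q \<times> {0..1}" using Q_swap by auto
  ultimately have "continuous_on (Q \<times> {0..1})
      (\<lambda>z. (\<lambda>((x, y, s), t). (1 - swap.push_slope x y s t) * E (x, push_time s t) i) (?w z))"
    by (rule continuous_on_compose2[OF swap.push_left_cont])
  then show ?thesis
    by (rule continuous_on_eq) (auto simp: push_slope_swap)
qed

end

section \<open>The compactified product and its group action\<close>

lemma absolute_extensorE: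
  fixes f :: "rseq \<times> real \<Rightarrow> 'a::topological_space"
  assumes "absolute_extensor B" "closedin (top_of_set N) A" "continuous_on A f" "f ` A \<subseteq> B"
  obtains g where "continuous_on N g" "g ` N \<subseteq> B" "\<And>z. z \<in> A \<Longrightarrow> g z = f z"
proof -
  have "\<exists>g. continuous_on N g \<and> g ` N \<subseteq> B \<and> (\<forall>z\<in>A. g z = f z)"
    using assms(1) unfolding absolute_extensor_def by (elim allE impE) (use assms in blast)+
  then show ?thesis using that by blast
qed

lemma (in controlled_EZ) finite_recurrent:
  assumes e: "0 < e"
  shows "finite {g \<in> carrier G. \<exists>x\<in>S. e \<le> a x \<and> e \<le> a (act g x)}"
proof -
  have "closedin (top_of_set S) {x \<in> S. a x \<in> {e..}}"
    using continuous_closedin_preimage[OF a_cont closed_atLeast[of e]] by (simp add: vimage_def Int_def)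
  then have "compact {x \<in> S. e \<le> a x}" using S_compact by (simp add: closedin_compact)
  moreover have "{x \<in> S. e \<le> a x} \<subseteq> {x \<in> S. 0 < a x}" using e by auto
  ultimately obtain \<Gamma> where \<Gamma>: "finite \<Gamma>" "\<forall>g\<in>carrier G - \<Gamma>. \<forall>x\<in>{x \<in> S. e \<le> a x}. a (act g x) < e \<and>
      (\<forall>y\<in>{x \<in> S. e \<le> a x}. dist (act g x) (act g y) < e)"
    using null e by meson
  have "{g \<in> carrier G. \<exists>x\<in>S. e \<le> a x \<and> e \<le> a (act g x)} \<subseteq> \<Gamma>"
  proof (rule subsetI, rule ccontr)
    fix g assume g: "g \<in> {g \<in> carrier G. \<exists>x\<in>S. e \<le> a x \<and> e \<le> a (act g x)}" "g \<notin> \<Gamma>"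
    then obtain x where x: "x \<in> S" "e \<le> a x" "e \<le> a (act g x)" by blast
    then have "a (act g x) < e" using \<Gamma>(2) g by blast
    then show False using x by simp
  qed
  then show ?thesis using \<Gamma>(1) by (rule finite_subset)
qed

context product_EZ
begin

text \<open>
  \<open>P\<close> is the compactification and \<open>D\<close> the copy of the product of the two interiors in it.
\<close>
definition P :: "rseq set" where "P = join_point ` Q"

definition D :: "rseq set" where
  "D = join_point ` {(x, y, s). (x, y, s) \<in> Q \<and> 0 < a x \<and> 0 < b y}"

definition rep :: "rseq \<Rightarrow> rseq \<times> rseq \<times> real" where
  "rep = inv_into Q join_point"

definition push :: "rseq \<times> real \<Rightarrow> rseq" where
  "push z = (case rep (fst z) of (x, y, s) \<Rightarrow>
     joined (F (x, push_time s (snd z))) (E (y, push_time (1 - s) (snd z))) s)"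

definition pair_act :: "'g \<times> 'h \<Rightarrow> rseq \<Rightarrow> rseq" where
  "pair_act \<gamma> p = (case rep p of (x, y, s) \<Rightarrow> joined (act (fst \<gamma>) x) (act' (snd \<gamma>) y) s)"

lemma rep_cases:
  assumes "(x, y, s) \<in> Q"
  obtains x' y' where "rep (join_point (x, y, s)) = (x', y', s)" "(x', y', s) \<in> Q" "s = 1 \<or> x = x'" "s = 0 \<or> y = y'"
proof -
  obtain x' y' s' where r: "rep (join_point (x, y, s)) = (x', y', s')" by (metis surj_pair)
  have im: "join_point (x, y, s) \<in> join_point ` Q" using assms by blast
  have "(x', y', s') \<in> Q" using inv_into_into[OF im] r by (simp add: rep_def)
  moreover have "join_point (x', y', s') = join_point (x, y, s)"
    using f_inv_into_f[OF im] r by (simp add: rep_def)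
  ultimately show ?thesis using that r by (auto simp: join_point_eq_iff)
qed

lemma P_cases: assumes "p \<in> P" obtains x y s where "(x, y, s) \<in> Q" "p = join_point (x, y, s)"
  using assms unfolding P_def by fastforce

lemma D_cases:
  assumes "p \<in> D" obtains x y s where "(x, y, s) \<in> Q" "0 < a x" "0 < b y" "0 < s" "s < 1" "p = join_point (x, y, s)"
proof -
  obtain x y s where q: "(x, y, s) \<in> Q" "0 < a x" "0 < b y" "p = join_point (x, y, s)"
    using assms unfolding D_def by fastforce
  then have "s \<noteq> 0" "s \<noteq> 1" using Q_ends by fastforce+
  then show ?thesis using that q Q_D(3)[OF q(1)] by auto
qed

lemma D_iff: assumes q: "(x, y, s) \<in> Q" shows "join_point (x, y, s) \<in> D \<longleftrightarrow> 0 < a x \<and> 0 < b y"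
proof
  assume "join_point (x, y, s) \<in> D"
  then obtain x' y' s' where "0 < a x'" "0 < b y'" "0 < s'" "s' < 1" "join_point (x, y, s) = join_point (x', y', s')"
    by (rule D_cases)
  then show "0 < a x \<and> 0 < b y" by (auto simp: join_point_eq_iff)
next
  assume "0 < a x \<and> 0 < b y" then show "join_point (x, y, s) \<in> D" using q unfolding D_def by blast
qed

lemma D_subset: "D \<subseteq> P" unfolding D_def P_def by blast

lemma joined_in_P: "x \<in> S \<Longrightarrow> y \<in> T \<Longrightarrow> s \<in> {0..1} \<Longrightarrow> joined x y s \<in> P"
  unfolding joined_def P_def using slope_in_Q by blast

lemma joined_in_D_iff:
  "x \<in> S \<Longrightarrow> y \<in> T \<Longrightarrow> s \<in> {0..1} \<Longrightarrow> joined x y s \<in> D \<longleftrightarrow> 0 < a x \<and> 0 < b y"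
  unfolding joined_def by (rule D_iff[OF slope_in_Q])

lemma joined_on_Q: "(x, y, s) \<in> Q \<Longrightarrow> joined x y s = join_point (x, y, s)"
  by (simp add: joined_def slope_on_Q)

lemma Q_compact: "compact Q"
proof -
  let ?A = "S \<times> T \<times> {0..1::real}"
  have A: "compact ?A" by (intro compact_Times X.S_compact Y.S_compact compact_Icc)
  have "continuous_on ?A (\<lambda>z. (1 - snd (snd z)) * a (fst z) - snd (snd z) * b (fst (snd z)))"
    by (intro continuous_intros continuous_on_compose2[OF X.a_cont] continuous_on_compose2[OF Y.a_cont]) auto
  from continuous_closedin_preimage[OF this closed_singleton[of 0]]
  have "closedin (top_of_set ?A) {z \<in> ?A. (1 - snd (snd z)) * a (fst z) - snd (snd z) * b (fst (snd z)) = 0}"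
    by (simp add: vimage_def Int_def)
  then have "compact {z \<in> ?A. (1 - snd (snd z)) * a (fst z) - snd (snd z) * b (fst (snd z)) = 0}"
    using A by (simp add: closedin_compact)
  moreover have "{z \<in> ?A. (1 - snd (snd z)) * a (fst z) - snd (snd z) * b (fst (snd z)) = 0} = Q"
    by (auto simp: Q_def)
  ultimately show ?thesis by simp
qed

lemma join_point_cont: "continuous_on A join_point"
proof -
  have "continuous_on A (\<lambda>z. join_point (fst z, fst (snd z), snd (snd z)))"
    by (intro continuous_on_join_point continuous_on_mult continuous_on_diff continuous_on_const continuous_on_snd continuous_on_id
        continuous_on_product_then_coordinatewise[where f = fst] continuous_on_product_then_coordinatewise[where f = "\<lambda>z. fst (snd z)"] continuous_on_fst)
  then show ?thesis by simp
qed

lemma P_compact: "compact P"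
  unfolding P_def by (rule compact_continuous_image[OF join_point_cont Q_compact])

lemma P_sub: "P \<subseteq> (euclid (2 * max m n + 2))"
proof (clarify elim!: P_cases)
  fix x y s and i :: nat assume q: "(x, y, s) \<in> Q" and i: "2 * max m n + 2 \<le> i"
  have "m \<le> i div 2" "n \<le> i div 2 - 1" "i \<noteq> 0" using i by auto
  moreover have "x j = 0" if "m \<le> j" for j using that X.S_sub Q_D(1)[OF q] by blast
  moreover have "y j = 0" if "n \<le> j" for j using that Y.S_sub Q_D(2)[OF q] by blast
  ultimately show "join_point (x, y, s) i = 0" by (simp add: join_point_def)
qed

lemma frontier_closed: "closed (P - D)"
proof -
  have "P - D = join_point ` (Q \<inter> {z \<in> Q. a (fst z) * b (fst (snd z)) = 0})"
  proof (intro equalityI subsetI)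
    fix p assume p: "p \<in> P - D"
    then obtain x y s where q: "(x, y, s) \<in> Q" "p = join_point (x, y, s)" using P_cases by blast
    then have "a x = 0 \<or> b y = 0"
      using p D_iff[OF q(1)] X.a_nonneg[OF Q_D(1)[OF q(1)]] Y.a_nonneg[OF Q_D(2)[OF q(1)]] by auto
    then show "p \<in> join_point ` (Q \<inter> {z \<in> Q. a (fst z) * b (fst (snd z)) = 0})" using q by force
  next
    fix p assume "p \<in> join_point ` (Q \<inter> {z \<in> Q. a (fst z) * b (fst (snd z)) = 0})"
    then obtain x y s where q: "(x, y, s) \<in> Q" "p = join_point (x, y, s)" "a x * b y = 0" by auto
    then have "p \<notin> D" using D_iff[OF q(1)] by auto
    then show "p \<in> P - D" using q unfolding P_def by blast
  qed
  moreover have "continuous_on Q (\<lambda>z. a (fst z) * b (fst (snd z)))"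
    by (intro continuous_intros continuous_on_compose2[OF X.a_cont] continuous_on_compose2[OF Y.a_cont]) (auto simp: Q_def)
  from continuous_closedin_preimage[OF this closed_singleton[of 0]]
  have "closedin (top_of_set Q) {z \<in> Q. a (fst z) * b (fst (snd z)) = 0}"
    by (simp add: vimage_def Int_def)
  then have "compact (Q \<inter> {z \<in> Q. a (fst z) * b (fst (snd z)) = 0})"
    using Q_compact by (simp add: closedin_compact Int_absorb1)
  then have "closed (join_point ` (Q \<inter> {z \<in> Q. a (fst z) * b (fst (snd z)) = 0}))"
    by (intro compact_imp_closed compact_continuous_image join_point_cont)
  ultimately show ?thesis by simp
qed

text \<open>
  Independence of the chosen representative: at an end of the join the representative is free in
  one coordinate only, and that coordinate is contracted to a constant for \<open>t > 0\<close>.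
\<close>
lemma push_eq:
  assumes q: "(x, y, s) \<in> Q" and t: "t \<in> {0..1}"
  shows "push (join_point (x, y, s), t) = joined (F (x, push_time s t)) (E (y, push_time (1 - s) t)) s"
proof -
  obtain x' y' where r: "rep (join_point (x, y, s)) = (x', y', s)" "(x', y', s) \<in> Q" "s = 1 \<or> x = x'" "s = 0 \<or> y = y'"
    using q by (rule rep_cases)
  have "joined (F (x', push_time s t)) (E (y', push_time (1 - s) t)) s = joined (F (x, push_time s t)) (E (y, push_time (1 - s) t)) s"
  proof (cases "t = 0")
    case True
    have "joined x' y' s = joined x y s"
      using joined_on_Q[OF r(2)] joined_on_Q[OF q] r(3,4) by (auto simp: join_point_eq_iff)
    then show ?thesis using True Q_D[OF q] Q_D[OF r(2)] by (simp add: push_time_def X.F_0 Y.F_0)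
  next
    case False
    then have "push_time 1 t = 1" using t by (intro push_time_one) auto
    then have "F (x', push_time s t) = F (x, push_time s t)" "E (y', push_time (1 - s) t) = E (y, push_time (1 - s) t)"
      using r(3,4) X.F_1[OF Q_D(1)[OF r(2)] Q_D(1)[OF q]] Y.F_1[OF Q_D(2)[OF r(2)] Q_D(2)[OF q]] by auto
    then show ?thesis by simp
  qed
  then show ?thesis by (simp add: push_def r(1))
qed

lemma push_cont: "continuous_on (P \<times> {0..1}) push"
proof -
  let ?e = "\<lambda>z :: (rseq \<times> rseq \<times> real) \<times> real. (join_point (fst z), snd z)"
  let ?f = "\<lambda>((x, y, s), t). joined (F (x, push_time s t)) (E (y, push_time (1 - s) t)) s"
  have "continuous_on (?e ` (Q \<times> {0..1})) push"
  proof (rule continuous_on_descend[where f = ?f])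
    show "compact (Q \<times> {0..1::real})" by (intro compact_Times Q_compact compact_Icc)
    show "continuous_on (Q \<times> {0..1}) ?e"
      by (intro continuous_on_Pair continuous_on_snd continuous_on_id continuous_on_compose2[OF join_point_cont[of UNIV] continuous_on_fst]) auto
    have "continuous_on (Q \<times> {0..1}) (\<lambda>z. join_point ((\<lambda>((x, y, s), t). F (x, push_time s t)) z,
        (\<lambda>((x, y, s), t). E (y, push_time (1 - s) t)) z, (\<lambda>((x, y, s), t). push_slope x y s t) z))"
    proof (rule continuous_on_join_point)
      show "continuous_on (Q \<times> {0..1}) (\<lambda>z. (1 - (\<lambda>((x, y, s), t). push_slope x y s t) z) * (\<lambda>((x, y, s), t). F (x, push_time s t)) z i)" for i
        by (rule continuous_on_eq[OF push_left_cont[of i]]) auto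
      show "continuous_on (Q \<times> {0..1}) (\<lambda>z. (\<lambda>((x, y, s), t). push_slope x y s t) z * (\<lambda>((x, y, s), t). E (y, push_time (1 - s) t)) z i)" for i
        by (rule continuous_on_eq[OF push_right_cont[of i]]) auto
    qed (rule push_slope_cont)
    then show "continuous_on (Q \<times> {0..1}) ?f"
      by (rule continuous_on_eq) (auto simp: joined_def push_slope_def)
    show "push (?e z) = ?f z" if "z \<in> Q \<times> {0..1}" for z
      using that push_eq by auto
  qed
  moreover have "?e ` (Q \<times> {0..1}) = P \<times> {0..1}" unfolding P_def by force
  ultimately show ?thesis by simp
qed

lemma push_0: assumes "p \<in> P" shows "push (p, 0) = p"
proof -
  obtain x y s where q: "(x, y, s) \<in> Q" "p = join_point (x, y, s)" using assms P_cases by blast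
  show ?thesis using push_eq[OF q(1), of 0] Q_D[OF q(1)] joined_on_Q[OF q(1)] by (simp add: q(2) push_time_def X.F_0 Y.F_0)
qed

lemma push_in_P: assumes "p \<in> P" "t \<in> {0..1}" shows "push (p, t) \<in> P"
proof -
  obtain x y s where q: "(x, y, s) \<in> Q" "p = join_point (x, y, s)" using assms P_cases by blast
  show ?thesis using push_eq[OF q(1) assms(2)] pushed_in[OF q(1) assms(2)] Q_D[OF q(1)] by (simp add: q(2) joined_in_P)
qed

lemma push_in_D: assumes "p \<in> P" "t \<in> {0<..1}" shows "push (p, t) \<in> D"
proof -
  obtain x y s where q: "(x, y, s) \<in> Q" "p = join_point (x, y, s)" using assms P_cases by blast
  have t: "t \<in> {0..1}" using assms by auto
  show ?thesis using push_eq[OF q(1) t] pushed_in[OF q(1) t] pushed_pos[OF q(1) assms(2)] Q_D(3)[OF q(1)]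
    by (simp add: q(2) joined_in_D_iff del: atLeastAtMost_iff)
qed

lemma P_ne: "P \<noteq> {}"
proof -
  obtain x y where "x \<in> S" "y \<in> T" using X.S_ne Y.S_ne by blast
  then have "joined x y 0 \<in> P" by (intro joined_in_P) auto
  then show ?thesis by blast
qed

text \<open>
  Inverse to the inclusion of the product of the interiors; meaningful where \<open>p 0\<close> is neither
  \<open>1\<close> nor \<open>0\<close>, in particular on \<open>D\<close>.
\<close>
definition fst_part :: "rseq \<Rightarrow> rseq" where "fst_part p i = p (2 * i + 1) / (1 - p 0)"
definition snd_part :: "rseq \<Rightarrow> rseq" where "snd_part p i = p (2 * i + 2) / p 0"

lemma parts_join_point:
  "s \<noteq> 1 \<Longrightarrow> fst_part (join_point (x, y, s)) = x" "s \<noteq> 0 \<Longrightarrow> snd_part (join_point (x, y, s)) = y"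
  by (auto simp: fst_part_def snd_part_def join_point_def)

lemma joined_indep: "a x + b y \<noteq> 0 \<Longrightarrow> joined x y s = joined x y s'"
  by (simp add: joined_def slope_def)

lemma D_parts:
  assumes "p \<in> D"
  shows "fst_part p \<in> S" "snd_part p \<in> T" "0 < a (fst_part p)" "0 < b (snd_part p)" "joined (fst_part p) (snd_part p) s' = p"
proof -
  obtain x y s where q: "(x, y, s) \<in> Q" "0 < a x" "0 < b y" "0 < s" "s < 1" "p = join_point (x, y, s)"
    using assms by (rule D_cases)
  have "fst_part p = x" "snd_part p = y" using q parts_join_point[of s x y] by simp_all
  then show "fst_part p \<in> S" "snd_part p \<in> T" "0 < a (fst_part p)" "0 < b (snd_part p)" "joined (fst_part p) (snd_part p) s' = p"
    using q Q_D[OF q(1)] joined_indep[of x y s' s] joined_on_Q[OF q(1)] by auto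
qed

lemma parts_cont: "continuous_on D fst_part" "continuous_on D snd_part"
proof -
  have "p 0 \<noteq> 0 \<and> 1 - p 0 \<noteq> 0" if "p \<in> D" for p
    using that by (rule D_cases) (simp add: join_point_coords)
  moreover have "continuous_on D (\<lambda>p. p k)" for k :: nat
    by (rule continuous_on_product_then_coordinatewise[OF continuous_on_id])
  ultimately have "continuous_on D (\<lambda>p. fst_part p i)" "continuous_on D (\<lambda>p. snd_part p i)" for i
    unfolding fst_part_def snd_part_def by (intro continuous_on_divide continuous_on_diff continuous_on_const; blast)+
  then show "continuous_on D fst_part" "continuous_on D snd_part"
    by (auto intro: continuous_on_coordinatewise_then_product)
qed

lemma joined_cont:
  assumes "continuous_on A f" "continuous_on A g"
    and "f ` A \<subseteq> {x \<in> S. 0 < a x}" "g ` A \<subseteq> {y \<in> T. 0 < b y}"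
  shows "continuous_on A (\<lambda>z. joined (f z) (g z) s)"
proof -
  have pos: "0 < a (f z)" "0 < b (g z)" "f z \<in> S" "g z \<in> T" if "z \<in> A" for z using that assms by auto
  have sc: "continuous_on A (\<lambda>z. a (f z) / (a (f z) + b (g z)))"
    using pos by (intro continuous_on_divide continuous_on_add continuous_on_compose2[OF X.a_cont assms(1)]
        continuous_on_compose2[OF Y.a_cont assms(2)]) (auto simp: add_pos_pos less_imp_neq[THEN not_sym])
  have fc: "continuous_on A (\<lambda>z. f z i)" "continuous_on A (\<lambda>z. g z i)" for i
    using assms by (auto intro: continuous_on_product_then_coordinatewise)
  have "continuous_on A (\<lambda>z. join_point (f z, g z, a (f z) / (a (f z) + b (g z))))"
    by (intro continuous_on_join_point continuous_on_mult continuous_on_diff continuous_on_const sc fc)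
  then show ?thesis
    by (rule continuous_on_eq) (use pos in \<open>fastforce simp: joined_def slope_def\<close>)
qed

text \<open>
  \<open>D\<close> is homeomorphic to the product of the interiors, and maps into a product extend
  componentwise.
\<close>
lemma D_extensor: "absolute_extensor D"
  unfolding absolute_extensor_def
proof (intro allI impI, elim conjE)
  fix N :: "(rseq \<times> real) set" and A f
  assume A: "closedin (top_of_set N) A" and f: "continuous_on A f" "f ` A \<subseteq> D"
  have parts: "(\<lambda>z. fst_part (f z)) ` A \<subseteq> {x \<in> S. 0 < a x}" "(\<lambda>z. snd_part (f z)) ` A \<subseteq> {y \<in> T. 0 < b y}"
    using f(2) D_parts by blast+
  obtain g where g: "continuous_on N g" "g ` N \<subseteq> {x \<in> S. 0 < a x}" "\<And>z. z \<in> A \<Longrightarrow> g z = fst_part (f z)"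
    by (rule absolute_extensorE[OF X.extensor A continuous_on_compose2[OF parts_cont(1) f] parts(1)]) (rule that)
  obtain h where h: "continuous_on N h" "h ` N \<subseteq> {y \<in> T. 0 < b y}" "\<And>z. z \<in> A \<Longrightarrow> h z = snd_part (f z)"
    by (rule absolute_extensorE[OF Y.extensor A continuous_on_compose2[OF parts_cont(2) f] parts(2)]) (rule that)
  show "\<exists>g. continuous_on N g \<and> g ` N \<subseteq> D \<and> (\<forall>z\<in>A. g z = f z)"
  proof (intro exI[of _ "\<lambda>z. joined (g z) (h z) 0"] conjI ballI)
    show "continuous_on N (\<lambda>z. joined (g z) (h z) 0)" by (rule joined_cont[OF g(1) h(1) g(2) h(2)])
    show "(\<lambda>z. joined (g z) (h z) 0) ` N \<subseteq> D"
    proof (rule image_subsetI)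
      fix z assume "z \<in> N"
      then have "g z \<in> {x \<in> S. 0 < a x}" "h z \<in> {y \<in> T. 0 < b y}" using g(2) h(2) by blast+
      then show "joined (g z) (h z) 0 \<in> D" using joined_in_D_iff[of "g z" "h z" 0] by simp
    qed
    fix z assume "z \<in> A"
    then show "joined (g z) (h z) 0 = f z" using g(3) h(3) f(2) D_parts(5) by auto
  qed
qed

lemma pair_act_eq:
  assumes q: "(x, y, s) \<in> Q" and g: "fst \<gamma> \<in> carrier G" "snd \<gamma> \<in> carrier H"
  shows "pair_act \<gamma> (join_point (x, y, s)) = joined (act (fst \<gamma>) x) (act' (snd \<gamma>) y) s"
proof -
  obtain x' y' where r: "rep (join_point (x, y, s)) = (x', y', s)" "(x', y', s) \<in> Q" "s = 1 \<or> x = x'" "s = 0 \<or> y = y'"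
    using q by (rule rep_cases)
  have "joined (act (fst \<gamma>) x') (act' (snd \<gamma>) y') s = joined (act (fst \<gamma>) x) (act' (snd \<gamma>) y) s"
  proof -
    consider "s = 0" | "s = 1" | "x = x'" "y = y'" using r by blast
    then show ?thesis
    proof cases
      case 1
      then have "x' = x" "a x = 0" using r q Q_ends by auto
      then show ?thesis using X.act_zero[OF g(1) Q_D(1)[OF q]] 1 by (simp add: joined_def slope_ends join_point_eq_iff)
    next
      case 2
      then have "y' = y" "b y = 0" using r q Q_ends by auto
      then show ?thesis using Y.act_zero[OF g(2) Q_D(2)[OF q]] 2 by (simp add: joined_def slope_ends join_point_eq_iff)
    qed simp
  qed
  then show ?thesis by (simp add: pair_act_def r(1))
qed

text \<open>
  The action on \<open>Q\<close> itself is continuous, because the slope of the translated pair differs from \<open>s\<close> by a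
  multiple of the sum of the gauges. Continuity then descends to the quotient \<open>P\<close>.
\<close>
lemma pair_act_cont:
  assumes g: "fst \<gamma> \<in> carrier G" "snd \<gamma> \<in> carrier H"
  shows "continuous_on P (pair_act \<gamma>)"
  unfolding P_def
proof (rule continuous_on_descend[OF Q_compact join_point_cont, where f = "\<lambda>(x, y, s). joined (act (fst \<gamma>) x) (act' (snd \<gamma>) y) s"])
  let ?gx = "\<lambda>z. act (fst \<gamma>) (fst z)" and ?hy = "\<lambda>z. act' (snd \<gamma>) (fst (snd z))"
  obtain C where C: "0 \<le> C" "\<And>x. x \<in> S \<Longrightarrow> \<bar>a (act (fst \<gamma>) x) - a x\<bar> \<le> C * a (act (fst \<gamma>) x) * a x"
    by (rule X.act_distortion[OF g(1)]) (rule that)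
  obtain C' where C': "0 \<le> C'" "\<And>y. y \<in> T \<Longrightarrow> \<bar>b (act' (snd \<gamma>) y) - b y\<bar> \<le> C' * b (act' (snd \<gamma>) y) * b y"
    by (rule Y.act_distortion[OF g(2)]) (rule that)
  define K where "K = max C C'"
  have gc: "continuous_on Q (\<lambda>z :: rseq \<times> rseq \<times> real. ?gx z)"
    by (intro continuous_on_compose2[OF X.act_cont[OF g(1)]] continuous_intros) (auto simp: Q_def)
  have hc: "continuous_on Q (\<lambda>z :: rseq \<times> rseq \<times> real. ?hy z)"
    by (intro continuous_on_compose2[OF Y.act_cont[OF g(2)]] continuous_intros) (auto simp: Q_def)
  have ac: "continuous_on Q (\<lambda>z :: rseq \<times> rseq \<times> real. a (?gx z))"
    by (rule continuous_on_compose2[OF X.a_cont gc]) (auto simp: Q_def X.act_in g)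
  have bc: "continuous_on Q (\<lambda>z :: rseq \<times> rseq \<times> real. b (?hy z))"
    by (rule continuous_on_compose2[OF Y.a_cont hc]) (auto simp: Q_def Y.act_in g)
  have sc: "continuous_on Q (\<lambda>z. if a (?gx z) + b (?hy z) = 0 then snd (snd z) else a (?gx z) / (a (?gx z) + b (?hy z)))"
  proof (rule continuous_on_quotient_or)
    show "continuous_on Q (\<lambda>z :: rseq \<times> rseq \<times> real. K * (a (fst z) + b (fst (snd z))))"
      by (intro continuous_intros continuous_on_compose2[OF X.a_cont] continuous_on_compose2[OF Y.a_cont]) (auto simp: Q_def)
    fix z :: "rseq \<times> rseq \<times> real" assume z: "z \<in> Q"
    obtain x y s where zq: "z = (x, y, s)" by (cases z)
    have q: "(x, y, s) \<in> Q" using z zq by simp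
    note xy = Q_D[OF q]
    have n: "0 \<le> a x" "0 \<le> b y" "0 \<le> a (act (fst \<gamma>) x)" "0 \<le> b (act' (snd \<gamma>) y)"
      using xy X.a_nonneg Y.a_nonneg X.act_in Y.act_in g by auto
    show "0 \<le> K * (a (fst z) + b (fst (snd z)))" using n C(1) by (simp add: zq K_def)
    show "K * (a (fst z) + b (fst (snd z))) = 0" if "a (?gx z) + b (?hy z) = 0"
    proof -
      have "a (act (fst \<gamma>) x) = 0" "b (act' (snd \<gamma>) y) = 0" using that n by (auto simp: zq)
      then show ?thesis using X.act_zero[OF g(1) xy(1)] Y.act_zero[OF g(2) xy(2)] by (simp add: zq)
    qed
    show "\<bar>a (?gx z) / (a (?gx z) + b (?hy z)) - snd (snd z)\<bar> \<le> K * (a (fst z) + b (fst (snd z)))"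
      if "a (?gx z) + b (?hy z) \<noteq> 0"
      unfolding zq fst_conv snd_conv
    proof (rule slope_estimate)
      have w: "s * (a x + b y) = a x" "(1 - s) * (a x + b y) = b y" using Q_weights[OF q] by simp_all
      have "C * (a (act (fst \<gamma>) x) * a x) \<le> K * (a (act (fst \<gamma>) x) * a x)"
        using n by (intro mult_right_mono) (auto simp: K_def)
      then show "\<bar>a (act (fst \<gamma>) x) - s * (a x + b y)\<bar> \<le> K * a (act (fst \<gamma>) x) * (s * (a x + b y))"
        using C(2)[OF xy(1)] unfolding w by (simp add: mult.assoc)
      have "C' * (b (act' (snd \<gamma>) y) * b y) \<le> K * (b (act' (snd \<gamma>) y) * b y)"
        using n by (intro mult_right_mono) (auto simp: K_def)
      then show "\<bar>b (act' (snd \<gamma>) y) - (1 - s) * (a x + b y)\<bar> \<le> K * b (act' (snd \<gamma>) y) * ((1 - s) * (a x + b y))"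
        using C'(2)[OF xy(2)] unfolding w by (simp add: mult.assoc)
    qed (use n that xy C(1) in \<open>auto simp: zq K_def\<close>)
  qed (intro ac bc continuous_intros)+
  have "continuous_on Q (\<lambda>z. join_point (?gx z, ?hy z,
      if a (?gx z) + b (?hy z) = 0 then snd (snd z) else a (?gx z) / (a (?gx z) + b (?hy z))))"
    by (intro continuous_on_join_point continuous_on_mult continuous_on_diff continuous_on_const sc
        continuous_on_product_then_coordinatewise[OF gc] continuous_on_product_then_coordinatewise[OF hc])
  then show "continuous_on Q (\<lambda>(x, y, s). joined (act (fst \<gamma>) x) (act' (snd \<gamma>) y) s)"
    by (rule continuous_on_eq) (auto simp: joined_def slope_def)
  show "pair_act \<gamma> (join_point q) = (case q of (x, y, s) \<Rightarrow> joined (act (fst \<gamma>) x) (act' (snd \<gamma>) y) s)" if "q \<in> Q" for q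
    using that g by (auto simp: pair_act_eq split: prod.split)
qed

lemma pair_act_in_P:
  assumes "fst \<gamma> \<in> carrier G" "snd \<gamma> \<in> carrier H" "p \<in> P" shows "pair_act \<gamma> p \<in> P"
proof -
  obtain x y s where q: "(x, y, s) \<in> Q" "p = join_point (x, y, s)" using assms P_cases by blast
  show ?thesis unfolding q(2) pair_act_eq[OF q(1) assms(1,2)]
    using Q_D[OF q(1)] assms by (intro joined_in_P X.act_in Y.act_in)
qed

lemma pair_act_in_D_iff:
  assumes g: "fst \<gamma> \<in> carrier G" "snd \<gamma> \<in> carrier H" and p: "p \<in> P" shows "pair_act \<gamma> p \<in> D \<longleftrightarrow> p \<in> D"
proof -
  obtain x y s where q: "(x, y, s) \<in> Q" "p = join_point (x, y, s)" using p P_cases by blast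
  note xy = Q_D[OF q(1)]
  show ?thesis
    unfolding q(2) pair_act_eq[OF q(1) g] D_iff[OF q(1)]
      joined_in_D_iff[OF X.act_in[OF g(1) xy(1)] Y.act_in[OF g(2) xy(2)] xy(3)]
    using X.act_pos[OF g(1) xy(1)] Y.act_pos[OF g(2) xy(2)] by simp
qed

lemma pair_act_one: assumes "p \<in> P" shows "pair_act (\<one>\<^bsub>G\<^esub>, \<one>\<^bsub>H\<^esub>) p = p"
proof -
  obtain x y s where q: "(x, y, s) \<in> Q" "p = join_point (x, y, s)" using assms P_cases by blast
  have "\<one>\<^bsub>G\<^esub> \<in> carrier G" "\<one>\<^bsub>H\<^esub> \<in> carrier H" using X.grp Y.grp by (auto intro: group.is_monoid monoid.one_closed)
  then show ?thesis using pair_act_eq[OF q(1), of "(\<one>\<^bsub>G\<^esub>, \<one>\<^bsub>H\<^esub>)"] Q_D[OF q(1)] joined_on_Q[OF q(1)]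
    by (simp add: q(2) X.act_one Y.act_one)
qed

text \<open>
  Over a pair of boundary points the slope is carried along unchanged; elsewhere it is recomputed
  from the gauges and forgets its previous value.
\<close>
lemma pair_act_mult:
  assumes g: "g \<in> carrier G" "g' \<in> carrier G" and h: "h \<in> carrier H" "h' \<in> carrier H" and p: "p \<in> P"
  shows "pair_act (g \<otimes>\<^bsub>G\<^esub> g', h \<otimes>\<^bsub>H\<^esub> h') p = pair_act (g, h) (pair_act (g', h') p)"
proof -
  obtain x y s where q: "(x, y, s) \<in> Q" "p = join_point (x, y, s)" using p P_cases by blast
  note xy = Q_D[OF q(1)]
  let ?x = "act g' x" and ?y = "act' h' y"
  have x': "?x \<in> S" "?y \<in> T" using g h xy X.act_in Y.act_in by auto
  have q': "(?x, ?y, slope ?x ?y s) \<in> Q" by (rule slope_in_Q[OF x' xy(3)])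
  have "pair_act (g, h) (pair_act (g', h') p) = joined (act g ?x) (act' h ?y) (slope ?x ?y s)"
    using pair_act_eq[OF q(1), of "(g', h')"] pair_act_eq[OF q', of "(g, h)"] g h by (simp add: q(2) joined_def)
  also have "\<dots> = joined (act g ?x) (act' h ?y) s"
  proof (cases "a (act g ?x) + b (act' h ?y) = 0")
    case True
    then have "a (act g ?x) = 0" "b (act' h ?y) = 0"
      using X.a_nonneg[OF X.act_in[OF g(1) x'(1)]] Y.a_nonneg[OF Y.act_in[OF h(1) x'(2)]] by linarith+
    then have "slope ?x ?y s = s" using X.act_zero[OF g(1) x'(1)] Y.act_zero[OF h(1) x'(2)] by (simp add: slope_def)
    then show ?thesis by simp
  qed (rule joined_indep)
  also have "\<dots> = pair_act (g \<otimes>\<^bsub>G\<^esub> g', h \<otimes>\<^bsub>H\<^esub> h') p"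
    using pair_act_eq[OF q(1), of "(g \<otimes>\<^bsub>G\<^esub> g', h \<otimes>\<^bsub>H\<^esub> h')"] g h xy X.grp Y.grp
    by (simp add: q(2) X.act_mult Y.act_mult group.is_monoid monoid.m_closed)
  finally show ?thesis by simp
qed

lemma pair_act_joined:
  assumes "x \<in> S" "y \<in> T" "0 < a x" "0 < b y" "g \<in> carrier G" "h \<in> carrier H"
  shows "pair_act (g, h) (joined x y s) = joined (act g x) (act' h y) s"
proof -
  have "a x + b y \<noteq> 0" "a (act g x) + b (act' h y) \<noteq> 0"
    using assms X.act_pos[OF assms(5,1)] Y.act_pos[OF assms(6,2)] by (auto simp: add_pos_pos less_imp_neq[THEN not_sym])
  then have i: "joined x y s = joined x y 0" "joined (act g x) (act' h y) s = joined (act g x) (act' h y) (slope x y 0)"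
    by (blast intro: joined_indep)+
  have "(x, y, slope x y 0) \<in> Q" using assms by (intro slope_in_Q) auto
  from pair_act_eq[OF this, of "(g, h)"] show ?thesis unfolding i using assms by (simp add: joined_def)
qed

lemma pair_act_proper:
  assumes p: "p \<in> D"
  shows "\<exists>U. openin (top_of_set D) U \<and> p \<in> U \<and> finite {\<gamma> \<in> carrier G \<times> carrier H. pair_act \<gamma> ` U \<inter> U \<noteq> {}}"
proof -
  define e where "e = min (a (fst_part p)) (b (snd_part p)) / 2"
  have e: "0 < e" "e < a (fst_part p)" "e < b (snd_part p)" using D_parts[OF p] by (auto simp: e_def)
  let ?f = "\<lambda>p. min (a (fst_part p)) (b (snd_part p))"
  have "continuous_on D ?f"
    using D_parts by (intro continuous_on_min continuous_on_compose2[OF X.a_cont parts_cont(1)]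
        continuous_on_compose2[OF Y.a_cont parts_cont(2)]) auto
  from continuous_openin_preimage_gen[OF this open_greaterThan[of e]]
  have "openin (top_of_set D) {q \<in> D. e < ?f q}" by (simp add: vimage_def Int_def conj_commute)
  moreover have "p \<in> {q \<in> D. e < ?f q}" using p e by simp
  moreover have "{\<gamma> \<in> carrier G \<times> carrier H. pair_act \<gamma> ` {q \<in> D. e < ?f q} \<inter> {q \<in> D. e < ?f q} \<noteq> {}} \<subseteq>
      {g \<in> carrier G. \<exists>x\<in>S. e \<le> a x \<and> e \<le> a (act g x)} \<times> {h \<in> carrier H. \<exists>y\<in>T. e \<le> b y \<and> e \<le> b (act' h y)}"
  proof (rule subsetI)
    fix \<gamma> assume \<gamma>: "\<gamma> \<in> {\<gamma> \<in> carrier G \<times> carrier H. pair_act \<gamma> ` {q \<in> D. e < ?f q} \<inter> {q \<in> D. e < ?f q} \<noteq> {}}"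
    obtain g h where gh: "\<gamma> = (g, h)" by (cases \<gamma>)
    have c: "g \<in> carrier G" "h \<in> carrier H" using \<gamma> gh by auto
    obtain q where q: "q \<in> D" "e < ?f q" "pair_act (g, h) q \<in> D" "e < ?f (pair_act (g, h) q)" using \<gamma> gh by auto
    let ?x = "fst_part q" and ?y = "snd_part q"
    note d = D_parts[OF q(1)]
    have pq: "pair_act (g, h) q = joined (act g ?x) (act' h ?y) 0"
      using pair_act_joined[OF d(1,2,3,4) c, of 0] d(5)[of 0] by simp
    have "slope (act g ?x) (act' h ?y) 0 \<noteq> 0" "slope (act g ?x) (act' h ?y) 0 \<noteq> 1"
      using X.act_pos[OF c(1) d(1)] Y.act_pos[OF c(2) d(2)] d(3,4) by (auto simp: slope_def)
    then have "fst_part (pair_act (g, h) q) = act g ?x" "snd_part (pair_act (g, h) q) = act' h ?y"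
      unfolding pq joined_def by (simp_all add: parts_join_point)
    then show "\<gamma> \<in> {g \<in> carrier G. \<exists>x\<in>S. e \<le> a x \<and> e \<le> a (act g x)} \<times> {h \<in> carrier H. \<exists>y\<in>T. e \<le> b y \<and> e \<le> b (act' h y)}"
    proof -
      have "\<exists>x\<in>S. e \<le> a x \<and> e \<le> a (act g x)" by (rule bexI[of _ ?x]) (use q d(1) \<open>fst_part (pair_act (g, h) q) = act g ?x\<close> in auto)
      moreover have "\<exists>y\<in>T. e \<le> b y \<and> e \<le> b (act' h y)" by (rule bexI[of _ ?y]) (use q d(2) \<open>snd_part (pair_act (g, h) q) = act' h ?y\<close> in auto)
      ultimately show ?thesis using c gh by blast
    qed
  qed
  then have "finite {\<gamma> \<in> carrier G \<times> carrier H. pair_act \<gamma> ` {q \<in> D. e < ?f q} \<inter> {q \<in> D. e < ?f q} \<noteq> {}}"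
    by (rule finite_subset) (intro finite_cartesian_product X.finite_recurrent Y.finite_recurrent e(1))
  ultimately show ?thesis by blast
qed

lemma pair_act_cocompact:
  "\<exists>K. compact K \<and> K \<subseteq> D \<and> (\<forall>p\<in>D. \<exists>\<gamma>\<in>carrier G \<times> carrier H. \<exists>k\<in>K. p = pair_act \<gamma> k)"
proof -
  obtain K where K: "compact K" "K \<subseteq> {x \<in> S. 0 < a x}" "\<forall>x\<in>S. 0 < a x \<longrightarrow> (\<exists>g\<in>carrier G. \<exists>k\<in>K. x = act g k)"
    using X.cocompact by (elim exE conjE) (rule that)
  obtain L where L: "compact L" "L \<subseteq> {y \<in> T. 0 < b y}" "\<forall>y\<in>T. 0 < b y \<longrightarrow> (\<exists>h\<in>carrier H. \<exists>k\<in>L. y = act' h k)"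
    using Y.cocompact by (elim exE conjE) (rule that)
  let ?J = "(\<lambda>z. joined (fst z) (snd z) 0) ` (K \<times> L)"
  have "compact ?J"
    by (intro compact_continuous_image compact_Times K L joined_cont continuous_intros) (use K L in auto)
  moreover have JD: "?J \<subseteq> D"
  proof (rule image_subsetI)
    fix z assume "z \<in> K \<times> L"
    then have "fst z \<in> {x \<in> S. 0 < a x}" "snd z \<in> {y \<in> T. 0 < b y}" using K(2) L(2) by auto
    then show "joined (fst z) (snd z) 0 \<in> D" using joined_in_D_iff[of "fst z" "snd z" 0] by simp
  qed
  moreover have "\<forall>p\<in>D. \<exists>\<gamma>\<in>carrier G \<times> carrier H. \<exists>k\<in>?J. p = pair_act \<gamma> k"
  proof
    fix p assume "p \<in> D"
    note d = D_parts[OF this]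
    obtain g k where g: "g \<in> carrier G" "k \<in> K" "fst_part p = act g k" using K(3) d(1,3) by blast
    obtain h l where h: "h \<in> carrier H" "l \<in> L" "snd_part p = act' h l" using L(3) d(2,4) by blast
    have "k \<in> S" "0 < a k" "l \<in> T" "0 < b l" using K(2) L(2) g(2) h(2) by auto
    then have eq: "p = pair_act (g, h) (joined k l 0)"
      using pair_act_joined[of k l g h 0] g h d(5)[of 0] by simp
    have inJ: "joined k l 0 \<in> ?J" by (rule image_eqI[of _ _ "(k, l)"]) (use g h in auto)
    have "(g, h) \<in> carrier G \<times> carrier H" using g h by simp
    moreover have "\<exists>k\<in>?J. p = pair_act (g, h) k" using eq inJ by (rule bexI)
    ultimately show "\<exists>\<gamma>\<in>carrier G \<times> carrier H. \<exists>k\<in>?J. p = pair_act \<gamma> k" by (rule rev_bexI)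
  qed
  ultimately show ?thesis by (intro exI[of _ ?J] conjI)
qed

end

section \<open>The null condition for the product\<close>

lemma (in controlled_EZ) finite_translates_bounded_below:
  assumes "finite \<Gamma>" "compact K" "K \<subseteq> {x \<in> S. 0 < a x}"
  obtains w where "0 < w" "w \<le> 1" "\<And>g x. g \<in> \<Gamma> \<Longrightarrow> g \<in> carrier G \<Longrightarrow> x \<in> K \<Longrightarrow> w \<le> a (act g x)"
proof -
  let ?U = "\<Union>g\<in>\<Gamma> \<inter> carrier G. act g ` K"
  have "compact (act g ` K)" if "g \<in> carrier G" for g
    by (rule compact_continuous_image[OF continuous_on_subset[OF act_cont[OF that]] assms(2)]) (use assms(3) in blast)
  then have U: "compact ?U" by (intro compact_UN) (use assms(1) in auto)
  have US: "x \<in> S \<and> 0 < a x" if "x \<in> ?U" for x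
    using that assms(3) act_in act_pos by fastforce
  have "continuous_on ?U a" by (rule continuous_on_subset[OF a_cont]) (use US in blast)
  then obtain d where d: "0 < d" "\<And>x. x \<in> ?U \<Longrightarrow> d \<le> a x"
    by (rule compact_positive_lower_bound[OF U]) (use US in blast)+
  show ?thesis
  proof (rule that[of "min d 1"])
    fix g x assume "g \<in> \<Gamma>" "g \<in> carrier G" "x \<in> K"
    then have "act g x \<in> ?U" by blast
    from d(2)[OF this] show "min d 1 \<le> a (act g x)" by simp
  qed (use d(1) in auto)
qed

lemma dist_triple_le:
  "dist (x, y, s) (x', y', s') \<le> dist x x' + dist y y' + dist s s'"
proof -
  have "dist (x, y, s) (x', y', s') \<le> dist x x' + dist (y, s) (y', s')"
    using sqrt_sum_squares_le_sum_abs[of "dist x x'" "dist (y, s) (y', s')"] by (simp add: dist_Pair_Pair)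
  also have "dist (y, s) (y', s') \<le> dist y y' + dist s s'"
    using sqrt_sum_squares_le_sum_abs[of "dist y y'" "dist s s'"] by (simp add: dist_Pair_Pair)
  finally show ?thesis by simp
qed

context product_EZ
begin

text \<open>
  If both \<open>g\<close> and \<open>h\<close> are far out, both translates are small and close to the boundary, and
  the slope hardly varies. If only \<open>g\<close> is far out while \<open>h\<close> ranges over a finite set \<open>\<Gamma>2\<close>, the
  translate by \<open>h\<close> stays away from the boundary, so the slope is nearly \<open>0\<close> provided that \<open>g\<close> is far out
  compared with \<open>\<Gamma>2\<close>; there the second coordinate, which is not small, is collapsed.
  For this reason two thresholds are chosen for each factor, the second one
  (\<open>\<Delta>1\<close>, \<open>\<Delta>2\<close>) depending on the first one of the other factor (\<open>\<Gamma>2\<close>, \<open>\<Gamma>1\<close>).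
\<close>
lemma pair_act_null:
  assumes C: "compact C" "C \<subseteq> D" and e: "0 < (e::real)"
  shows "\<exists>\<Gamma>. finite \<Gamma> \<and> (\<forall>\<gamma>\<in>carrier G \<times> carrier H - \<Gamma>. \<forall>p\<in>C. \<forall>p'\<in>C. dist (pair_act \<gamma> p) (pair_act \<gamma> p') < e)"
proof -
  let ?A = "S \<times> T \<times> {0..1::real}"
  have "uniformly_continuous_on ?A join_point"
    by (intro compact_uniformly_continuous join_point_cont compact_Times X.S_compact Y.S_compact compact_Icc)
  from this[unfolded uniformly_continuous_on_def, THEN spec, THEN mp, OF half_gt_zero[OF e]]
  obtain \<delta> where \<delta>: "0 < \<delta>" "\<forall>z\<in>?A. \<forall>z'\<in>?A. dist z' z < \<delta> \<longrightarrow> dist (join_point z') (join_point z) < e / 2"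
    by (elim exE conjE) (rule that)
  have close: "dist (join_point (x, y, s)) (join_point (x', y', s')) < e / 2"
    if "x \<in> S" "y \<in> T" "s \<in> {0..1}" "x' \<in> S" "y' \<in> T" "s' \<in> {0..1}" "dist x x' + dist y y' + \<bar>s - s'\<bar> < \<delta>"
    for x y s x' y' s'
    using \<delta>(2)[rule_format, of "(x', y', s')" "(x, y, s)"] that dist_triple_le[of x y s x' y' s'] by (simp add: dist_real_def)
  define K where "K = fst_part ` C"
  define L where "L = snd_part ` C"
  have K: "compact K" "K \<subseteq> {x \<in> S. 0 < a x}" and L: "compact L" "L \<subseteq> {y \<in> T. 0 < b y}"
    unfolding K_def L_def using C D_parts
    by (auto intro!: compact_continuous_image continuous_on_subset[OF parts_cont(1)] continuous_on_subset[OF parts_cont(2)])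
  obtain c1 where c1: "0 \<le> c1"
    "\<And>g x y. g \<in> carrier G \<Longrightarrow> x \<in> K \<Longrightarrow> y \<in> K \<Longrightarrow> \<bar>a (act g y) - a (act g x)\<bar> \<le> c1 * a (act g y) * a (act g x)"
    by (rule X.translate_distortion[OF K]) (rule that)
  obtain c2 where c2: "0 \<le> c2"
    "\<And>h x y. h \<in> carrier H \<Longrightarrow> x \<in> L \<Longrightarrow> y \<in> L \<Longrightarrow> \<bar>b (act' h y) - b (act' h x)\<bar> \<le> c2 * b (act' h y) * b (act' h x)"
    by (rule Y.translate_distortion[OF L]) (rule that)
  define c where "c = max c1 c2"
  have c0: "0 \<le> c" using c1 by (simp add: c_def)
  define \<eta> where "\<eta> = \<delta> / (8 * (c + 1))"
  have eta: "0 < \<eta>" "4 * \<eta> < \<delta>" "2 * \<eta> + c * (2 * \<eta>) < \<delta>"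
    using \<delta>(1) c0 by (simp_all add: \<eta>_def field_simps add_pos_nonneg)
  obtain \<Gamma>1 where \<Gamma>1: "finite \<Gamma>1" "\<forall>g\<in>carrier G - \<Gamma>1. \<forall>x\<in>K. a (act g x) < \<eta> \<and> (\<forall>y\<in>K. dist (act g x) (act g y) < \<eta>)"
    using X.null[OF K eta(1)] by (elim exE conjE) (rule that)
  obtain \<Gamma>2 where \<Gamma>2: "finite \<Gamma>2" "\<forall>h\<in>carrier H - \<Gamma>2. \<forall>x\<in>L. b (act' h x) < \<eta> \<and> (\<forall>y\<in>L. dist (act' h x) (act' h y) < \<eta>)"
    using Y.null[OF L eta(1)] by (elim exE conjE) (rule that)
  obtain w1 where w1: "0 < w1" "w1 \<le> 1" "\<And>g x. g \<in> \<Gamma>1 \<Longrightarrow> g \<in> carrier G \<Longrightarrow> x \<in> K \<Longrightarrow> w1 \<le> a (act g x)"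
    by (rule X.finite_translates_bounded_below[OF \<Gamma>1(1) K]) (rule that)
  obtain w2 where w2: "0 < w2" "w2 \<le> 1" "\<And>h x. h \<in> \<Gamma>2 \<Longrightarrow> h \<in> carrier H \<Longrightarrow> x \<in> L \<Longrightarrow> w2 \<le> b (act' h x)"
    by (rule Y.finite_translates_bounded_below[OF \<Gamma>2(1) L]) (rule that)
  have e1: "0 < \<eta> * w2" "\<eta> * w2 \<le> \<eta>" and e2: "0 < \<eta> * w1" "\<eta> * w1 \<le> \<eta>"
    using eta(1) w1 w2 by (simp_all add: mult_left_le)
  obtain \<Delta>1 where \<Delta>1: "finite \<Delta>1" "\<forall>g\<in>carrier G - \<Delta>1. \<forall>x\<in>K. a (act g x) < \<eta> * w2 \<and> (\<forall>y\<in>K. dist (act g x) (act g y) < \<eta> * w2)"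
    using X.null[OF K e1(1)] by (elim exE conjE) (rule that)
  obtain \<Delta>2 where \<Delta>2: "finite \<Delta>2" "\<forall>h\<in>carrier H - \<Delta>2. \<forall>x\<in>L. b (act' h x) < \<eta> * w1 \<and> (\<forall>y\<in>L. dist (act' h x) (act' h y) < \<eta> * w1)"
    using Y.null[OF L e2(1)] by (elim exE conjE) (rule that)
  have "dist (pair_act (g, h) p) (pair_act (g, h) p') < e"
    if gh: "g \<in> carrier G" "h \<in> carrier H" "(g, h) \<notin> \<Delta>1 \<times> \<Delta>2" and p: "p \<in> C" "p' \<in> C" for g h p p'
  proof -
    let ?x = "act g (fst_part p)" and ?y = "act' h (snd_part p)"
    let ?x' = "act g (fst_part p')" and ?y' = "act' h (snd_part p')"
    have pD: "p \<in> D" "p' \<in> D" using p C by auto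
    note d = D_parts[OF pD(1)] and d' = D_parts[OF pD(2)]
    have kl: "fst_part p \<in> K" "fst_part p' \<in> K" "snd_part p \<in> L" "snd_part p' \<in> L"
      using p by (auto simp: K_def L_def)
    have S: "?x \<in> S" "?x' \<in> S" "?y \<in> T" "?y' \<in> T" using d d' gh X.act_in Y.act_in by auto
    have pos: "0 < a ?x" "0 < a ?x'" "0 < b ?y" "0 < b ?y'"
      using d d' gh X.act_pos Y.act_pos by auto
    define s where "s = a ?x / (a ?x + b ?y)"
    define s' where "s' = a ?x' / (a ?x' + b ?y')"
    have s01: "s \<in> {0..1}" "s' \<in> {0..1}" using pos by (auto simp: s_def s'_def)
    have eq: "pair_act (g, h) p = join_point (?x, ?y, s)" "pair_act (g, h) p' = join_point (?x', ?y', s')"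
      using pair_act_joined[OF d(1-4) gh(1,2), of 0] pair_act_joined[OF d'(1-4) gh(1,2), of 0] d(5)[of 0] d'(5)[of 0] pos
      by (simp_all add: joined_def slope_def s_def s'_def)
    consider "a ?x < \<eta>" "a ?x' < \<eta>" "dist ?x ?x' < \<eta>" "b ?y < \<eta>" "b ?y' < \<eta>" "dist ?y ?y' < \<eta>"
      | "a ?x < \<eta> * w2" "a ?x' < \<eta> * w2" "dist ?x ?x' < \<eta>" "w2 \<le> b ?y" "w2 \<le> b ?y'"
      | "b ?y < \<eta> * w1" "b ?y' < \<eta> * w1" "dist ?y ?y' < \<eta>" "w1 \<le> a ?x" "w1 \<le> a ?x'"
    proof -
      have X1: "a ?x < \<eta>" "a ?x' < \<eta>" "dist ?x ?x' < \<eta>" if "g \<notin> \<Gamma>1" using \<Gamma>1(2) gh(1) that kl by blast+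
      have Y1: "b ?y < \<eta>" "b ?y' < \<eta>" "dist ?y ?y' < \<eta>" if "h \<notin> \<Gamma>2" using \<Gamma>2(2) gh(2) that kl by blast+
      have X2: "a ?x < \<eta> * w2" "a ?x' < \<eta> * w2" "dist ?x ?x' < \<eta> * w2" if "g \<notin> \<Delta>1" using \<Delta>1(2) gh(1) that kl by blast+
      have Y2: "b ?y < \<eta> * w1" "b ?y' < \<eta> * w1" "dist ?y ?y' < \<eta> * w1" if "h \<notin> \<Delta>2" using \<Delta>2(2) gh(2) that kl by blast+
      consider "g \<notin> \<Delta>1" "h \<in> \<Gamma>2" | "g \<notin> \<Delta>1" "h \<notin> \<Gamma>2" | "h \<notin> \<Delta>2" "g \<in> \<Gamma>1" | "h \<notin> \<Delta>2" "g \<notin> \<Gamma>1"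
        using gh(3) by blast
      then show thesis
      proof cases
        case 1
        then show thesis using that(2) X2 w2(3)[OF 1(2) gh(2)] kl e1 by fastforce
      next
        case 2
        then show thesis using that(1) X2 Y1 e1 by fastforce
      next
        case 3
        then show thesis using that(3) Y2 w1(3)[OF 3(2) gh(1)] kl e2 by fastforce
      next
        case 4
        then show thesis using that(1) Y2 X1 e2 by fastforce
      qed
    qed
    \<comment> \<open>The three cases: both coordinates small, only the first one, only the second one.\<close>
    then show ?thesis
    proof cases
      case 1
      have "\<bar>s' - s\<bar> \<le> c * (a ?x + b ?y)"
        unfolding s'_def
      proof (rule slope_estimate)
        have w: "s * (a ?x + b ?y) = a ?x" "(1 - s) * (a ?x + b ?y) = b ?y"
          using pos by (simp_all add: s_def field_simps)
        have "c1 * (a ?x' * a ?x) \<le> c * (a ?x' * a ?x)" using pos by (intro mult_right_mono) (auto simp: c_def)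
        then show "\<bar>a ?x' - s * (a ?x + b ?y)\<bar> \<le> c * a ?x' * (s * (a ?x + b ?y))"
          using c1(2)[OF gh(1) kl(1,2)] unfolding w by (simp add: mult.assoc)
        have "c2 * (b ?y' * b ?y) \<le> c * (b ?y' * b ?y)" using pos by (intro mult_right_mono) (auto simp: c_def)
        then show "\<bar>b ?y' - (1 - s) * (a ?x + b ?y)\<bar> \<le> c * b ?y' * ((1 - s) * (a ?x + b ?y))"
          using c2(2)[OF gh(2) kl(3,4)] unfolding w by (simp add: mult.assoc)
      qed (use pos s01 c0 in auto)
      also have "\<dots> \<le> c * (2 * \<eta>)" using 1 c0 by (intro mult_left_mono) auto
      finally have "dist ?x ?x' + dist ?y ?y' + \<bar>s - s'\<bar> < \<delta>" using 1 eta(3) by linarith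
      from close[OF S(1,3) s01(1) S(2,4) s01(2) this] show ?thesis using e by (simp add: eq)
    next
      case 2
      have small: "u / (u + v) < \<eta>" if "0 < u" "u < \<eta> * w2" "w2 \<le> v" for u v
      proof -
        have "\<eta> * w2 \<le> \<eta> * (u + v)" using that eta(1) by (intro mult_left_mono) auto
        then have "u < \<eta> * (u + v)" using that(2) by linarith
        then show ?thesis using that w2(1) by (simp add: divide_less_eq)
      qed
      have s: "s < \<eta>" "s' < \<eta>" using small pos 2 by (simp_all add: s_def s'_def)
      have "dist (join_point (?x, ?y, s)) (join_point (?x, ?y, 0)) < e / 2"
        by (rule close) (use S s01 s eta in auto)
      moreover have "dist (join_point (?x, ?y', 0)) (join_point (?x', ?y', s')) < e / 2"
        by (rule close) (use S s01 s eta 2 in auto)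
      moreover have "join_point (?x, ?y, 0) = join_point (?x, ?y', 0)" by (simp add: join_point_eq_iff)
      ultimately show ?thesis unfolding eq by (metis dist_triangle_half_r dist_commute)
    next
      case 3
      have small: "1 - u / (u + v) < \<eta>" if "0 < v" "v < \<eta> * w1" "w1 \<le> u" for u v
      proof -
        have "\<eta> * w1 \<le> \<eta> * (u + v)" using that eta(1) by (intro mult_left_mono) auto
        then have "v < \<eta> * (u + v)" using that(2) by linarith
        moreover have "0 < u + v" using that w1(1) by simp
        moreover have "1 - u / (u + v) = v / (u + v)" using calculation(2) by (simp add: field_simps)
        ultimately show ?thesis by (simp add: divide_less_eq)
      qed
      have s: "1 - s < \<eta>" "1 - s' < \<eta>" using small pos 3 by (simp_all add: s_def s'_def)
      have "dist (join_point (?x, ?y, s)) (join_point (?x, ?y, 1)) < e / 2"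
        by (rule close) (use S s01 s eta in auto)
      moreover have "dist (join_point (?x', ?y, 1)) (join_point (?x', ?y', s')) < e / 2"
        by (rule close) (use S s01 s eta 3 in auto)
      moreover have "join_point (?x, ?y, 1) = join_point (?x', ?y, 1)" by (simp add: join_point_eq_iff)
      ultimately show ?thesis unfolding eq by (metis dist_triangle_half_r dist_commute)
    qed
  qed
  moreover have "finite (\<Delta>1 \<times> \<Delta>2)" using \<Delta>1(1) \<Delta>2(1) by simp
  ultimately show ?thesis by (intro exI[of _ "\<Delta>1 \<times> \<Delta>2"]) auto
qed

section \<open>The EZ-structure on the product\<close>

text \<open>
  The homotopy \<open>push\<close> moves \<open>P\<close> instantly into the absolute extensor \<open>D\<close>.
\<close>
lemma P_retraction:
  obtains r where "continuous_on (euclid (2 * max m n + 2)) r"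
    "r ` (euclid (2 * max m n + 2)) \<subseteq> P" "\<And>p. p \<in> P \<Longrightarrow> r p = p"
proof -
  let ?E = "(euclid (2 * max m n + 2))"
  have "closedin (top_of_set ?E) P" using P_sub P_compact by (simp add: closed_subset compact_imp_closed)
  then have cl: "closedin (top_of_set (?E \<times> {0<..1})) (P \<times> {0<..1::real})" by (rule closedin_Times) simp
  have pc: "continuous_on (P \<times> {0<..1}) push" by (rule continuous_on_subset[OF push_cont]) auto
  have im: "push ` (P \<times> {0<..1}) \<subseteq> D" using push_in_D by auto
  obtain \<Phi> where \<Phi>: "continuous_on (?E \<times> {0<..1}) \<Phi>" "\<Phi> ` (?E \<times> {0<..1}) \<subseteq> D" "\<And>z. z \<in> P \<times> {0<..1} \<Longrightarrow> \<Phi> z = push z"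
    by (rule absolute_extensorE[OF D_extensor cl pc im]) (rule that)
  show ?thesis
    by (rule instant_homotopy_retraction[OF P_compact P_ne P_sub push_cont push_0 \<Phi>(1)])
      (use \<Phi> D_subset that in auto)
qed

end

lemma Euclidean_space_eq: "Euclidean_space n = top_of_set (euclid n)"
  by (simp add: Euclidean_space_def euclidean_product_topology)

lemma separable_space_top_of_set: "separable_space (top_of_set (A :: 'a::second_countable_topology set))"
proof -
  obtain B :: "'a set set" where B: "countable B" "topological_basis B" using ex_countable_basis by blast
  have "second_countable (euclidean :: 'a topology)"
    unfolding second_countable_def
    using B topological_basis_open[OF B(2)] topological_basisE[OF B(2)] by (intro exI[of _ B]) (metis open_openin)
  then show ?thesis by (intro second_countable_imp_separable_space second_countable_subtopology)
qed

lemma ER_space_top_of_set: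
  fixes P :: "rseq set"
  assumes "P \<subseteq> euclid n" "continuous_on (euclid n) r"
    "r ` euclid n \<subseteq> P" "\<And>p. p \<in> P \<Longrightarrow> r p = p"
  shows "ER_space (top_of_set P)"
proof -
  let ?E = "euclid n"
  have EP: "?E \<inter> P = P" using assms(1) by blast
  have "embedding_map (top_of_set P) (Euclidean_space n) id"
    by (simp add: embedding_map_def Euclidean_space_eq subtopology_subtopology EP)
  moreover have "P retract_of_space Euclidean_space n"
    unfolding retract_of_space_def
    using assms by (auto simp: Euclidean_space_eq subtopology_subtopology EP image_subset_iff intro!: exI[of _ r])
  ultimately show ?thesis unfolding ER_space_def by (intro exI[of _ n] exI[of _ id]) simp
qed

text \<open>
  A Euclidean retract is even a retract of every metrizable space in which it is closed: extend the
  inverse of the embedding coordinatewise by Tietze, then retract. So the neighbourhood can be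
  the whole space.
\<close>
lemma ANR_space_top_of_set:
  fixes P :: "rseq set"
  assumes P: "P \<subseteq> euclid n" and r: "continuous_on (euclid n) r"
    "r ` euclid n \<subseteq> P" "\<And>p. p \<in> P \<Longrightarrow> r p = p"
  shows "ANR_space (top_of_set P)"
  unfolding ANR_space_def
proof (intro conjI allI impI; (elim conjE)?)
  show "metrizable_space (top_of_set P)" by (intro metrizable_space_subtopology metrizable_space_euclidean)
  show "separable_space (top_of_set P)" by (rule separable_space_top_of_set)
  fix Y :: "rseq topology" and f :: "rseq \<Rightarrow> rseq"
  assume Y: "metrizable_space Y" and f: "embedding_map (top_of_set P) Y f" and cl: "closedin Y (f ` topspace (top_of_set P))"
  let ?E = "euclid n"
  let ?B = "f ` P"
  have clB: "closedin Y ?B" using cl by simp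
  obtain g where fg: "homeomorphic_maps (top_of_set P) (subtopology Y ?B) f g"
    using f by (auto simp: embedding_map_def homeomorphic_map_maps)
  then have fc: "continuous_map (top_of_set P) Y f" and gc: "continuous_map (subtopology Y ?B) (top_of_set P) g"
    and gf: "\<And>p. p \<in> P \<Longrightarrow> g (f p) = p"
    by (auto simp: homeomorphic_maps_def continuous_map_in_subtopology)
  have gci: "continuous_map (subtopology Y ?B) euclideanreal (\<lambda>y. g y i)" for i
  proof -
    have "continuous_map (subtopology Y ?B) euclidean g" using gc by (simp add: continuous_map_in_subtopology)
    then show ?thesis unfolding euclidean_product_topology[symmetric] continuous_map_componentwise_UNIV by blast
  qed
  have "\<exists>h. continuous_map Y euclideanreal h \<and> (\<forall>y\<in>?B. h y = g y i)" for i
    by (rule Tietze_extension_realinterval[OF metrizable_imp_normal_space[OF Y] clB, of UNIV "\<lambda>y. g y i"])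
      (use gci in auto)
  then obtain h where h: "\<And>i. continuous_map Y euclideanreal (h i)" "\<And>i y. y \<in> ?B \<Longrightarrow> h i y = g y i" by metis
  define k where "k y = (\<lambda>i. if i < n then h i y else 0)" for y
  have kc: "continuous_map Y (top_of_set ?E) k"
    using continuous_map_componentwise_Euclidean_space[of Y n "\<lambda>y i. h i y"] h(1)
    unfolding k_def Euclidean_space_eq by simp
  have kg: "k (f p) = p" if "p \<in> P" for p
  proof
    fix i
    have "p i = 0" if "\<not> i < n" using \<open>p \<in> P\<close> P that by auto
    then show "k (f p) i = p i" using that h(2)[of "f p" i] gf[OF that] by (auto simp: k_def)
  qed
  have "continuous_map (top_of_set ?E) (top_of_set P) r" using r by (auto simp: image_subset_iff)
  from continuous_map_compose[OF continuous_map_compose[OF kc this] fc]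
  have rc: "continuous_map Y Y (f \<circ> (r \<circ> k))" .
  have "?B retract_of_space Y"
    unfolding retract_of_space_def
  proof (intro conjI exI[of _ "f \<circ> (r \<circ> k)"] ballI)
    show "?B \<subseteq> topspace Y" using clB by (rule closedin_subset)
    have "k y \<in> ?E" if "y \<in> topspace Y" for y using kc that by (auto simp: continuous_map_def)
    then have "r (k y) \<in> P" if "y \<in> topspace Y" for y using r(2) that by blast
    then show "continuous_map Y (subtopology Y ?B) (f \<circ> (r \<circ> k))"
      using rc by (auto simp: continuous_map_in_subtopology)
    show "(f \<circ> (r \<circ> k)) y = y" if "y \<in> ?B" for y using that kg r(3) by auto
  qed
  then show "\<exists>V. openin Y V \<and> f ` topspace (top_of_set P) \<subseteq> V \<and> f ` topspace (top_of_set P) retract_of_space subtopology Y V"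
    using closedin_subset[OF clB] by (intro exI[of _ "topspace Y"]) simp
qed

lemma acts_by_homeos_restrict:
  fixes K :: "('k, 'l) monoid_scheme" and M :: "'a::topological_space set"
  assumes K: "group K"
    and cont: "\<And>g. g \<in> carrier K \<Longrightarrow> continuous_on M (\<alpha> g)"
    and im: "\<And>g x. g \<in> carrier K \<Longrightarrow> x \<in> M \<Longrightarrow> \<alpha> g x \<in> M"
    and one: "\<And>x. x \<in> M \<Longrightarrow> \<alpha> \<one>\<^bsub>K\<^esub> x = x"
    and mult: "\<And>g h x. g \<in> carrier K \<Longrightarrow> h \<in> carrier K \<Longrightarrow> x \<in> M \<Longrightarrow> \<alpha> (g \<otimes>\<^bsub>K\<^esub> h) x = \<alpha> g (\<alpha> h x)"
  shows "acts_by_homeos K (top_of_set M) (\<lambda>g. restrict (\<alpha> g) M)"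
proof -
  interpret group K by (rule K)
  have inv1: "\<alpha> (inv\<^bsub>K\<^esub> g) (\<alpha> g x) = x" if "g \<in> carrier K" "x \<in> M" for g x
    using mult[of "inv\<^bsub>K\<^esub> g" g x] one that by simp
  have inv2: "\<alpha> g (\<alpha> (inv\<^bsub>K\<^esub> g) x) = x" if "g \<in> carrier K" "x \<in> M" for g x
    using mult[of g "inv\<^bsub>K\<^esub> g" x] one that by simp
  have bij: "restrict (\<alpha> g) M \<in> Bij M" if g: "g \<in> carrier K" for g
  proof -
    have "bij_betw (\<alpha> g) M M"
      by (rule bij_betw_byWitness[where f' = "\<alpha> (inv\<^bsub>K\<^esub> g)"]) (use g inv1 inv2 im in auto)
    then show ?thesis by (simp add: Bij_def)
  qed
  have "group_hom K (BijGroup M) (\<lambda>g. restrict (\<alpha> g) M)"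
  proof (intro group_hom.intro group_hom_axioms.intro K group_BijGroup homI)
    show "restrict (\<alpha> g) M \<in> carrier (BijGroup M)" if "g \<in> carrier K" for g
      using bij[OF that] by (simp add: BijGroup_def)
    show "restrict (\<alpha> (g \<otimes>\<^bsub>K\<^esub> h)) M = restrict (\<alpha> g) M \<otimes>\<^bsub>BijGroup M\<^esub> restrict (\<alpha> h) M"
      if "g \<in> carrier K" "h \<in> carrier K" for g h
      using bij that mult im by (auto simp: BijGroup_def compose_def restrict_def)
  qed
  moreover have "homeomorphic_map (top_of_set M) (top_of_set M) (restrict (\<alpha> g) M)" if g: "g \<in> carrier K" for g
  proof -
    have "continuous_on M (restrict (\<alpha> h) M)" if "h \<in> carrier K" for h
      using cont[OF that] by (rule continuous_on_eq) simp
    then have "homeomorphic_maps (top_of_set M) (top_of_set M) (restrict (\<alpha> g) M) (restrict (\<alpha> (inv\<^bsub>K\<^esub> g)) M)"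
      using g im inv1 inv2 by (auto simp: homeomorphic_maps_def)
    then show ?thesis using homeomorphic_map_maps by blast
  qed
  ultimately show ?thesis by (simp add: acts_by_homeos_def group_action_def)
qed

context product_EZ
begin

theorem EZ_structure_product:
  "EZ_structure (G \<times>\<times> H) (top_of_set P) (P - D) (\<lambda>\<gamma>. restrict (pair_act \<gamma>) D)"
proof -
  have grp: "group (G \<times>\<times> H)" by (rule DirProd_group[OF X.grp Y.grp])
  have car: "fst \<gamma> \<in> carrier G" "snd \<gamma> \<in> carrier H" if "\<gamma> \<in> carrier (G \<times>\<times> H)" for \<gamma>
    using that by auto
  have PD: "P - (P - D) = D" "P \<inter> D = D" using D_subset by auto
  obtain r where r: "continuous_on (euclid (2 * max m n + 2)) r"
    "r ` (euclid (2 * max m n + 2)) \<subseteq> P" "\<And>p. p \<in> P \<Longrightarrow> r p = p"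
    by (rule P_retraction) (rule that)
  have ER: "ER_space (top_of_set P)" by (rule ER_space_top_of_set[OF P_sub r])
  have ANR: "ANR_space (top_of_set P)" by (rule ANR_space_top_of_set[OF P_sub r])
  have comp: "compact_space (top_of_set P)" using P_compact by (simp add: compact_space_subtopology)
  have Zset: "Z_set (top_of_set P) (P - D)"
    unfolding Z_set_def
  proof (intro conjI exI[of _ push] ANR)
    show "closedin (top_of_set P) (P - D)" using frontier_closed by (simp add: closed_subset)
    show "continuous_map (prod_topology (top_of_set P) (top_of_set {0..1})) (top_of_set P) push"
      using push_cont push_in_P by auto
    show "\<forall>x\<in>topspace (top_of_set P). push (x, 0) = x" using push_0 by simp
    show "\<forall>t\<in>{0<..1}. (\<lambda>x. push (x, t)) ` topspace (top_of_set P) \<inter> (P - D) = {}"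
      using push_in_D by auto
  qed
  have pm: "pair_act (\<gamma> \<otimes>\<^bsub>G \<times>\<times> H\<^esub> \<gamma>') p = pair_act \<gamma> (pair_act \<gamma>' p)"
    if "\<gamma> \<in> carrier (G \<times>\<times> H)" "\<gamma>' \<in> carrier (G \<times>\<times> H)" "p \<in> P" for \<gamma> \<gamma>' p
    using that pair_act_mult[of "fst \<gamma>" "fst \<gamma>'" "snd \<gamma>" "snd \<gamma>'" p] by (auto simp: DirProd_def split: prod.splits)
  have p1: "pair_act \<one>\<^bsub>G \<times>\<times> H\<^esub> p = p" if "p \<in> P" for p using pair_act_one[OF that] by simp
  have actP: "acts_by_homeos (G \<times>\<times> H) (top_of_set P) (\<lambda>\<gamma>. restrict (pair_act \<gamma>) P)"
    by (rule acts_by_homeos_restrict[OF grp]) (use car pair_act_cont pair_act_in_P p1 pm in auto)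
  have actD: "acts_by_homeos (G \<times>\<times> H) (top_of_set D) (\<lambda>\<gamma>. restrict (pair_act \<gamma>) D)"
  proof (rule acts_by_homeos_restrict[OF grp])
    show "continuous_on D (pair_act \<gamma>)" if "\<gamma> \<in> carrier (G \<times>\<times> H)" for \<gamma>
      by (rule continuous_on_subset[OF pair_act_cont D_subset]) (use car[OF that] in auto)
    show "pair_act \<gamma> p \<in> D" if "\<gamma> \<in> carrier (G \<times>\<times> H)" "p \<in> D" for \<gamma> p
      using pair_act_in_D_iff[of \<gamma> p] car[OF that(1)] that(2) D_subset by auto
    show "pair_act \<one>\<^bsub>G \<times>\<times> H\<^esub> p = p" if "p \<in> D" for p using p1 that D_subset by blast
    show "pair_act (\<gamma> \<otimes>\<^bsub>G \<times>\<times> H\<^esub> \<gamma>') p = pair_act \<gamma> (pair_act \<gamma>' p)"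
      if "\<gamma> \<in> carrier (G \<times>\<times> H)" "\<gamma>' \<in> carrier (G \<times>\<times> H)" "p \<in> D" for \<gamma> \<gamma>' p
      using pm that D_subset by blast
  qed
  have proper: "proper_action (G \<times>\<times> H) (top_of_set D) (\<lambda>\<gamma>. restrict (pair_act \<gamma>) D)"
    unfolding proper_action_def
  proof
    fix p assume "p \<in> topspace (top_of_set D)"
    then obtain U where U: "openin (top_of_set D) U" "p \<in> U" "finite {\<gamma> \<in> carrier G \<times> carrier H. pair_act \<gamma> ` U \<inter> U \<noteq> {}}"
      using pair_act_proper by auto
    have "restrict (pair_act \<gamma>) D ` U = pair_act \<gamma> ` U" for \<gamma>
      using openin_subset[OF U(1)] by (auto simp: subset_iff)
    then show "\<exists>U. openin (top_of_set D) U \<and> p \<in> U \<and> finite {\<gamma> \<in> carrier (G \<times>\<times> H). restrict (pair_act \<gamma>) D ` U \<inter> U \<noteq> {}}"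
      using U by (intro exI[of _ U]) simp
  qed
  have cocpt: "cocompact_action (G \<times>\<times> H) (top_of_set D) (\<lambda>\<gamma>. restrict (pair_act \<gamma>) D)"
  proof -
    obtain K where K: "compact K" "K \<subseteq> D" "\<forall>p\<in>D. \<exists>\<gamma>\<in>carrier G \<times> carrier H. \<exists>k\<in>K. p = pair_act \<gamma> k"
      using pair_act_cocompact by (elim exE conjE) (rule that)
    have "(\<Union>\<gamma>\<in>carrier (G \<times>\<times> H). restrict (pair_act \<gamma>) D ` K) = D"
    proof (intro equalityI subsetI)
      fix p assume "p \<in> (\<Union>\<gamma>\<in>carrier (G \<times>\<times> H). restrict (pair_act \<gamma>) D ` K)"
      then obtain \<gamma> k where gk: "\<gamma> \<in> carrier (G \<times>\<times> H)" "k \<in> K" "p = restrict (pair_act \<gamma>) D k" by blast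
      then have "k \<in> D" using K(2) by blast
      then show "p \<in> D" using pair_act_in_D_iff[of \<gamma> k] car[OF gk(1)] gk(3) D_subset by auto
    next
      fix p assume "p \<in> D"
      then obtain \<gamma> k where gk: "\<gamma> \<in> carrier G \<times> carrier H" "k \<in> K" "p = pair_act \<gamma> k" using K(3) by blast
      then have "p \<in> restrict (pair_act \<gamma>) D ` K" using K(2) by (intro image_eqI[of _ _ k]) auto
      then show "p \<in> (\<Union>\<gamma>\<in>carrier (G \<times>\<times> H). restrict (pair_act \<gamma>) D ` K)"
        using gk(1) by (intro UN_I[of \<gamma>]) simp_all
    qed
    then show ?thesis unfolding cocompact_action_def using K(1,2)
      by (intro exI[of _ K]) (simp add: compactin_subtopology)
  qed
  have null: "null_condition (G \<times>\<times> H) (top_of_set P) D (\<lambda>\<gamma>. restrict (pair_act \<gamma>) D)"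
    unfolding null_condition_def
  proof (intro allI impI, elim conjE)
    fix C \<U>
    assume C: "compactin (subtopology (top_of_set P) D) C" and op: "\<forall>U\<in>\<U>. openin (top_of_set P) U"
      and cov: "\<Union>\<U> = topspace (top_of_set P)"
    have C': "compact C" "C \<subseteq> D" using C by (auto simp: compactin_subtopology subtopology_subtopology)
    have cover: "P \<subseteq> \<Union>{V. open V \<and> P \<inter> V \<in> \<U>}"
    proof
      fix p assume "p \<in> P"
      then obtain U where "U \<in> \<U>" "p \<in> U" using cov by auto
      moreover then obtain V where "open V" "U = P \<inter> V" using op unfolding openin_open by blast
      ultimately show "p \<in> \<Union>{V. open V \<and> P \<inter> V \<in> \<U>}" by blast
    qed
    obtain e where e: "0 < e" "\<And>p. p \<in> P \<Longrightarrow> \<exists>V\<in>{V. open V \<and> P \<inter> V \<in> \<U>}. ball p e \<subseteq> V"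
      by (rule Heine_Borel_lemma[OF P_compact cover]) auto
    obtain \<Gamma> where \<Gamma>: "finite \<Gamma>" "\<forall>\<gamma>\<in>carrier G \<times> carrier H - \<Gamma>. \<forall>p\<in>C. \<forall>p'\<in>C. dist (pair_act \<gamma> p) (pair_act \<gamma> p') < e"
      using pair_act_null[OF C' e(1)] by (elim exE conjE) (rule that)
    have "\<exists>U\<in>\<U>. restrict (pair_act \<gamma>) D ` C \<subseteq> U" if \<gamma>: "\<gamma> \<in> carrier (G \<times>\<times> H) - (\<Gamma> \<inter> carrier (G \<times>\<times> H))" for \<gamma>
    proof (cases "C = {}")
      case True
      have "\<Union>\<U> \<noteq> {}" using cov P_ne by simp
      then show ?thesis using True by blast
    next
      case False
      then obtain p where p: "p \<in> C" by blast
      have \<gamma>': "\<gamma> \<in> carrier G \<times> carrier H - \<Gamma>" "fst \<gamma> \<in> carrier G" "snd \<gamma> \<in> carrier H" using \<gamma> by auto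
      have inP: "pair_act \<gamma> q \<in> P" if "q \<in> C" for q using pair_act_in_P[OF \<gamma>'(2,3)] that C'(2) D_subset by blast
      obtain V where V: "P \<inter> V \<in> \<U>" "ball (pair_act \<gamma> p) e \<subseteq> V" using e(2)[OF inP[OF p]] by blast
      have "restrict (pair_act \<gamma>) D ` C \<subseteq> P \<inter> V"
      proof (rule image_subsetI)
        fix q assume q: "q \<in> C"
        have "pair_act \<gamma> q \<in> ball (pair_act \<gamma> p) e" using \<Gamma>(2) \<gamma>'(1) p q by simp
        then show "restrict (pair_act \<gamma>) D q \<in> P \<inter> V" using V(2) inP[OF q] q C'(2) by auto
      qed
      then show ?thesis using V(1) by blast
    qed
    then show "\<exists>\<Gamma>. finite \<Gamma> \<and> \<Gamma> \<subseteq> carrier (G \<times>\<times> H) \<and> (\<forall>\<gamma>\<in>carrier (G \<times>\<times> H) - \<Gamma>. \<exists>U\<in>\<U>. restrict (pair_act \<gamma>) D ` C \<subseteq> U)"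
      using \<Gamma>(1) by (intro exI[of _ "\<Gamma> \<inter> carrier (G \<times>\<times> H)"]) auto
  qed
  have "Z_structure (G \<times>\<times> H) (top_of_set P) (P - D) (\<lambda>\<gamma>. restrict (pair_act \<gamma>) D)"
    unfolding Z_structure_def Let_def Z_compactification_def
    using comp ER ANR Zset actD proper cocpt null D_subset by (simp add: PD subtopology_subtopology double_diff)
  moreover have "\<forall>\<gamma>\<in>carrier (G \<times>\<times> H). \<forall>p\<in>topspace (top_of_set P) - (P - D). restrict (pair_act \<gamma>) P p = restrict (pair_act \<gamma>) D p"
    using D_subset by (auto simp: PD)
  ultimately show ?thesis unfolding EZ_structure_def using actP by blast
qed

end

section \<open>Transport to Euclidean space and conclusion\<close>

text \<open>
  Everything is conjugated by an embedding \<open>e\<close> with inverse \<open>d\<close>. The extended action preserves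
  the boundary, because it agrees with the given action, which permutes the complement.
\<close>
lemma EZ_structure_embedded:
  assumes grp: "group G" and EZ: "EZ_structure G Xh Z \<phi>"
  shows "\<exists>n S Z' r F act. euclidean_EZ G n S Z' r F act"
proof -
  define X where "X = topspace Xh"
  have ZX: "Z \<subseteq> X" and comp: "compact_space Xh" and ER: "ER_space Xh"
    and Zc: "Z_compactification Xh (X - Z)"
    and proper: "proper_action G (subtopology Xh (X - Z)) \<phi>"
    and cocpt: "cocompact_action G (subtopology Xh (X - Z)) \<phi>"
    and null: "null_condition G Xh (X - Z) \<phi>"
    and phi: "acts_by_homeos G (subtopology Xh (X - Z)) \<phi>"
    using EZ by (auto simp: EZ_structure_def Z_structure_def Let_def X_def)
  have "X - (X - Z) = Z" using ZX by blast
  then have "Z_set Xh Z" using Zc by (simp add: Z_compactification_def X_def)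
  then obtain F0 where clZ: "closedin Xh Z" and F0: "continuous_map (prod_topology Xh (top_of_set {0..1::real})) Xh F0"
    and F0_0: "\<And>x. x \<in> X \<Longrightarrow> F0 (x, 0) = x" and F0_off: "\<And>x t. x \<in> X \<Longrightarrow> t \<in> {0<..1} \<Longrightarrow> F0 (x, t) \<notin> Z"
    unfolding Z_set_def X_def by blast
  obtain \<psi> where psi: "acts_by_homeos G Xh \<psi>" and ext: "\<And>g x. g \<in> carrier G \<Longrightarrow> x \<in> X - Z \<Longrightarrow> \<psi> g x = \<phi> g x"
    using EZ unfolding EZ_structure_def X_def by blast
  obtain n e where e: "embedding_map Xh (Euclidean_space n) e" and re: "e ` X retract_of_space Euclidean_space n"
    using ER unfolding ER_space_def X_def by blast
  let ?E = "euclid n"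
  define S where "S = e ` X"
  have SE: "S \<subseteq> ?E" using retract_of_space_imp_subset[OF re] by (simp add: S_def topspace_Euclidean_space)
  then have ES: "?E \<inter> S = S" by blast
  have hom: "homeomorphic_map Xh (top_of_set S) e"
    using e by (simp add: embedding_map_def Euclidean_space_eq subtopology_subtopology ES S_def[unfolded X_def, symmetric])
  then obtain d where "homeomorphic_maps Xh (top_of_set S) e d" by (auto simp: homeomorphic_map_maps)
  then have ec: "continuous_map Xh (top_of_set S) e" and dc: "continuous_map (top_of_set S) Xh d"
    and de: "\<And>x. x \<in> X \<Longrightarrow> d (e x) = x" and ed: "\<And>y. y \<in> S \<Longrightarrow> e (d y) = y"
    by (auto simp: homeomorphic_maps_def X_def)
  have eS: "\<And>x. x \<in> X \<Longrightarrow> e x \<in> S" by (simp add: S_def)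
  have dX: "\<And>y. y \<in> S \<Longrightarrow> d y \<in> X" using de by (auto simp: S_def)
  define Z' where "Z' = e ` Z"
  have eZ: "e x \<in> Z' \<longleftrightarrow> x \<in> Z" if "x \<in> X" for x
    using that de ZX by (auto simp: Z'_def) (metis subsetD)
  have dZ: "d y \<in> Z \<longleftrightarrow> y \<in> Z'" if "y \<in> S" for y
    using eZ[OF dX[OF that]] ed[OF that] by simp
  have S_comp: "compact S"
    using image_compactin[OF comp[unfolded compact_space_def] ec] by (simp add: compactin_subtopology S_def X_def)
  obtain r where r: "continuous_map (Euclidean_space n) (subtopology (Euclidean_space n) S) r" "\<forall>y\<in>S. r y = y"
    using re unfolding retract_of_space_def S_def by blast
  then have rc: "continuous_on ?E r" "r ` ?E \<subseteq> S"
    by (auto simp: Euclidean_space_eq subtopology_subtopology ES)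
  have Z'_cl: "closed Z'"
  proof -
    have "closedin (top_of_set S) Z'"
      using homeomorphic_map_closedness[OF hom, of Z] clZ ZX by (simp add: Z'_def X_def)
    then show ?thesis using compact_imp_closed[OF S_comp] closedin_closed_trans by blast
  qed
  define F where "F z = e (F0 (d (fst z), snd z))" for z
  have "continuous_map (prod_topology (top_of_set S) (top_of_set {0..1::real})) (prod_topology Xh (top_of_set {0..1}))
      (\<lambda>z. (d (fst z), snd z))"
    unfolding continuous_map_pairwise o_def fst_conv snd_conv
    using continuous_map_compose[OF continuous_map_fst dc] by (simp add: o_def continuous_map_snd del: prod_topology_subtopology_eu)
  from continuous_map_compose[OF continuous_map_compose[OF this F0] ec]
  have Fc: "continuous_on (S \<times> {0..1}) F" "F ` (S \<times> {0..1}) \<subseteq> S"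
    by (auto simp: F_def[abs_def] o_def)
  have F0_in: "F0 (x, t) \<in> X" if "x \<in> X" "t \<in> {0..1}" for x t
    using F0 that by (auto simp: continuous_map_def X_def Pi_iff)
  interpret psi: group_action G X \<psi> using psi by (simp add: acts_by_homeos_def X_def)
  interpret phi: group_action G "X - Z" \<phi>
    using phi by (simp add: acts_by_homeos_def X_def Int_absorb1)
  have psi_in: "\<psi> g x \<in> X" if "g \<in> carrier G" "x \<in> X" for g x
    using psi.surj_prop[OF that(1)] that(2) by blast
  have phi_in: "\<phi> g x \<in> X - Z" if "g \<in> carrier G" "x \<in> X - Z" for g x
    using phi.surj_prop[OF that(1)] that(2) by blast
  have psi_one: "\<psi> \<one>\<^bsub>G\<^esub> x = x" if "x \<in> X" for x
    using fun_cong[OF psi.id_eq_one, of x] that by simp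
  have psi_inv: "\<psi> (inv\<^bsub>G\<^esub> g) (\<psi> g x) = x" if "g \<in> carrier G" "x \<in> X" for g x
    using psi.composition_rule[of x "inv\<^bsub>G\<^esub> g" g] that psi_one group.l_inv[OF grp] group.inv_closed[OF grp] by simp
  have psi_Z: "\<psi> g x \<in> Z \<longleftrightarrow> x \<in> Z" if g: "g \<in> carrier G" and x: "x \<in> X" for g x
  proof
    assume "\<psi> g x \<in> Z"
    then show "x \<in> Z" using phi_in[OF g, of x] ext[OF g, of x] x by (metis DiffD2 DiffI)
  next
    assume xZ: "x \<in> Z"
    show "\<psi> g x \<in> Z"
    proof (rule ccontr)
      assume "\<psi> g x \<notin> Z"
      then have w: "\<psi> g x \<in> X - Z" using psi_in[OF g x] by blast
      have "\<psi> (inv\<^bsub>G\<^esub> g) (\<psi> g x) \<in> X - Z"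
        using phi_in[OF group.inv_closed[OF grp g] w] ext[OF group.inv_closed[OF grp g] w] by simp
      then show False using psi_inv[OF g x] xZ by simp
    qed
  qed
  define act where "act g y = e (\<psi> g (d y))" for g y
  have act_e: "act g (e x) = e (\<psi> g x)" if "x \<in> X" for g x using that by (simp add: act_def de)
  have SZ: "S - Z' = e ` (X - Z)" using eZ by (auto simp: S_def)
  have "euclidean_EZ G n S Z' r F act"
  proof (rule euclidean_EZ.intro)
    show "group G" "compact S" "S \<subseteq> ?E" "continuous_on ?E r" "r ` ?E \<subseteq> S" "closed Z'"
      "continuous_on (S \<times> {0..1}) F" "F ` (S \<times> {0..1}) \<subseteq> S"
      by (fact grp S_comp SE rc Z'_cl Fc)+
    show "r x = x" if "x \<in> S" for x using r(2) that by blast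
    show "F (x, 0) = x" if "x \<in> S" for x using that by (simp add: F_def F0_0 dX ed)
    show "F (x, t) \<notin> Z'" if "x \<in> S" "t \<in> {0<..1}" for x t
      using F0_off[OF dX[OF that(1)] that(2)] eZ[OF F0_in[OF dX[OF that(1)], of t]] that(2) by (simp add: F_def)
    show "continuous_on S (act g)" if "g \<in> carrier G" for g
    proof -
      have "homeomorphic_map Xh Xh (\<psi> g)" using psi that by (simp add: acts_by_homeos_def)
      then have "continuous_map Xh Xh (\<psi> g)" by (rule homeomorphic_imp_continuous_map)
      from continuous_map_compose[OF continuous_map_compose[OF dc this] ec]
      show ?thesis by (simp add: act_def[abs_def] o_def)
    qed
    show "act g x \<in> S" if "g \<in> carrier G" "x \<in> S" for g x
      using that by (simp add: act_def eS psi_in dX)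
    show "act \<one>\<^bsub>G\<^esub> x = x" if "x \<in> S" for x using that by (simp add: act_def psi_one dX ed)
    show "act (g \<otimes>\<^bsub>G\<^esub> h) x = act g (act h x)" if "g \<in> carrier G" "h \<in> carrier G" "x \<in> S" for g h x
      using that psi.composition_rule[OF dX[OF that(3)] that(1,2)] by (simp add: act_def de psi_in dX)
    show "act g x \<in> Z' \<longleftrightarrow> x \<in> Z'" if "g \<in> carrier G" "x \<in> S" for g x
      using that eZ[OF psi_in[OF that(1) dX[OF that(2)]]] psi_Z[OF that(1) dX[OF that(2)]] dZ[OF that(2)]
      by (simp add: act_def)
    show "\<exists>U. openin (top_of_set (S - Z')) U \<and> y \<in> U \<and> finite {g \<in> carrier G. act g ` U \<inter> U \<noteq> {}}"
      if y: "y \<in> S - Z'" for y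
    proof -
      have dy: "d y \<in> topspace (subtopology Xh (X - Z))" using y dX dZ by (auto simp: X_def)
      obtain U where U: "openin (subtopology Xh (X - Z)) U" "d y \<in> U" "finite {g \<in> carrier G. \<phi> g ` U \<inter> U \<noteq> {}}"
        using proper dy unfolding proper_action_def by blast
      obtain V where V: "openin Xh V" "U = V \<inter> (X - Z)" using U(1) by (auto simp: openin_subtopology)
      have VX: "V \<subseteq> X" using openin_subset[OF V(1)] by (simp add: X_def)
      have UX: "U \<subseteq> X - Z" using V(2) by blast
      have "openin (top_of_set S) (e ` V)"
        using homeomorphic_map_openness[OF hom, of V] V(1) VX by (simp add: X_def)
      then obtain T where T: "open T" "e ` V = S \<inter> T" by (auto simp: openin_open)
      have "e ` U = e ` V \<inter> (S - Z')"
        using V(2) VX eZ eS by auto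
      also have "\<dots> = (S - Z') \<inter> T" using T(2) by blast
      finally have op: "openin (top_of_set (S - Z')) (e ` U)" using T(1) by (auto simp: openin_open)
      have "{g \<in> carrier G. act g ` (e ` U) \<inter> e ` U \<noteq> {}} \<subseteq> {g \<in> carrier G. \<phi> g ` U \<inter> U \<noteq> {}}"
      proof (rule subsetI)
        fix g assume "g \<in> {g \<in> carrier G. act g ` (e ` U) \<inter> e ` U \<noteq> {}}"
        then obtain u u' where g: "g \<in> carrier G" and u: "u \<in> U" "u' \<in> U" "act g (e u) = e u'" by auto
        have uX: "u \<in> X - Z" "u' \<in> X" using u UX by auto
        then have "e (\<phi> g u) = e u'" using u(3) act_e[of u g] ext[OF g uX(1)] by simp
        then have "\<phi> g u = u'" using de phi_in[OF g uX(1)] uX(2) by (metis DiffD1)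
        then show "g \<in> {g \<in> carrier G. \<phi> g ` U \<inter> U \<noteq> {}}" using g u by auto
      qed
      then have "finite {g \<in> carrier G. act g ` (e ` U) \<inter> e ` U \<noteq> {}}" using U(3) by (rule finite_subset)
      moreover have "y \<in> e ` U" using U(2) ed[of y] y by (intro image_eqI[of _ _ "d y"]) auto
      ultimately show ?thesis using op by (intro exI[of _ "e ` U"] conjI)
    qed
    show "\<exists>K. compact K \<and> K \<subseteq> S - Z' \<and> (\<forall>x\<in>S - Z'. \<exists>g\<in>carrier G. \<exists>k\<in>K. x = act g k)"
    proof -
      obtain K where K: "compactin (subtopology Xh (X - Z)) K" "(\<Union>g\<in>carrier G. \<phi> g ` K) = topspace (subtopology Xh (X - Z))"
        using cocpt unfolding cocompact_action_def by blast
      have KX: "compactin Xh K" "K \<subseteq> X - Z" using K(1) by (auto simp: compactin_subtopology)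
      have top: "topspace (subtopology Xh (X - Z)) = X - Z" by (auto simp: X_def)
      have "compact (e ` K)" using image_compactin[OF KX(1) ec] by (simp add: compactin_subtopology)
      moreover have "e ` K \<subseteq> S - Z'" using KX(2) SZ by blast
      moreover have "\<forall>y\<in>S - Z'. \<exists>g\<in>carrier G. \<exists>k\<in>e ` K. y = act g k"
      proof
        fix y assume that: "y \<in> S - Z'"
        have "d y \<in> (\<Union>g\<in>carrier G. \<phi> g ` K)" unfolding K(2) top using that dX dZ by blast
        then obtain g k where g: "g \<in> carrier G" "k \<in> K" "d y = \<phi> g k" by blast
        have "y = act g (e k)" using g act_e[of k g] ext[OF g(1), of k] KX(2) ed[of y] that by auto
        then show "\<exists>g\<in>carrier G. \<exists>k\<in>e ` K. y = act g k" using g by blast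
      qed
      ultimately show ?thesis by (intro exI[of _ "e ` K"] conjI)
    qed
    show "\<exists>\<Gamma>. finite \<Gamma> \<and> (\<forall>g\<in>carrier G - \<Gamma>. \<forall>x\<in>C. \<forall>y\<in>C. dist (act g x) (act g y) < \<epsilon>)"
      if C: "compact C" "C \<subseteq> S - Z'" and eps: "0 < \<epsilon>" for C and \<epsilon> :: real
    proof -
      have "compactin (top_of_set S) C" using C by (auto simp: compactin_subtopology)
      from image_compactin[OF this dc] have "compactin Xh (d ` C)" .
      moreover have "d ` C \<subseteq> X - Z" using C(2) dX dZ by blast
      ultimately have dC: "compactin (subtopology Xh (X - Z)) (d ` C)" by (simp add: compactin_subtopology)
      define \<U> where "\<U> = (\<lambda>p. {x \<in> topspace Xh. e x \<in> S \<inter> ball p (\<epsilon> / 2)}) ` S"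
      have "openin Xh {x \<in> topspace Xh. e x \<in> S \<inter> ball p (\<epsilon> / 2)}" for p
        by (rule openin_continuous_map_preimage[OF ec]) (simp add: openin_open_Int)
      then have "\<forall>U\<in>\<U>. openin Xh U" unfolding \<U>_def by blast
      moreover have "\<Union>\<U> = topspace Xh"
      proof (intro equalityI subsetI)
        fix x assume "x \<in> topspace Xh"
        then show "x \<in> \<Union>\<U>" using eS[of x] eps by (auto simp: \<U>_def X_def intro!: bexI[of _ "e x"])
      qed (auto simp: \<U>_def)
      ultimately obtain \<Gamma> where \<Gamma>: "finite \<Gamma>" "\<forall>g\<in>carrier G - \<Gamma>. \<exists>U\<in>\<U>. \<phi> g ` d ` C \<subseteq> U"
        using null dC unfolding null_condition_def by meson
      have "dist (act g x) (act g y) < \<epsilon>" if g: "g \<in> carrier G - \<Gamma>" and xy: "x \<in> C" "y \<in> C" for g x y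
      proof -
        obtain p where p: "\<phi> g ` d ` C \<subseteq> {x \<in> topspace Xh. e x \<in> S \<inter> ball p (\<epsilon> / 2)}"
          using \<Gamma>(2) g unfolding \<U>_def by blast
        have eq: "act g z = e (\<phi> g (d z))" if "z \<in> C" for z
        proof -
          have "d z \<in> X - Z" using that C(2) dX dZ by blast
          then show ?thesis using ext[of g "d z"] g by (simp add: act_def)
        qed
        have "act g x \<in> ball p (\<epsilon> / 2)" "act g y \<in> ball p (\<epsilon> / 2)" using p xy eq by auto
        then show ?thesis by (auto intro: dist_triangle_half_l[of _ p] simp: dist_commute)
      qed
      then show ?thesis using \<Gamma>(1) by blast
    qed
  qed
  then show ?thesis by blast
qed

theorem theorem3p22:
  fixes G :: "('g, 'm) monoid_scheme" and H :: "('h, 'n) monoid_scheme"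
  assumes "group G" and "group H"
    and "admits_EZ_structure TYPE('x) G"
    and "admits_EZ_structure TYPE('y) H"
  shows "admits_EZ_structure TYPE(nat \<Rightarrow> real) (G \<times>\<times> H)"
proof -
  obtain m S a F act where G: "controlled_EZ G m S a F act"
    using assms(1,3) EZ_structure_embedded euclidean_EZ.exists_controlled
    unfolding admits_EZ_structure_def by metis
  obtain n T b E act' where H: "controlled_EZ H n T b E act'"
    using assms(2,4) EZ_structure_embedded euclidean_EZ.exists_controlled
    unfolding admits_EZ_structure_def by metis
  interpret product_EZ G m S a F act H n T b E act' by (rule product_EZ.intro[OF G H])
  show ?thesis unfolding admits_EZ_structure_def using EZ_structure_product by blast
qed

end
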